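(* Let $(X,d)$ be a complete separable metric space, let $\gamma:\mathbb{R}_+\to\mathbb{R}_+$ be a lower-semicontinuous function with $\gamma(0)=0$ and $\gamma(u+v)\le C(\gamma(u)+\gamma(v))$ for all $u,v\ge 0$ and some constant $C$, and let $c:X\times\mathcal{P}_\gamma(X)\to[0,\infty]$ be a (measurable) cost function. Assume that one of the conditions $(C)$, $(C')$, $(C'')$ spelled out in the context holds. Then for all $\mu,\nu\in\mathcal{P}_\gamma(X)$, $$\mathcal{T}_c(\nu|\mu)=\sup_{\varphi\in\Phi_{\gamma,b}(X)}\left\{\int R_c\varphi(x)\,\mu(dx)-\int\varphi(y)\,\nu(dy)\right\},$$ where $$R_c\varphi(x):=\inf_{p\in\mathcal{P}_\gamma(X)}\left\{\int\varphi(y)\,p(dy)+c(x,p)\right\},\qquad x\in X,\ \varphi\in\Phi_{\gamma,b}(X).$$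
   Context: $\mathcal{P}(X)$ is the set of Borel probability measures on $X$, and $\mathcal{P}_\gamma(X)=\{\mu\in\mathcal{P}(X):\int\gamma(d(x,x_o))\,\mu(dx)<\infty\}$ for some (hence all) $x_o\in X$. $\Phi_\gamma(X)$ is the set of continuous $\varphi:X\to\mathbb{R}$ such that $|\varphi(x)|\le a+b\,\gamma(d(x,x_o))$ for all $x$, for some $a,b\ge0$; $\Phi_{\gamma,b}(X)$ is the set of elements of $\Phi_\gamma(X)$ that are bounded from below. $\mathcal{P}_\gamma(X)$ carries the topology $\sigma(\mathcal{P}_\gamma(X))$, the coarsest one making $\mu\mapsto\int\varphi\,d\mu$ continuous for every $\varphi\in\Phi_\gamma(X)$; its measurable structure is the $\sigma$-field generated by the maps $\nu\mapsto\nu(A)$, $A$ Borel. $\mathcal{P}_\gamma(X\times X)$ and $\sigma(\mathcal{P}_\gamma(X\times X))$ are defined in the same way, with $\Phi_\gamma(X\times X)$ the set of continuous $\varphi$ such that $|\varphi(x,y)|\le a+b(\gamma(d(x_o,x))+\gamma(d(x_o,y)))$ for some $a,b\ge 0$, $x_o\in X$. $\Pi(\mu,\nu)$ is the set of couplings, i.e. probability measures on $X\times X$ with first marginal $\mu$ and second marginal $\nu$. For $\pi\in\mathcal{P}_\gamma(X\times X)$ with first marginal $\pi_1$, write $\pi(dxdy)=\pi_1(dx)p_x(dy)$ (disintegration) and $I_c[\pi]=\int c(x,p_x)\,\pi_1(dx)$. The transport cost is $\mathcal{T}_c(\nu|\mu)=\inf_{\pi\in\Pi(\mu,\nu)}I_c[\pi]$.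 Conditions: - $(C_1)$: for all $\mu\in\mathcal{P}_\gamma(X)$, $\pi\mapsto I_c[\pi]$ is lower-semicontinuous on $\{\pi\in\mathcal{P}_\gamma(X\times X):\pi(dx\times X)=\mu(dx)\}$ for $\sigma(\mathcal{P}_\gamma(X\times X))$. - $(C_2)$: $p\mapsto c(x,p)$ is convex for all $x\in X$. - $(C_3)$: $(x,p)\mapsto c(x,p)$ is continuous for the product topology. - $(C_3')$: $(X,d)$ is compact and $(x,p)\mapsto c(x,p)$ is lower-semicontinuous for the product topology. - $(C_3'')$: $X$ is a countable set of isolated points and for all $x\in X$, $p\mapsto c(x,p)$ is lower-semicontinuous. - $(C_4)$: if $\mu\in\mathcal{P}_\gamma(X)$ and $(p_x)_{x\in X}$ is a measurable probability kernel with $p_x\in\mathcal{P}_\gamma(X)$ for all $x$ and $\int c(x,p_x)\,\mu(dx)<\infty$, then $\mu p:=\int p_x(\cdot)\,\mu(dx)\in\mathcal{P}_\gamma(X)$. Condition $(C)$ means $(C_1),(C_2),(C_3),(C_4)$; condition $(C')$ means $(C_1),(C_2),(C_3'),(C_4)$; condition $(C'')$ means $(C_2),(C_3''),(C_4)$. *)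

theory Defs
  imports "HOL-Probability.Probability"
begin

section \<open>Moment-constrained probability measures and their topology\<close>

text \<open>
  Everything is first defined relative to a weight \<open>w\<close>, so that the constructions on the space
  \<open>X\<close> (the type \<open>'a\<close>) and on \<open>X \<times> X\<close> are instances of the same definitions.
\<close>

definition P_weight :: "('z::topological_space \<Rightarrow> real) \<Rightarrow> 'z measure set" where
  "P_weight w = {\<mu>. sets \<mu> = sets borel \<and> prob_space \<mu> \<and> (\<integral>\<^sup>+ z. ennreal (w z) \<partial>\<mu>) < \<infinity>}"

definition Phi_weight :: "('z::topological_space \<Rightarrow> real) \<Rightarrow> ('z \<Rightarrow> real) set" where
  "Phi_weight w =
     {\<phi>. continuous_on UNIV \<phi> \<and> (\<exists>a\<ge>0. \<exists>b\<ge>0. \<forall>z. \<bar>\<phi> z\<bar> \<le> a + b * w z)}"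

text \<open>
  The coarsest topology on \<open>P_weight w\<close> making all \<open>\<mu> \<mapsto> \<integral>\<phi> d\<mu>\<close> continuous; taking the zero
  function for \<open>\<phi>\<close> shows that its underlying set is \<open>P_weight w\<close>.
\<close>

definition sigma_topology :: "('z::topological_space \<Rightarrow> real) \<Rightarrow> 'z measure topology" where
  "sigma_topology w = topology_generated_by
     {{\<mu> \<in> P_weight w. (\<integral>z. \<phi> z \<partial>\<mu>) \<in> U} | \<phi> U. \<phi> \<in> Phi_weight w \<and> open U}"

lemma topspace_sigma_topology: "topspace (sigma_topology w) = P_weight w"
proof -
  have "(\<lambda>_. 0) \<in> Phi_weight w"
    by (auto simp: Phi_weight_def intro!: exI[of _ "0::real"])
  then have "{\<mu> \<in> P_weight w. (\<integral>z. 0 \<partial>\<mu>) \<in> (UNIV :: real set)} \<in>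
      {{\<mu> \<in> P_weight w. (\<integral>z. \<phi> z \<partial>\<mu>) \<in> U} | \<phi> U. \<phi> \<in> Phi_weight w \<and> open U}"
    by (intro CollectI exI[of _ "\<lambda>_. 0"] exI[of _ UNIV]) auto
  then show ?thesis
    unfolding sigma_topology_def topology_generated_by_topspace by auto
qed

text \<open>
  The base point \<open>xo\<close> is an explicit parameter, the same one throughout. If the moment condition
  does not depend on the base point (e.g. if \<open>\<gamma>\<close> is nondecreasing), then none of the notions
  below does. Only the values of \<open>\<gamma>\<close> on nonnegative reals are used.
\<close>

definition weight1 :: "(real \<Rightarrow> real) \<Rightarrow> 'a::metric_space \<Rightarrow> 'a \<Rightarrow> real" where
  "weight1 \<gamma> xo = (\<lambda>x. \<gamma> (dist x xo))"

definition weight2 :: "(real \<Rightarrow> real) \<Rightarrow> 'a::metric_space \<Rightarrow> 'a \<times> 'a \<Rightarrow> real" where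
  "weight2 \<gamma> xo = (\<lambda>(x, y). \<gamma> (dist xo x) + \<gamma> (dist xo y))"

definition P_gamma :: "(real \<Rightarrow> real) \<Rightarrow> 'a::metric_space \<Rightarrow> 'a measure set" where
  "P_gamma \<gamma> xo = P_weight (weight1 \<gamma> xo)"

definition P_gamma2 :: "(real \<Rightarrow> real) \<Rightarrow> 'a::metric_space \<Rightarrow> ('a \<times> 'a) measure set" where
  "P_gamma2 \<gamma> xo = P_weight (weight2 \<gamma> xo)"

definition Phi_gamma_b :: "(real \<Rightarrow> real) \<Rightarrow> 'a::metric_space \<Rightarrow> ('a \<Rightarrow> real) set" where
  "Phi_gamma_b \<gamma> xo = {\<phi> \<in> Phi_weight (weight1 \<gamma> xo). bdd_below (range \<phi>)}"

definition sigma_P :: "(real \<Rightarrow> real) \<Rightarrow> 'a::metric_space \<Rightarrow> 'a measure topology" where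
  "sigma_P \<gamma> xo = sigma_topology (weight1 \<gamma> xo)"

definition sigma_P2 :: "(real \<Rightarrow> real) \<Rightarrow> 'a::metric_space \<Rightarrow> ('a \<times> 'a) measure topology" where
  "sigma_P2 \<gamma> xo = sigma_topology (weight2 \<gamma> xo)"

text \<open>
  The measurable structure generated by the evaluations \<open>\<nu> \<mapsto> \<nu>(A)\<close>: the trace of the
  Giry \<open>\<sigma>\<close>-algebra.
\<close>

definition P_gamma_algebra :: "(real \<Rightarrow> real) \<Rightarrow> 'a::metric_space \<Rightarrow> 'a measure measure" where
  "P_gamma_algebra \<gamma> xo = restrict_space (prob_algebra borel) (P_gamma \<gamma> xo)"


section \<open>Transport costs\<close>

text \<open>
  A cost is a function \<open>c\<close> of type \<open>'a \<Rightarrow> 'a measure \<Rightarrow> ennreal\<close>; only its values \<open>c x p\<close> with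
  \<open>p \<in> P_gamma \<gamma> xo\<close> are ever used.
\<close>

definition couplings :: "'a::metric_space measure \<Rightarrow> 'a measure \<Rightarrow> ('a \<times> 'a) measure set" where
  "couplings \<mu> \<nu> = {\<pi>. sets \<pi> = sets borel \<and> prob_space \<pi> \<and>
     distr \<pi> borel fst = \<mu> \<and> distr \<pi> borel snd = \<nu>}"

definition P_gamma_kernels :: "(real \<Rightarrow> real) \<Rightarrow> 'a::metric_space \<Rightarrow> ('a \<Rightarrow> 'a measure) set" where
  "P_gamma_kernels \<gamma> xo = {p \<in> borel \<rightarrow>\<^sub>M prob_algebra borel. \<forall>x. p x \<in> P_gamma \<gamma> xo}"

text \<open>
  \<open>\<pi>(dxdy) = \<pi>\<^sub>1(dx) p\<^sub>x(dy)\<close>. If \<open>\<pi>\<close> satisfies the moment condition, then \<open>p\<^sub>x\<close> does so for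
  almost every \<open>x\<close>, hence there is a version for which this is true everywhere.
\<close>

definition disintegrates ::
    "(real \<Rightarrow> real) \<Rightarrow> 'a::metric_space \<Rightarrow> ('a \<times> 'a) measure \<Rightarrow> ('a \<Rightarrow> 'a measure) \<Rightarrow> bool" where
  "disintegrates \<gamma> xo \<pi> p \<longleftrightarrow> p \<in> P_gamma_kernels \<gamma> xo \<and>
     (\<forall>A\<in>sets borel. \<forall>B\<in>sets borel.
        emeasure \<pi> (A \<times> B) = (\<integral>\<^sup>+ x\<in>A. emeasure (p x) B \<partial>distr \<pi> borel fst))"

text \<open>The value does not depend on the chosen version, as these agree almost everywhere.\<close>

definition I_cost ::
    "(real \<Rightarrow> real) \<Rightarrow> 'a::metric_space \<Rightarrow> ('a \<Rightarrow> 'a measure \<Rightarrow> ennreal) \<Rightarrow>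
      ('a \<times> 'a) measure \<Rightarrow> ennreal" where
  "I_cost \<gamma> xo c \<pi> =
     (let p = (SOME p. disintegrates \<gamma> xo \<pi> p) in \<integral>\<^sup>+ x. c x (p x) \<partial>distr \<pi> borel fst)"

text \<open>The argument order is that of \<open>\<T>\<^sub>c(\<nu>|\<mu>)\<close>: the second marginal comes first.\<close>

definition T_cost ::
    "(real \<Rightarrow> real) \<Rightarrow> 'a::metric_space \<Rightarrow> ('a \<Rightarrow> 'a measure \<Rightarrow> ennreal) \<Rightarrow>
      'a measure \<Rightarrow> 'a measure \<Rightarrow> ennreal" where
  "T_cost \<gamma> xo c \<nu> \<mu> = (INF \<pi>\<in>couplings \<mu> \<nu>. I_cost \<gamma> xo c \<pi>)"

definition R_cost ::
    "(real \<Rightarrow> real) \<Rightarrow> 'a::metric_space \<Rightarrow> ('a \<Rightarrow> 'a measure \<Rightarrow> ennreal) \<Rightarrow>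
      ('a \<Rightarrow> real) \<Rightarrow> 'a \<Rightarrow> ereal" where
  "R_cost \<gamma> xo c \<phi> x =
     (INF p\<in>P_gamma \<gamma> xo. ereal (\<integral>y. \<phi> y \<partial>p) + enn2ereal (c x p))"

text \<open>
  Integral of an extended-real function: positive part minus negative part (\<open>e2ennreal\<close> maps
  negative numbers to \<open>0\<close>). It is only applied to functions bounded from below, so the
  subtrahend is finite.
\<close>

definition ereal_integral :: "'z measure \<Rightarrow> ('z \<Rightarrow> ereal) \<Rightarrow> ereal" where
  "ereal_integral M f =
     enn2ereal (\<integral>\<^sup>+ z. e2ennreal (f z) \<partial>M) - enn2ereal (\<integral>\<^sup>+ z. e2ennreal (- f z) \<partial>M)"


section \<open>The conditions on the cost\<close>

definition lsc_map :: "'z topology \<Rightarrow> ('z \<Rightarrow> 'b::linorder) \<Rightarrow> bool" where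
  "lsc_map T f \<longleftrightarrow> (\<forall>a. openin T {z \<in> topspace T. a < f z})"

text \<open>The convex combination \<open>(1 - t) p + t q\<close> of two Borel measures.\<close>

definition mixture :: "real \<Rightarrow> 'a::topological_space measure \<Rightarrow> 'a measure \<Rightarrow> 'a measure" where
  "mixture t p q = measure_of UNIV (sets borel)
     (\<lambda>A. ennreal (1 - t) * emeasure p A + ennreal t * emeasure q A)"

lemma emeasure_mixture:
  assumes "sets p = sets borel" "sets q = sets borel" "A \<in> sets borel"
  shows "emeasure (mixture t p q) A = ennreal (1 - t) * emeasure p A + ennreal t * emeasure q A"
  unfolding mixture_def
proof (rule emeasure_measure_of_sigma)
  show "sigma_algebra UNIV (sets borel)"
    using sets.sigma_algebra_axioms[of borel] by simp
  show "positive (sets borel) (\<lambda>A. ennreal (1 - t) * emeasure p A + ennreal t * emeasure q A)"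
    by (simp add: positive_def)
  show "countably_additive (sets borel)
      (\<lambda>A. ennreal (1 - t) * emeasure p A + ennreal t * emeasure q A)"
    using assms(1,2)
    by (auto simp: countably_additive_def suminf_add[symmetric] ennreal_suminf_cmult suminf_emeasure)
qed fact

definition C1 ::
    "(real \<Rightarrow> real) \<Rightarrow> 'a::metric_space \<Rightarrow> ('a \<Rightarrow> 'a measure \<Rightarrow> ennreal) \<Rightarrow> bool" where
  "C1 \<gamma> xo c \<longleftrightarrow> (\<forall>\<mu>\<in>P_gamma \<gamma> xo.
     lsc_map (subtopology (sigma_P2 \<gamma> xo) {\<pi> \<in> P_gamma2 \<gamma> xo. distr \<pi> borel fst = \<mu>})
       (I_cost \<gamma> xo c))"

definition C2 ::
    "(real \<Rightarrow> real) \<Rightarrow> 'a::metric_space \<Rightarrow> ('a \<Rightarrow> 'a measure \<Rightarrow> ennreal) \<Rightarrow> bool" where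
  "C2 \<gamma> xo c \<longleftrightarrow> (\<forall>x. \<forall>p\<in>P_gamma \<gamma> xo. \<forall>q\<in>P_gamma \<gamma> xo. \<forall>t\<in>{0..1}.
     c x (mixture t p q) \<le> ennreal (1 - t) * c x p + ennreal t * c x q)"

definition C3 ::
    "(real \<Rightarrow> real) \<Rightarrow> 'a::metric_space \<Rightarrow> ('a \<Rightarrow> 'a measure \<Rightarrow> ennreal) \<Rightarrow> bool" where
  "C3 \<gamma> xo c \<longleftrightarrow>
     continuous_map (prod_topology euclidean (sigma_P \<gamma> xo)) euclidean (\<lambda>(x, p). c x p)"

definition C3' ::
    "(real \<Rightarrow> real) \<Rightarrow> 'a::metric_space \<Rightarrow> ('a \<Rightarrow> 'a measure \<Rightarrow> ennreal) \<Rightarrow> bool" where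
  "C3' \<gamma> xo c \<longleftrightarrow> compact (UNIV :: 'a set) \<and>
     lsc_map (prod_topology euclidean (sigma_P \<gamma> xo)) (\<lambda>(x, p). c x p)"

definition C3'' ::
    "(real \<Rightarrow> real) \<Rightarrow> 'a::metric_space \<Rightarrow> ('a \<Rightarrow> 'a measure \<Rightarrow> ennreal) \<Rightarrow> bool" where
  "C3'' \<gamma> xo c \<longleftrightarrow> countable (UNIV :: 'a set) \<and> (\<forall>x::'a. x isolated_in UNIV) \<and>
     (\<forall>x. lsc_map (sigma_P \<gamma> xo) (c x))"

definition C4 ::
    "(real \<Rightarrow> real) \<Rightarrow> 'a::metric_space \<Rightarrow> ('a \<Rightarrow> 'a measure \<Rightarrow> ennreal) \<Rightarrow> bool" where
  "C4 \<gamma> xo c \<longleftrightarrow> (\<forall>\<mu>\<in>P_gamma \<gamma> xo. \<forall>p\<in>P_gamma_kernels \<gamma> xo.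
     (\<integral>\<^sup>+ x. c x (p x) \<partial>\<mu>) < \<infinity> \<longrightarrow> (\<mu> \<bind> p) \<in> P_gamma \<gamma> xo)"

definition cond_C ::
    "(real \<Rightarrow> real) \<Rightarrow> 'a::metric_space \<Rightarrow> ('a \<Rightarrow> 'a measure \<Rightarrow> ennreal) \<Rightarrow> bool" where
  "cond_C \<gamma> xo c \<longleftrightarrow> C1 \<gamma> xo c \<and> C2 \<gamma> xo c \<and> C3 \<gamma> xo c \<and> C4 \<gamma> xo c"

definition cond_C' ::
    "(real \<Rightarrow> real) \<Rightarrow> 'a::metric_space \<Rightarrow> ('a \<Rightarrow> 'a measure \<Rightarrow> ennreal) \<Rightarrow> bool" where
  "cond_C' \<gamma> xo c \<longleftrightarrow> C1 \<gamma> xo c \<and> C2 \<gamma> xo c \<and> C3' \<gamma> xo c \<and> C4 \<gamma> xo c"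

definition cond_C'' ::
    "(real \<Rightarrow> real) \<Rightarrow> 'a::metric_space \<Rightarrow> ('a \<Rightarrow> 'a measure \<Rightarrow> ennreal) \<Rightarrow> bool" where
  "cond_C'' \<gamma> xo c \<longleftrightarrow> C2 \<gamma> xo c \<and> C3'' \<gamma> xo c \<and> C4 \<gamma> xo c"

end

theory Submission
  imports Defs
begin

text \<open>
  By disintegration, \<open>T\<^sub>c(\<nu>|\<mu>)\<close> is the infimum of \<open>\<integral> c(x, p\<^sub>x) d\<mu>\<close> over kernels \<open>p\<close> with
  \<open>\<mu>p = \<nu>\<close>. It is convex in \<open>\<nu>\<close> by \<open>(C2)\<close>, and lower semicontinuous: along a filter of kernels
  with bounded cost and \<open>\<mu>p \<rightarrow> \<nu>\<close>, Tychonoff's theorem gives a limit of the values on rectangles,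
  which is again given by a kernel, and the convergence can be improved so that \<open>(C1)\<close> applies.
  Lower semicontinuity involves finitely many test functions only, so a finite-dimensional separation
  argument yields \<open>\<phi>\<close> with \<open>\<integral>\<phi> d(\<mu>p) + \<integral> c(x, p\<^sub>x) d\<mu> \<ge> \<alpha> + \<integral>\<phi> d\<nu>\<close> for all \<open>p\<close>, where
  \<open>\<alpha> < T\<^sub>c(\<nu>|\<mu>)\<close>; truncating \<open>\<phi>\<close> from below costs arbitrarily little. Finally the infimum over
  \<open>p\<close> is moved inside the \<open>\<mu>\<close>-integral by selecting a nearly optimal \<open>p\<^sub>x\<close> measurably in \<open>x\<close>:
  from countably many constant kernels under \<open>(C3)\<close> (Lindelof), as a minimiser over the compact
  sets \<open>{p. \<integral>w dp \<le> n}\<close> under \<open>(C3')\<close>, and trivially under \<open>(C3'')\<close>, which also implies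
  \<open>(C1)\<close>. All that is used of \<open>\<gamma>\<close> is that the weight \<open>w(x) = \<gamma>(d(x, x\<^sub>o))\<close> is nonnegative, lower
  semicontinuous and zero at \<open>x\<^sub>o\<close>.
\<close>

section \<open>Kernels from bimeasures\<close>

text \<open>The topologies involved need not be metrizable, so limits are taken along filters.
  Setwise limits lose countable additivity in the second coordinate: for Dirac masses at 1/n, the
  singleton {0} gets no mass. Hence a kernel extracted from such a limit lies below it on open sets
  only, and this portmanteau inequality is all that is carried on. In the first coordinate nothing
  is lost, because all couplings have first marginal \<mu>.

  The topology in (C1) tests with functions f(x,y) of growth w(x) + w(y). As w need not be
  continuous, it is no test function and gives no continuous dominating function. Over a compact set
  of x on which w is bounded, the supremum of |f(x,y)| over x does; elsewhere all kernels are
  replaced by one fixed kernel of finite cost, whose contribution off large compact sets is small.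

  (C4) makes the separation possible: a kernel of finite cost has a second marginal against which
  all test functions are integrable. The bound on the multipliers is \<alpha>/\<epsilon>, where
  \<epsilon> is the radius of the neighbourhood of \<nu> in which the cost is at least
  \<alpha>.\<close>

locale bimeasure = prob_space M for M :: "'x measure" +
  fixes m :: "'x set \<Rightarrow> 'a::polish_space set \<Rightarrow> real"
  assumes nonneg: "A \<in> sets M \<Longrightarrow> B \<in> sets borel \<Longrightarrow> 0 \<le> m A B"
    and add_left: "A \<in> sets M \<Longrightarrow> A' \<in> sets M \<Longrightarrow> B \<in> sets borel \<Longrightarrow> A \<inter> A' = {} \<Longrightarrow>
      m (A \<union> A') B = m A B + m A' B"
    and add_right: "A \<in> sets M \<Longrightarrow> B \<in> sets borel \<Longrightarrow> B' \<in> sets borel \<Longrightarrow> B \<inter> B' = {} \<Longrightarrow>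
      m A (B \<union> B') = m A B + m A B'"
    and total: "A \<in> sets M \<Longrightarrow> m A UNIV = measure M A"
    and closed_empty: "\<And>C. (\<And>n::nat. closed (C n)) \<Longrightarrow> decseq C \<Longrightarrow> (\<Inter>n. C n) = {} \<Longrightarrow>
      (\<lambda>n. m (space M) (C n)) \<longlonglongrightarrow> 0"
begin

lemma empty_right: "A \<in> sets M \<Longrightarrow> m A {} = 0"
  using add_right[of A "{}" "{}"] by simp

lemma empty_left: "B \<in> sets borel \<Longrightarrow> m {} B = 0"
  using add_left[of "{}" "{}" B] by simp

lemma mono_right:
  assumes "A \<in> sets M" "B \<in> sets borel" "B' \<in> sets borel" "B \<subseteq> B'"
  shows "m A B \<le> m A B'"
proof -
  have "B' = B \<union> (B' - B)" using assms by auto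
  then have "m A B' = m A B + m A (B' - B)"
    using add_right[of A B "B' - B"] assms by (metis Diff_disjoint sets.Diff)
  then show ?thesis using nonneg[of A "B' - B"] assms by simp
qed

lemma le_measure: "A \<in> sets M \<Longrightarrow> B \<in> sets borel \<Longrightarrow> m A B \<le> measure M A"
  using mono_right[of A B UNIV] total by simp

lemma sum_right:
  assumes "A \<in> sets M" "finite T" "\<And>s. s \<in> T \<Longrightarrow> B s \<in> sets borel" "disjoint_family_on B T"
  shows "m A (\<Union>s\<in>T. B s) = (\<Sum>s\<in>T. m A (B s))"
  using assms(2-4)
proof (induction T)
  case empty
  then show ?case using assms(1) by (simp add: empty_right)
next
  case (insert s T)
  have "m A (B s \<union> (\<Union>s\<in>T. B s)) = m A (B s) + m A (\<Union>s\<in>T. B s)"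
    using insert assms(1) by (intro add_right) (auto simp: disjoint_family_on_def)
  then show ?case using insert by (simp add: disjoint_family_on_def)
qed

text \<open>Only finite additivity in the first argument is assumed. The bound by
  \<open>measure M A\<close> from \<open>le_measure\<close> gives continuity at the empty set and
  absolute continuity, so Radon-Nikodym applies for each fixed \<open>B\<close>.\<close>

lemma ex_density:
  assumes B: "B \<in> sets borel"
  shows "\<exists>k\<in>borel_measurable M. (\<forall>x. 0 \<le> k x) \<and>
    (\<forall>A\<in>sets M. (\<integral>\<^sup>+x\<in>A. ennreal (k x) \<partial>M) = ennreal (m A B))"
proof -
  define f where "f = (\<lambda>A. ennreal (m A B))"
  have pos: "positive (sets M) f"
    using B by (simp add: f_def positive_def empty_left)
  have addf: "additive (sets M) f"
    using B by (auto simp: f_def additive_def add_left nonneg)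
  have "countably_additive (sets M) f"
  proof (rule sets.empty_continuous_imp_countably_additive[OF pos addf])
    show "\<forall>A\<in>sets M. f A \<noteq> \<infinity>" by (simp add: f_def)
    fix A :: "nat \<Rightarrow> 'x set" assume A: "range A \<subseteq> sets M" "decseq A" "(\<Inter>i. A i) = {}"
    have "(\<lambda>i. emeasure M (A i)) \<longlonglongrightarrow> emeasure M (\<Inter>i. A i)"
      using A by (intro Lim_emeasure_decseq) auto
    then have lim: "(\<lambda>i. emeasure M (A i)) \<longlonglongrightarrow> 0" using A(3) by simp
    have le: "f (A i) \<le> emeasure M (A i)" for i
      using A B le_measure[of "A i" B] by (simp add: f_def emeasure_eq_measure ennreal_leI image_subset_iff)
    show "(\<lambda>i. f (A i)) \<longlonglongrightarrow> 0"
      by (rule tendsto_sandwich[OF _ _ tendsto_const lim]) (auto simp: le)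
  qed
  with pos have ms: "measure_space (space M) (sets M) f"
    by (simp add: measure_space_def sets.sigma_algebra_axioms)
  define N where "N = measure_of (space M) (sets M) f"
  have sN: "sets N = sets M" by (simp add: N_def)
  have eN: "emeasure N A = f A" if "A \<in> sets M" for A
    unfolding N_def using that ms
    by (intro emeasure_measure_of_sigma) (auto simp: measure_space_def)
  have "absolutely_continuous M N"
    unfolding absolutely_continuous_def
  proof
    fix A assume A: "A \<in> null_sets M"
    then have "m A B \<le> 0" using le_measure[of A B] B by (simp add: null_setsD1 measure_def null_setsD2)
    then show "A \<in> null_sets N" using A eN[of A] sN by (simp add: null_sets_def f_def ennreal_neg)
  qed
  then obtain g where g: "g \<in> borel_measurable M" "density M g = N"
    using Radon_Nikodym sN by blast
  have "(\<integral>\<^sup>+x. g x \<partial>M) = emeasure N (space M)"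
    unfolding g(2)[symmetric] using g(1) by (subst emeasure_density) (auto intro!: nn_integral_cong)
  then have "(\<integral>\<^sup>+x. g x \<partial>M) \<noteq> \<infinity>" using eN[of "space M"] by (simp add: f_def)
  then have fin: "AE x in M. g x \<noteq> \<infinity>" using g(1) by (intro nn_integral_noteq_infinite) auto
  show ?thesis
  proof (intro bexI[of _ "\<lambda>x. enn2real (g x)"] conjI ballI allI)
    fix A assume A: "A \<in> sets M"
    have "(\<integral>\<^sup>+x\<in>A. ennreal (enn2real (g x)) \<partial>M) = (\<integral>\<^sup>+x\<in>A. g x \<partial>M)"
      using fin by (intro nn_integral_cong_AE) (auto simp: less_top)
    also have "\<dots> = emeasure N A"
      unfolding g(2)[symmetric] using g(1) A by (simp add: emeasure_density)
    finally show "(\<integral>\<^sup>+x\<in>A. ennreal (enn2real (g x)) \<partial>M) = ennreal (m A B)"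
      using eN[OF A] by (simp add: f_def)
  qed (use g in auto)
qed

end

section \<open>Sampling a random point from nested cells\<close>

primrec cell :: "(nat \<Rightarrow> 'a set) \<Rightarrow> bool list \<Rightarrow> 'a set" where
  "cell B [] = UNIV"
| "cell B (b # s) = cell B s \<inter> (if b then B (length s) else - B (length s))"

text \<open>The newest test sits at the head of a code: \<open>b # s\<close> refines
  \<open>s\<close> by membership in \<open>B (length s)\<close>. Two codes of equal length differ
  either in their tails, where the induction applies, or only in the head, where the last set
  separates the cells.\<close>

lemma cell_disjoint: "length s = length t \<Longrightarrow> s \<noteq> t \<Longrightarrow> cell B s \<inter> cell B t = {}"
proof (induction s arbitrary: t)
  case (Cons b s)
  then obtain b' t' where t: "t = b' # t'" "length s = length t'" by (metis length_Suc_conv)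
  show ?case
  proof (cases "s = t'")
    case True
    with Cons.prems t have "b \<noteq> b'" by auto
    with True t show ?thesis by auto
  next
    case False
    with Cons.IH[OF t(2)] t show ?thesis by auto
  qed
qed simp

lemma cell_borel: "(\<And>n. B n \<in> sets borel) \<Longrightarrow> cell B s \<in> sets borel"
  by (induction s) auto

locale cell_densities =
  fixes M :: "'x measure" and k :: "bool list \<Rightarrow> 'x \<Rightarrow> real"
  assumes meas [measurable]: "\<And>s. k s \<in> borel_measurable M"
    and nonneg: "\<And>s x. 0 \<le> k s x"
    and one: "\<And>x. k [] x = 1"
    and split: "\<And>s x. k (True # s) x + k (False # s) x = k s x"

text \<open>The densities \<open>k s\<close> are a version of \<open>P(cell s | x)\<close>, consistent at every point.\<close>

lemma (in bimeasure) ex_cell_densities: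
  assumes B: "\<And>n. B n \<in> sets borel"
  shows "\<exists>k. cell_densities M k \<and>
    (\<forall>s. \<forall>A\<in>sets M. (\<integral>\<^sup>+x\<in>A. ennreal (k s x) \<partial>M) = ennreal (m A (cell B s))) \<and>
    (\<forall>s x. cell B s = {} \<longrightarrow> k s x = 0)"
proof -
  have "\<forall>s. \<exists>k\<in>borel_measurable M. (\<forall>x. 0 \<le> k x) \<and>
    (\<forall>A\<in>sets M. (\<integral>\<^sup>+x\<in>A. ennreal (k x) \<partial>M) = ennreal (m A (cell B s)))"
    by (rule allI, rule ex_density, rule cell_borel[OF B])
  then have "\<exists>k. \<forall>s. k s \<in> borel_measurable M \<and> (\<forall>x. 0 \<le> k s x) \<and>
    (\<forall>A\<in>sets M. (\<integral>\<^sup>+x\<in>A. ennreal (k s x) \<partial>M) = ennreal (m A (cell B s)))"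
    unfolding Bex_def by (rule choice)
  then obtain k where k: "\<And>s. k s \<in> borel_measurable M" "\<And>s x. 0 \<le> k s x"
    "\<And>s A. A \<in> sets M \<Longrightarrow> (\<integral>\<^sup>+x\<in>A. ennreal (k s x) \<partial>M) = ennreal (m A (cell B s))"
    by auto
  note [measurable] = k(1)
  have un: "AE x in M. f x = g x" if [measurable]: "f \<in> borel_measurable M" "g \<in> borel_measurable M"
    and pos: "\<And>x. 0 \<le> f x" "\<And>x. 0 \<le> g x"
    and "\<And>A. A \<in> sets M \<Longrightarrow> (\<integral>\<^sup>+x\<in>A. ennreal (f x) \<partial>M) = (\<integral>\<^sup>+x\<in>A. ennreal (g x) \<partial>M)"
    for f g :: "'x \<Rightarrow> real"
  proof -
    have "AE x in M. ennreal (f x) = ennreal (g x)"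
      using that by (intro density_unique_finite_measure) auto
    then show ?thesis using pos by (auto simp: ennreal_inj)
  qed
  have e: "AE x in M. k [] x = 1"
    by (rule un) (auto simp: k total emeasure_eq_measure)
  \<comment> \<open>There are countably many codes, so one \<open>s\<close> may be treated at a
    time; functions with equal integrals over all measurable sets agree almost everywhere.\<close>
  have a: "AE x in M. \<forall>s. k (True # s) x + k (False # s) x = k s x"
  proof (subst AE_all_countable, intro allI un)
    fix s and A assume A: "A \<in> sets M"
    have c: "cell B s = cell B (True # s) \<union> cell B (False # s)" by auto
    have mm: "m A (cell B s) = m A (cell B (True # s)) + m A (cell B (False # s))"
      by (subst c, rule add_right) (use A cell_borel[OF B] B in auto)
    have "(\<integral>\<^sup>+x\<in>A. ennreal (k (True # s) x + k (False # s) x) \<partial>M) =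
      (\<integral>\<^sup>+x. ennreal (k (True # s) x) * indicator A x + ennreal (k (False # s) x) * indicator A x \<partial>M)"
      by (intro nn_integral_cong) (auto simp: k distrib_right split: split_indicator)
    also have "\<dots> = ennreal (m A (cell B (True # s))) + ennreal (m A (cell B (False # s)))"
      using A by (subst nn_integral_add) (auto simp: k(3) simp del: cell.simps)
    also have "\<dots> = ennreal (m A (cell B s))"
      unfolding mm using nonneg[OF A] cell_borel[OF B] by (simp del: cell.simps)
    finally show "(\<integral>\<^sup>+x\<in>A. ennreal (k (True # s) x + k (False # s) x) \<partial>M) =
        (\<integral>\<^sup>+x\<in>A. ennreal (k s x) \<partial>M)"
      using k(3)[OF A] by simp
  qed (auto simp: k add_nonneg_nonneg)
  have z: "AE x in M. \<forall>s. cell B s = {} \<longrightarrow> k s x = 0"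
  proof (subst AE_all_countable, rule allI)
    fix s
    show "AE x in M. cell B s = {} \<longrightarrow> k s x = 0"
    proof (cases "cell B s = {}")
      case True
      have "AE x in M. k s x = 0"
        by (rule un) (auto simp: k True empty_right)
      then show ?thesis by auto
    qed simp
  qed
  define good where "good x \<longleftrightarrow> k [] x = 1 \<and> (\<forall>s. k (True # s) x + k (False # s) x = k s x) \<and>
      (\<forall>s. cell B s = {} \<longrightarrow> k s x = 0)" for x
  have ae: "AE x in M. good x"
    unfolding good_def using e a z by (intro AE_conjI)
  obtain N where N: "\<And>x. x \<in> space M - N \<Longrightarrow> good x" "N \<in> null_sets M"
    by (rule AE_E3[OF ae], rule that)
  have "space M - N \<noteq> {}"
  proof
    assume "space M - N = {}"
    then have "space M = N" using sets.sets_into_space[OF null_setsD2[OF N(2)]] by auto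
    then show False using null_setsD1[OF N(2)] emeasure_space_1 by simp
  qed
  then obtain x0 where x0: "x0 \<in> space M - N" by auto
  \<comment> \<open>On the exceptional null set all densities are frozen at one good point
    \<open>x0\<close>. The identities then hold at every point, as the subdivision of the unit
    interval needs, and the integrals do not change.\<close>
  define k' where "k' s x = k s (if x \<in> space M - N then x else x0)" for s x
  have pk: "k' [] x = 1 \<and> (\<forall>s. k' (True # s) x + k' (False # s) x = k' s x) \<and>
      (\<forall>s. cell B s = {} \<longrightarrow> k' s x = 0)" for x
    using N(1)[of "if x \<in> space M - N then x else x0"] x0 unfolding k'_def good_def by simp
  have "k' s \<in> borel_measurable M" for s
  proof -
    have [measurable]: "N \<in> sets M" using N(2) by (rule null_setsD2)
    have "(\<lambda>x. if x \<in> N then k s x0 else k s x) \<in> borel_measurable M" by measurable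
    then show ?thesis by (rule measurable_cong[THEN iffD1, rotated]) (auto simp: k'_def)
  qed
  moreover have "(\<integral>\<^sup>+x\<in>A. ennreal (k' s x) \<partial>M) = ennreal (m A (cell B s))" if "A \<in> sets M" for s A
  proof -
    have "(\<integral>\<^sup>+x\<in>A. ennreal (k' s x) \<partial>M) = (\<integral>\<^sup>+x\<in>A. ennreal (k s x) \<partial>M)"
      using AE_not_in[OF N(2)] AE_space
      by (intro nn_integral_cong_AE) (auto simp: k'_def elim!: eventually_elim2)
    with k(3)[OF that] show ?thesis by simp
  qed
  moreover have "0 \<le> k' s x" for s x
    by (simp add: k'_def k(2))
  ultimately show ?thesis using pk by (intro exI[of _ k'] conjI cell_densities.intro) blast+
qed

text \<open>
  For fixed \<open>x\<close>, subdivide \<open>[0, 1)\<close> into intervals of length \<open>k s x\<close>, one for each code \<open>s\<close> of a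
  given length. Sampling \<open>u\<close> uniformly and following the cells whose intervals contain \<open>u\<close> then
  produces a random point with the conditional law given \<open>x\<close>.
\<close>

primrec cell_start :: "(bool list \<Rightarrow> 'x \<Rightarrow> real) \<Rightarrow> bool list \<Rightarrow> 'x \<Rightarrow> real" where
  "cell_start k [] x = 0"
| "cell_start k (b # s) x = cell_start k s x + (if b then 0 else k (True # s) x)"

primrec code :: "(bool list \<Rightarrow> 'x \<Rightarrow> real) \<Rightarrow> nat \<Rightarrow> 'x \<Rightarrow> real \<Rightarrow> bool list" where
  "code k 0 x u = []"
| "code k (Suc n) x u =
    (u < cell_start k (code k n x u) x + k (True # code k n x u) x) # code k n x u"

lemma length_code [simp]: "length (code k n x u) = n"
  by (induction n) auto

definition U01 :: "real measure" where "U01 = uniform_measure lborel {0..<1}"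

lemma sets_U01 [simp, measurable_cong]: "sets U01 = sets borel"
  by (simp add: U01_def)

lemma space_U01 [simp]: "space U01 = UNIV"
  by (simp add: U01_def)

lemma prob_space_U01: "prob_space U01"
  unfolding U01_def by (intro prob_space_uniform_measure) auto

lemma AE_U01: "AE u in U01. 0 \<le> u \<and> u < 1"
  unfolding U01_def using AE_uniform_measureI[of "{0..<1::real}" lborel "\<lambda>u. 0 \<le> u \<and> u < 1"] by auto

lemma emeasure_U01_interval:
  assumes "0 \<le> a" "a \<le> b" "b \<le> 1"
  shows "emeasure U01 {a..<b} = ennreal (b - a)"
proof -
  have "{0..<1} \<inter> {a..<b} = {a..<b}" using assms by auto
  then show ?thesis using assms unfolding U01_def by (subst emeasure_uniform_measure) (auto simp: divide_ennreal_def)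
qed

context cell_densities
begin

lemma start_measurable [measurable]: "cell_start k s \<in> borel_measurable M"
proof (induction s)
  case (Cons b s)
  then have [measurable]: "cell_start k s \<in> borel_measurable M" .
  show ?case by (cases b) simp_all
qed simp

text \<open>A code takes countably many values, so the next bit may be examined with the current
  code held fixed. Joint measurability in the pair is what makes the sampled point define a
  kernel.\<close>

lemma code_measurable [measurable]:
  "(\<lambda>(x, u). code k n x u) \<in> M \<Otimes>\<^sub>M borel \<rightarrow>\<^sub>M count_space UNIV"
proof (induction n)
  case (Suc n)
  note [measurable] = Suc
  have "(\<lambda>s z. (snd z < cell_start k s (fst z) + k (True # s) (fst z)) # s) s
    \<in> M \<Otimes>\<^sub>M borel \<rightarrow>\<^sub>M count_space UNIV" for s
    by measurable
  then have "(\<lambda>z. (snd z < cell_start k (code k n (fst z) (snd z)) (fst z) +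
      k (True # code k n (fst z) (snd z)) (fst z)) # code k n (fst z) (snd z))
    \<in> M \<Otimes>\<^sub>M borel \<rightarrow>\<^sub>M count_space UNIV"
    by (rule measurable_compose_countable) (use Suc in \<open>simp add: case_prod_beta\<close>)
  then show ?case by (simp add: case_prod_beta)
qed simp

lemma code_measurable_snd: "code k n x \<in> borel \<rightarrow>\<^sub>M count_space UNIV"
proof (induction n)
  case (Suc n)
  have "(\<lambda>u. (u < cell_start k s x + k (True # s) x) # s) \<in> borel \<rightarrow>\<^sub>M count_space UNIV" for s
    by measurable
  then have "(\<lambda>u. (u < cell_start k (code k n x u) x +
      k (True # code k n x u) x) # code k n x u) \<in> borel \<rightarrow>\<^sub>M count_space UNIV"
    by (rule measurable_compose_countable) (use Suc in simp)
  then show ?case by simp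
qed simp

lemma code_eq_borel: "{u. code k n x u = s} \<in> sets borel"
  using measurable_sets[OF code_measurable_snd, of "{s}" n x] by (simp add: vimage_def)

lemma code_interval:
  assumes "0 \<le> u" "u < 1"
  shows "cell_start k (code k n x u) x \<le> u \<and>
    u < cell_start k (code k n x u) x + k (code k n x u) x"
proof (induction n)
  case 0
  then show ?case using assms by (simp add: one)
next
  case (Suc n)
  then show ?case using split[of "code k n x u" x] by auto
qed

lemma interval_subset:
  "{cell_start k (b # s) x..<cell_start k (b # s) x + k (b # s) x} \<subseteq>
    {cell_start k s x..<cell_start k s x + k s x}"
  using split[of s x] nonneg[of "True # s" x] nonneg[of "False # s" x] by (cases b) auto

lemma interval_01: "{cell_start k s x..<cell_start k s x + k s x} \<subseteq> {0..<1}"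
proof (induction s)
  case (Cons b s)
  then show ?case using interval_subset[of b s x] by (rule order_trans[rotated])
qed (simp add: one)

lemma code_eqI:
  "u \<in> {cell_start k s x..<cell_start k s x + k s x} \<Longrightarrow> code k (length s) x u = s"
proof (induction s)
  case (Cons b s)
  then have "code k (length s) x u = s" using interval_subset[of b s x] by blast
  then show ?case using Cons.prems split[of s x] by (cases b) auto
qed simp

text \<open>For \<open>u\<close> in the unit interval the code is \<open>s\<close> exactly when
  \<open>u\<close> lies in the interval of \<open>s\<close>, by \<open>code_interval\<close> and
  \<open>code_eqI\<close>; the length of that interval is \<open>k s x\<close>.\<close>

lemma emeasure_code_eq:
  assumes "length s = n"
  shows "emeasure U01 {u. code k n x u = s} = ennreal (k s x)"
proof -
  interpret U: prob_space U01 by (rule prob_space_U01)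
  define I where "I = {cell_start k s x..<cell_start k s x + k s x}"
  have "emeasure U01 {u. code k n x u = s} = emeasure U01 I"
  proof (rule emeasure_eq_AE)
    show "AE u in U01. u \<in> {u. code k n x u = s} \<longleftrightarrow> u \<in> I"
      using AE_U01
    proof eventually_elim
      case (elim u)
      then show ?case using code_interval[of u n x] code_eqI[of u s x] assms by (auto simp: I_def)
    qed
    show "I \<in> sets U01" by (simp add: I_def)
    show "{u. code k n x u = s} \<in> sets U01" by (simp add: code_eq_borel)
  qed
  also have "\<dots> = ennreal (k s x)"
  proof -
    have "0 \<le> cell_start k s x" by (induction s) (auto simp: nonneg add_nonneg_nonneg)
    moreover have "cell_start k s x + k s x \<le> 1"
    \<comment> \<open>If the interval is empty, the inclusion \<open>interval_01\<close> says
      nothing about its end points, so the bound by 1 is then shown by induction on the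
      code.\<close>
    proof (cases "k s x = 0")
      case True
      have "cell_start k t x + k t x \<le> 1" for t
      proof (induction t)
        case (Cons b t)
        then show ?case using split[of t x] nonneg[of "False # t" x] nonneg[of "True # t" x] by (cases b) auto
      qed (simp add: one)
      then show ?thesis .
    next
      case False
      then have "0 < k s x" using nonneg[of s x] by simp
      then show ?thesis using interval_01[of s x] by simp
    qed
    ultimately show ?thesis unfolding I_def using nonneg[of s x] by (subst emeasure_U01_interval) auto
  qed
  finally show ?thesis .
qed

lemma emeasure_code_in:
  assumes T: "\<And>s. s \<in> T \<Longrightarrow> length s = n"
  shows "emeasure U01 {u. code k n x u \<in> T} = (\<Sum>s\<in>T. ennreal (k s x))"
proof -
  have fin: "finite T"
    by (rule finite_subset[OF _ finite_lists_length_eq[of "UNIV :: bool set" n]]) (use T in auto)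
  have "{u. code k n x u \<in> T} = (\<Union>s\<in>T. {u. code k n x u = s})" by auto
  also have "emeasure U01 \<dots> = (\<Sum>s\<in>T. emeasure U01 {u. code k n x u = s})"
    using code_eq_borel fin by (intro sum_emeasure[symmetric]) (auto simp: disjoint_family_on_def)
  finally show ?thesis using T by (simp add: emeasure_code_eq)
qed

end

text \<open>Pairs \<open>(i, j)\<close>, coded by \<open>prod_decode\<close>, enumerate the balls of radius \<open>1 / (j + 1)\<close>
  about the \<open>i\<close>-th point of a dense sequence; a code is fine at scale \<open>j\<close> if it lies in one
  of the balls of index at least \<open>j\<close>.\<close>

primrec fine_at :: "nat \<Rightarrow> bool list \<Rightarrow> bool" where
  "fine_at j [] = False"
| "fine_at j (b # s) = (b \<and> j \<le> snd (prod_decode (length s)) \<or> fine_at j s)"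

lemma fine_at_imp: "fine_at j s \<Longrightarrow> \<exists>i. j \<le> snd (prod_decode i) \<and> cell B s \<subseteq> B i"
  by (induction s) (auto split: if_splits)

lemma not_fine_imp:
  "\<not> fine_at j s \<Longrightarrow> cell B s \<inter> (\<Union>i\<in>{i. i < length s \<and> j \<le> snd (prod_decode i)}. B i) = {}"
  by (induction s) (auto simp: less_Suc_eq split: if_splits)

lemma code_cell_antimono: "n \<le> n' \<Longrightarrow> cell B (code k n' x u) \<subseteq> cell B (code k n x u)"
  by (induction n' rule: dec_induct) auto

text \<open>The random point is the limit of representatives of the cells selected by a uniform
  \<open>u\<close>. Equality fails in general: if \<open>m\<close> comes from a setwise limit of
  Dirac masses at 1/n, it vanishes on {0}, while the kernel is the Dirac mass at 0. For open
  \<open>V\<close>, however, a limit point in \<open>V\<close> has one of its cells inside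
  \<open>V\<close>, and the probability of reaching such a cell is computed exactly by
  \<open>m\<close>. The assumption \<open>closed_empty\<close> ensures that the cells shrink almost
  surely.\<close>

theorem (in bimeasure) ex_kernel:
  "\<exists>p\<in>M \<rightarrow>\<^sub>M prob_algebra borel. \<forall>A\<in>sets M. \<forall>V. open V \<longrightarrow>
    (\<integral>\<^sup>+x\<in>A. emeasure (p x) V \<partial>M) \<le> ennreal (m A V)"
proof -
  obtain D0 :: "'a set" where D0: "countable D0" "\<And>X. open X \<Longrightarrow> X \<noteq> {} \<Longrightarrow> \<exists>d\<in>D0. d \<in> X"
    using countable_dense_exists by metis
  define D where "D = from_nat_into D0"
  have D: "\<exists>i. dist (D i) y < e" if e: "e > 0" for y and e :: real
  proof -
    obtain d where "d \<in> D0" "d \<in> ball y e" using D0(2)[of "ball y e"] e by auto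
    then show ?thesis using from_nat_into_surj[OF D0(1)] by (force simp: D_def dist_commute)
  qed
  define B where "B n = ball (D (fst (prod_decode n))) (1 / Suc (snd (prod_decode n)))" for n
  have openB: "open (B n)" for n by (simp add: B_def)
  have B: "B n \<in> sets borel" for n by (simp add: B_def)
  obtain k where cd: "cell_densities M k"
    and k_int: "\<And>s A. A \<in> sets M \<Longrightarrow> (\<integral>\<^sup>+x\<in>A. ennreal (k s x) \<partial>M) = ennreal (m A (cell B s))"
    and k_empty: "\<And>s x. cell B s = {} \<Longrightarrow> k s x = 0"
    using ex_cell_densities[where B = B, OF B] by blast
  interpret K: cell_densities M k by (rule cd)
  note [measurable] = K.code_measurable
  have cellm: "cell B s \<in> sets borel" for s by (rule cell_borel, rule B)
  have code_integral: "(\<integral>\<^sup>+x\<in>A. emeasure U01 {u. code k n x u \<in> T} \<partial>M) =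
      ennreal (m A (\<Union>s\<in>T. cell B s))"
    if A: "A \<in> sets M" and T: "\<And>s. s \<in> T \<Longrightarrow> length s = n" for A T n
  proof -
    have fin: "finite T"
      by (rule finite_subset[OF _ finite_lists_length_eq[of "UNIV :: bool set" n]]) (use T in auto)
    have "(\<integral>\<^sup>+x\<in>A. emeasure U01 {u. code k n x u \<in> T} \<partial>M) =
        (\<integral>\<^sup>+x. (\<Sum>s\<in>T. ennreal (k s x) * indicator A x) \<partial>M)"
      using T by (subst K.emeasure_code_in) (auto simp: sum_distrib_right)
    also have "\<dots> = (\<Sum>s\<in>T. ennreal (m A (cell B s)))"
      using A K.meas by (subst nn_integral_sum) (auto simp: k_int)
    also have "\<dots> = ennreal (m A (\<Union>s\<in>T. cell B s))"
      using fin A T cellm nonneg[OF A]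
      by (subst sum_right) (auto simp: disjoint_family_on_def intro!: sum_ennreal cell_disjoint)
    finally show ?thesis .
  qed
  have code_meas [measurable]: "(\<lambda>x. emeasure U01 {u. code k n x u \<in> T}) \<in> borel_measurable M"
    if T: "\<And>s. s \<in> T \<Longrightarrow> length s = n" for T n
    using T K.meas by (subst K.emeasure_code_in) auto
  have codeT: "{u. code k n x u \<in> T} \<in> sets U01" for n x T
    using measurable_sets[OF K.code_measurable_snd, of T n x] by (simp add: vimage_def)

  define rep where "rep s = (SOME z. z \<in> cell B s)" for s
  have rep: "rep s \<in> cell B s" if "cell B s \<noteq> {}" for s
    using that unfolding rep_def by (simp add: some_in_eq)
  define f where "f n z = rep (code k n (fst z) (snd z))" for n z
  have fm [measurable]: "f n \<in> M \<Otimes>\<^sub>M borel \<rightarrow>\<^sub>M borel" for n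
    using measurable_compose[OF K.code_measurable, of rep borel n]
    by (simp add: f_def[abs_def] case_prod_beta)
  \<comment> \<open>Where the representatives do not converge, a fixed point is used instead; by the
    fact \<open>good\<close> below, this concerns a null set only.\<close>
  define y where "y x u = (if Cauchy (\<lambda>n. f n (x, u)) then lim (\<lambda>n. f n (x, u)) else rep [])" for x u
  have ym: "(\<lambda>(x, u). y x u) \<in> M \<Otimes>\<^sub>M U01 \<rightarrow>\<^sub>M borel"
  proof -
    define S where "S = {z \<in> space (M \<Otimes>\<^sub>M borel :: ('x \<times> real) measure). Cauchy (\<lambda>n. f n z)}"
    have [measurable]: "S \<in> sets (M \<Otimes>\<^sub>M borel)" unfolding S_def by measurable
    have "(\<lambda>z. y (fst z) (snd z)) \<in> M \<Otimes>\<^sub>M borel \<rightarrow>\<^sub>M borel"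
    proof (rule borel_measurable_LIMSEQ_metric)
      show "(\<lambda>z. if z \<in> S then f n z else rep []) \<in> borel_measurable (M \<Otimes>\<^sub>M borel)" for n
        by measurable
      fix z :: "'x \<times> real" assume "z \<in> space (M \<Otimes>\<^sub>M borel)"
      then have "z \<in> S \<longleftrightarrow> Cauchy (\<lambda>n. f n z)" by (simp add: S_def)
      then show "(\<lambda>n. if z \<in> S then f n z else rep []) \<longlonglongrightarrow> y (fst z) (snd z)"
        by (auto simp: y_def Cauchy_convergent_iff convergent_LIMSEQ_iff)
    qed
    then show ?thesis by (simp add: case_prod_beta cong: measurable_cong_sets)
  qed
  define p where "p x = distr U01 borel (y x)" for x
  have pm: "p \<in> M \<rightarrow>\<^sub>M prob_algebra borel"
    unfolding p_def
    by (rule measurable_distr_prob_space2[OF measurable_const ym])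
       (simp add: space_prob_algebra prob_space_U01)
  interpret U: prob_space U01 by (rule prob_space_U01)

  \<comment> \<open>The codes of length \<open>n\<close> that are not fine at scale \<open>j\<close>
    have cells inside \<open>C n\<close>, the complement of finitely many balls of radius at most
    1/(j + 1). These closed sets decrease to the empty set, because all such balls together cover
    the space.\<close>
  have notfine: "AE x in M. emeasure U01 {u. \<forall>n. \<not> fine_at j (code k n x u)} = 0" for j
  proof -
    define T where "T n = {s. length s = n \<and> \<not> fine_at j s}" for n
    define g where "g x = (INF n. emeasure U01 {u. code k n x u \<in> T n})" for x
    have gm [measurable]: "g \<in> borel_measurable M"
      unfolding g_def by (intro borel_measurable_INF code_meas) (auto simp: T_def)
    define C where "C n = - (\<Union>i\<in>{i. i < n \<and> j \<le> snd (prod_decode i)}. B i)" for n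
    have Ccl: "closed (C n)" for n
      unfolding C_def by (intro closed_Compl open_UN) (auto simp: openB)
    have "(\<Inter>n. C n) = {}"
    proof safe
      fix z assume z: "z \<in> (\<Inter>n. C n)"
      obtain i where "dist (D i) z < 1 / Suc j" using D[of "1 / Suc j" z] by auto
      then have "z \<in> B (prod_encode (i, j))" by (simp add: B_def)
      moreover have "z \<in> C (Suc (prod_encode (i, j)))" using z by blast
      ultimately show "z \<in> {}" by (auto simp: C_def)
    qed
    moreover have "decseq C" by (force simp: C_def decseq_def)
    ultimately have lim: "(\<lambda>n. ennreal (m (space M) (C n))) \<longlonglongrightarrow> 0"
      using closed_empty[OF Ccl] tendsto_ennrealI by fastforce
    have "(\<integral>\<^sup>+x. g x \<partial>M) \<le> ennreal (m (space M) (C n))" for n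
    proof -
      have "(\<integral>\<^sup>+x. g x \<partial>M) \<le> (\<integral>\<^sup>+x\<in>space M. emeasure U01 {u. code k n x u \<in> T n} \<partial>M)"
        by (intro nn_integral_mono) (auto simp: g_def intro!: INF_lower)
      also have "\<dots> = ennreal (m (space M) (\<Union>s\<in>T n. cell B s))"
        by (rule code_integral) (auto simp: T_def)
      also have "\<dots> \<le> ennreal (m (space M) (C n))"
      proof (intro ennreal_leI mono_right)
        show "(\<Union>s\<in>T n. cell B s) \<in> sets borel"
          by (intro sets.finite_UN cellm) (auto simp: T_def intro: finite_subset[OF _ finite_lists_length_eq[of "UNIV :: bool set" n]])
        show "(\<Union>s\<in>T n. cell B s) \<subseteq> C n" using not_fine_imp[of j _ B] by (fastforce simp: T_def C_def)
      qed (use Ccl in auto)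
      finally show ?thesis .
    qed
    then have "(\<integral>\<^sup>+x. g x \<partial>M) \<le> 0" by (intro LIMSEQ_le_const[OF lim]) auto
    then have "AE x in M. g x = 0" using gm by (simp add: nn_integral_0_iff_AE)
    then show ?thesis
    proof eventually_elim
      case (elim x)
      have "emeasure U01 {u. \<forall>n. \<not> fine_at j (code k n x u)} \<le> g x"
        unfolding g_def
      proof (rule INF_greatest)
        show "emeasure U01 {u. \<forall>n. \<not> fine_at j (code k n x u)} \<le> emeasure U01 {u. code k n x u \<in> T n}" for n
          by (intro emeasure_mono[OF _ codeT]) (auto simp: T_def)
      qed
      with elim show ?case by simp
    qed
  qed
  have good: "AE x in M. AE u in U01. (\<forall>j. \<exists>n. fine_at j (code k n x u)) \<and> (\<forall>n. cell B (code k n x u) \<noteq> {})"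
  proof -
    have "AE x in M. \<forall>j. emeasure U01 {u. \<forall>n. \<not> fine_at j (code k n x u)} = 0"
      using notfine by (simp add: AE_all_countable)
    then show ?thesis
    proof eventually_elim
      case (elim x)
      have 1: "AE u in U01. \<exists>n. fine_at j (code k n x u)" for j
      proof (rule AE_I')
        have "{u. \<forall>n. \<not> fine_at j (code k n x u)} = (\<Inter>n. {u. code k n x u \<in> {s. \<not> fine_at j s}})" by auto
        also have "\<dots> \<in> sets U01" by (intro sets.countable_INT image_subsetI codeT) auto
        finally show "{u. \<forall>n. \<not> fine_at j (code k n x u)} \<in> null_sets U01" using elim by (auto simp: null_sets_def)
      qed auto
      have 2: "AE u in U01. cell B (code k n x u) \<noteq> {}" for n
      proof (rule AE_I')
        let ?T = "{s. length s = n \<and> cell B s = {}}"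
        have "emeasure U01 {u. code k n x u \<in> ?T} = 0"
          by (subst K.emeasure_code_in) (auto simp: k_empty)
        then show "{u. code k n x u \<in> ?T} \<in> null_sets U01" by (intro null_setsI codeT)
      qed auto
      show ?case using 1 2 by (simp add: AE_all_countable)
    qed
  qed
  have "(\<integral>\<^sup>+x\<in>A. emeasure (p x) V \<partial>M) \<le> ennreal (m A V)" if A: "A \<in> sets M" and V: "open V" for A V
  proof -
    define T where "T n = {s. length s = n \<and> cell B s \<subseteq> V}" for n
    have incT: "incseq (\<lambda>n. {u. code k n x u \<in> T n})" for x
      using code_cell_antimono[of _ _ B k x] by (force simp: T_def incseq_def)
    have "AE x in M. emeasure (p x) V \<le> (SUP n. emeasure U01 {u. code k n x u \<in> T n})"
      using good AE_space
    proof eventually_elim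
      case (elim x)
      have yx: "y x \<in> U01 \<rightarrow>\<^sub>M borel"
        using measurable_Pair2[OF ym] elim(2) by simp
      have "emeasure (p x) V = emeasure U01 {u. y x u \<in> V}"
        unfolding p_def using V yx by (subst emeasure_distr) (auto simp: vimage_def)
      also have "\<dots> \<le> emeasure U01 (\<Union>n. {u. code k n x u \<in> T n})"
      proof (rule emeasure_mono_AE)
        show "(\<Union>n. {u. code k n x u \<in> T n}) \<in> sets U01" using codeT by (intro sets.countable_UN) auto
        show "AE u in U01. u \<in> {u. y x u \<in> V} \<longrightarrow> u \<in> (\<Union>n. {u. code k n x u \<in> T n})"
          using elim(1)
        proof eventually_elim
          case (elim u)
          let ?c = "\<lambda>n. cell B (code k n x u)"
          have inc: "f n' (x, u) \<in> ?c n" if "n \<le> n'" for n n'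
            using rep[of "code k n' x u"] elim code_cell_antimono[OF that, of B k x u] by (auto simp: f_def)
          have small: "\<exists>n a. ?c n \<subseteq> ball a (1 / Suc j)" for j
          proof -
            obtain n where "fine_at j (code k n x u)" using elim by blast
            from fine_at_imp[OF this, of B] obtain i where i: "j \<le> snd (prod_decode i)" "?c n \<subseteq> B i" by auto
            have "B i \<subseteq> ball (D (fst (prod_decode i))) (1 / Suc j)"
              unfolding B_def using i(1) by (intro subset_ball frac_le) auto
            with i(2) show ?thesis by blast
          qed
          have "Cauchy (\<lambda>n. f n (x, u))"
          proof (rule metric_CauchyI)
            fix e :: real assume "e > 0"
            then obtain j where "inverse (real (Suc j)) < e / 2"
              using reals_Archimedean[of "e / 2"] by auto
            then have j: "1 / real (Suc j) + 1 / real (Suc j) < e" by (simp add: inverse_eq_divide)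
            obtain n a where na: "?c n \<subseteq> ball a (1 / Suc j)" using small by blast
            have "dist (f n1 (x, u)) (f n2 (x, u)) < e" if "n \<le> n1" "n \<le> n2" for n1 n2
            proof -
              have "dist a (f n1 (x, u)) < 1 / Suc j" "dist a (f n2 (x, u)) < 1 / Suc j"
                using na inc[OF that(1)] inc[OF that(2)] by (auto simp: subset_eq)
              then show ?thesis using dist_triangle3[of "f n1 (x, u)" "f n2 (x, u)" a] j by simp
            qed
            then show "\<exists>M. \<forall>m\<ge>M. \<forall>n\<ge>M. dist (f m (x, u)) (f n (x, u)) < e" by blast
          qed
          then have lim: "(\<lambda>n. f n (x, u)) \<longlonglongrightarrow> y x u"
            by (simp add: y_def Cauchy_convergent_iff convergent_LIMSEQ_iff)
          show ?case
          proof safe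
            assume "y x u \<in> V"
            then obtain e where e: "e > 0" "ball (y x u) e \<subseteq> V" using V open_contains_ball by blast
            then obtain j where "inverse (real (Suc j)) < e / 2"
              using reals_Archimedean[of "e / 2"] by auto
            then have j: "1 / real (Suc j) + 1 / real (Suc j) < e" by (simp add: inverse_eq_divide)
            obtain n a where na: "?c n \<subseteq> ball a (1 / Suc j)" using small by blast
            \<comment> \<open>Cells are not closed, so the limit may lie outside them. It still lies
              in the closed ball about \<open>a\<close>, which is enough to place the whole cell
              inside the ball about \<open>y x u\<close>.\<close>
            have "dist a (y x u) \<le> 1 / Suc j"
            proof (rule Lim_bounded[OF tendsto_dist[OF tendsto_const lim]])
              show "\<forall>n'\<ge>n. dist a (f n' (x, u)) \<le> 1 / Suc j"
                using na inc by (force simp: subset_eq)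
            qed
            have "?c n \<subseteq> ball (y x u) e"
            proof
              fix z assume "z \<in> ?c n"
              then have "dist a z < 1 / Suc j" using na by auto
              with \<open>dist a (y x u) \<le> 1 / Suc j\<close> show "z \<in> ball (y x u) e"
                using dist_triangle3[of "y x u" z a] j by simp
            qed
            with e(2) have "code k n x u \<in> T n" by (auto simp: T_def)
            then show "u \<in> (\<Union>n. {u. code k n x u \<in> T n})" by auto
          qed
        qed
      qed
      also have "\<dots> = (SUP n. emeasure U01 {u. code k n x u \<in> T n})"
        using codeT incT by (intro SUP_emeasure_incseq[symmetric]) auto
      finally show ?case .
    qed
    then have "(\<integral>\<^sup>+x\<in>A. emeasure (p x) V \<partial>M) \<le>
        (\<integral>\<^sup>+x. (SUP n. emeasure U01 {u. code k n x u \<in> T n} * indicator A x) \<partial>M)"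
      by (intro nn_integral_mono_AE) (auto elim!: eventually_mono split: split_indicator)
    also have "\<dots> = (SUP n. (\<integral>\<^sup>+x\<in>A. emeasure U01 {u. code k n x u \<in> T n} \<partial>M))"
    proof (rule nn_integral_monotone_convergence_SUP)
      show "incseq (\<lambda>n x. emeasure U01 {u. code k n x u \<in> T n} * indicator A x)"
        unfolding incseq_def le_fun_def
        using incT codeT by (auto simp: incseq_def intro!: mult_right_mono emeasure_mono)
      show "(\<lambda>x. emeasure U01 {u. code k n x u \<in> T n} * indicator A x) \<in> borel_measurable M" for n
        using A by (intro borel_measurable_times_ennreal code_meas) (auto simp: T_def)
    qed
    also have "\<dots> \<le> ennreal (m A V)"
    proof (rule SUP_least)
      fix n
      have "(\<integral>\<^sup>+x\<in>A. emeasure U01 {u. code k n x u \<in> T n} \<partial>M) = ennreal (m A (\<Union>s\<in>T n. cell B s))"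
        using A by (rule code_integral) (auto simp: T_def)
      also have "\<dots> \<le> ennreal (m A V)"
      proof (intro ennreal_leI mono_right A)
        show "(\<Union>s\<in>T n. cell B s) \<in> sets borel"
          by (intro sets.finite_UN cellm) (auto simp: T_def intro: finite_subset[OF _ finite_lists_length_eq[of "UNIV :: bool set" n]])
      qed (use V in \<open>auto simp: T_def\<close>)
      finally show "(\<integral>\<^sup>+x\<in>A. emeasure U01 {u. code k n x u \<in> T n} \<partial>M) \<le> ennreal (m A V)" .
    qed
    finally show ?thesis .
  qed
  with pm show ?thesis by blast
qed

section \<open>Semidirect products and disintegration\<close>

definition semidirect :: "'a::second_countable_topology measure \<Rightarrow>
    ('a \<Rightarrow> 'b::second_countable_topology measure) \<Rightarrow> ('a \<times> 'b) measure" where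
  "semidirect \<mu> p = \<mu> \<bind> (\<lambda>x. distr (p x) borel (Pair x))"

locale prob_kernel =
  fixes \<mu> :: "'a::second_countable_topology measure"
    and p :: "'a \<Rightarrow> 'b::second_countable_topology measure"
  assumes sets_base [simp, measurable_cong]: "sets \<mu> = sets borel"
    and prob_base: "prob_space \<mu>"
    and kernel: "p \<in> borel \<rightarrow>\<^sub>M prob_algebra borel"
begin

lemma space_base [simp]: "space \<mu> = UNIV"
  using sets_eq_imp_space_eq[OF sets_base] by simp

lemma kernel_subprob [measurable]: "p \<in> borel \<rightarrow>\<^sub>M subprob_algebra borel"
  using kernel by (rule measurable_prob_algebraD)

lemma kernel_sets [simp]: "sets (p x) = sets borel"
  using measurable_space[OF kernel, of x] by (simp add: space_prob_algebra)

lemma kernel_space [simp]: "space (p x) = UNIV"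
  using sets_eq_imp_space_eq[OF kernel_sets] by simp

lemma kernel_prob: "prob_space (p x)"
  using measurable_space[OF kernel, of x] by (simp add: space_prob_algebra)

lemma base_in: "\<mu> \<in> space (prob_algebra borel)"
  by (simp add: space_prob_algebra prob_base)

lemma kernel_base: "p \<in> \<mu> \<rightarrow>\<^sub>M prob_algebra borel"
  using kernel by (simp cong: measurable_cong_sets)

lemma pair_kernel: "(\<lambda>x. distr (p x) borel (Pair x)) \<in> borel \<rightarrow>\<^sub>M prob_algebra borel"
  by (rule measurable_distr_prob_space2[OF kernel]) (simp add: borel_prod)

lemma pair_kernel_base: "(\<lambda>x. distr (p x) borel (Pair x)) \<in> \<mu> \<rightarrow>\<^sub>M prob_algebra borel"
  using pair_kernel by (simp cong: measurable_cong_sets)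

lemma Pair_measurable: "Pair x \<in> p x \<rightarrow>\<^sub>M borel"
  unfolding borel_prod[symmetric] by (simp cong: measurable_cong_sets)

lemma sets_semidirect [simp, measurable_cong]: "sets (semidirect \<mu> p) = sets borel"
  unfolding semidirect_def by (rule sets_bind) (auto simp: prob_space.not_empty[OF prob_base])

lemma space_semidirect [simp]: "space (semidirect \<mu> p) = UNIV"
  using sets_eq_imp_space_eq[OF sets_semidirect] by simp

lemma prob_semidirect: "prob_space (semidirect \<mu> p)"
  unfolding semidirect_def by (rule prob_space_bind'[OF base_in pair_kernel])

lemma fst_measurable: "fst \<in> semidirect \<mu> p \<rightarrow>\<^sub>M borel"
  by (simp add: borel_measurable_continuous_onI continuous_on_fst cong: measurable_cong_sets)

lemma snd_measurable: "snd \<in> semidirect \<mu> p \<rightarrow>\<^sub>M borel"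
  by (simp add: borel_measurable_continuous_onI continuous_on_snd cong: measurable_cong_sets)

lemma nn_integral_semidirect:
  assumes f: "f \<in> borel_measurable borel"
  shows "(\<integral>\<^sup>+z. f z \<partial>semidirect \<mu> p) = (\<integral>\<^sup>+x. \<integral>\<^sup>+y. f (x, y) \<partial>p x \<partial>\<mu>)"
proof -
  have "(\<integral>\<^sup>+z. f z \<partial>semidirect \<mu> p) = (\<integral>\<^sup>+x. \<integral>\<^sup>+z. f z \<partial>distr (p x) borel (Pair x) \<partial>\<mu>)"
    unfolding semidirect_def
    by (rule nn_integral_bind[OF f measurable_prob_algebraD[OF pair_kernel_base]])
  also have "\<dots> = (\<integral>\<^sup>+x. \<integral>\<^sup>+y. f (x, y) \<partial>p x \<partial>\<mu>)"
    using f by (intro nn_integral_cong nn_integral_distr Pair_measurable) auto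
  finally show ?thesis .
qed

lemma emeasure_semidirect_Times:
  assumes "A \<in> sets borel" "B \<in> sets borel"
  shows "emeasure (semidirect \<mu> p) (A \<times> B) = (\<integral>\<^sup>+x\<in>A. emeasure (p x) B \<partial>\<mu>)"
proof -
  have AB: "A \<times> B \<in> sets borel" using assms unfolding borel_prod[symmetric] by simp
  then have "emeasure (semidirect \<mu> p) (A \<times> B) = (\<integral>\<^sup>+z. indicator (A \<times> B) z \<partial>semidirect \<mu> p)"
    by simp
  also have "\<dots> = (\<integral>\<^sup>+x. \<integral>\<^sup>+y. indicator A x * indicator B y \<partial>p x \<partial>\<mu>)"
    using AB by (subst nn_integral_semidirect) (simp_all add: indicator_times)
  also have "\<dots> = (\<integral>\<^sup>+x\<in>A. emeasure (p x) B \<partial>\<mu>)"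
    using assms by (intro nn_integral_cong) (simp add: nn_integral_cmult mult.commute)
  finally show ?thesis .
qed

lemma distr_fst_semidirect: "distr (semidirect \<mu> p) borel fst = \<mu>"
proof (rule measure_eqI)
  fix A assume "A \<in> sets (distr (semidirect \<mu> p) borel fst)"
  then have A: "A \<in> sets borel" by simp
  have "emeasure (distr (semidirect \<mu> p) borel fst) A = emeasure (semidirect \<mu> p) (A \<times> UNIV)"
    using A fst_measurable by (subst emeasure_distr) (auto intro!: arg_cong2[where f=emeasure])
  also have "\<dots> = (\<integral>\<^sup>+x\<in>A. 1 \<partial>\<mu>)"
    using A prob_space.emeasure_space_1[OF kernel_prob] by (subst emeasure_semidirect_Times) auto
  finally show "emeasure (distr (semidirect \<mu> p) borel fst) A = emeasure \<mu> A" using A by simp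
qed simp

lemma sets_bind_kernel [simp, measurable_cong]: "sets (\<mu> \<bind> p) = sets borel"
  by (rule sets_bind) (auto simp: prob_space.not_empty[OF prob_base])

lemma prob_bind_kernel: "prob_space (\<mu> \<bind> p)"
  by (rule prob_space_bind'[OF base_in kernel])

lemma nn_integral_bind_kernel:
  "f \<in> borel_measurable borel \<Longrightarrow> (\<integral>\<^sup>+y. f y \<partial>(\<mu> \<bind> p)) = (\<integral>\<^sup>+x. \<integral>\<^sup>+y. f y \<partial>p x \<partial>\<mu>)"
  by (rule nn_integral_bind[OF _ measurable_prob_algebraD[OF kernel_base]])

lemma distr_snd_semidirect: "distr (semidirect \<mu> p) borel snd = \<mu> \<bind> p"
proof (rule measure_eqI)
  fix A assume "A \<in> sets (distr (semidirect \<mu> p) borel snd)"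
  then have A: "A \<in> sets borel" by simp
  have "emeasure (distr (semidirect \<mu> p) borel snd) A = emeasure (semidirect \<mu> p) (UNIV \<times> A)"
    using A snd_measurable by (subst emeasure_distr) (auto intro!: arg_cong2[where f=emeasure])
  also have "\<dots> = (\<integral>\<^sup>+x. emeasure (p x) A \<partial>\<mu>)"
    using A by (subst emeasure_semidirect_Times) auto
  also have "\<dots> = emeasure (\<mu> \<bind> p) A"
    using A by (intro emeasure_bind_prob_algebra[symmetric, OF base_in kernel])
  finally show "emeasure (distr (semidirect \<mu> p) borel snd) A = emeasure (\<mu> \<bind> p) A" .
qed simp

lemma nn_integral_snd_semidirect:
  "f \<in> borel_measurable borel \<Longrightarrow> (\<integral>\<^sup>+z. f (snd z) \<partial>semidirect \<mu> p) = (\<integral>\<^sup>+y. f y \<partial>(\<mu> \<bind> p))"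
  unfolding distr_snd_semidirect[symmetric] by (subst nn_integral_distr[OF snd_measurable]) auto

lemma integral_snd_semidirect:
  fixes f :: "'b \<Rightarrow> real"
  shows "f \<in> borel_measurable borel \<Longrightarrow> (\<integral>z. f (snd z) \<partial>semidirect \<mu> p) = (\<integral>y. f y \<partial>(\<mu> \<bind> p))"
  unfolding distr_snd_semidirect[symmetric] by (subst integral_distr[OF snd_measurable]) auto

end

text \<open>Countability lets almost sure identities be collected over all generators, and stability
  under intersections makes them determine the measure. Openness makes the mass of a generator a
  lower semicontinuous function of the measure, which the selection of measurable minimisers relies
  on.\<close>

lemma borel_countable_Int_stable_generator:
  obtains G :: "'a::second_countable_topology set set"
  where "countable G" "Int_stable G" "UNIV \<in> G" "sets borel = sigma_sets UNIV G" "\<And>U. U \<in> G \<Longrightarrow> open U"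
proof -
  obtain B :: "'a set set" where B: "countable B" "topological_basis B"
    using ex_countable_basis by blast
  define G where "G = {\<Inter>F | F. finite F \<and> F \<subseteq> B}"
  have "G = Inter ` {F. finite F \<and> F \<subseteq> B}" by (auto simp: G_def)
  then have 1: "countable G" using countable_Collect_finite_subset[OF B(1)] by simp
  have 2: "Int_stable G"
  proof (rule Int_stableI)
    fix a b assume "a \<in> G" "b \<in> G"
    then obtain E F where "a = \<Inter>E" "b = \<Inter>F" "finite E" "finite F" "E \<subseteq> B" "F \<subseteq> B"
      by (auto simp: G_def)
    then show "a \<inter> b \<in> G" by (auto simp: G_def intro!: exI[of _ "E \<union> F"])
  qed
  have 3: "UNIV \<in> G" by (auto simp: G_def intro!: exI[of _ "{}"])
  have op: "open U" if "U \<in> G" for U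
    using that topological_basis_open[OF B(2)] by (auto simp: G_def)
  have "B \<subseteq> G" by (auto simp: G_def intro!: exI[of _ "{_}"])
  have "sets borel = sigma_sets UNIV B"
    using borel_eq_countable_basis[OF B] by (metis sets_measure_of Pow_UNIV top_greatest)
  also have "\<dots> \<subseteq> sigma_sets UNIV G" by (rule sigma_sets_mono') fact
  finally have "sets borel \<subseteq> sigma_sets UNIV G" .
  moreover have "sigma_sets UNIV G \<subseteq> sets borel"
  proof -
    have "G \<subseteq> sets borel" using op by auto
    from sets.sigma_sets_subset[OF this] show ?thesis by simp
  qed
  ultimately show thesis using that 1 2 3 op by blast
qed

lemma kernel_unique:
  fixes p q :: "'a::second_countable_topology \<Rightarrow> 'b::second_countable_topology measure"
  assumes "prob_kernel \<mu> p" "prob_kernel \<mu> q"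
    and eq: "\<And>A B. A \<in> sets borel \<Longrightarrow> B \<in> sets borel \<Longrightarrow>
      (\<integral>\<^sup>+x\<in>A. emeasure (p x) B \<partial>\<mu>) = (\<integral>\<^sup>+x\<in>A. emeasure (q x) B \<partial>\<mu>)"
  shows "AE x in \<mu>. p x = q x"
proof -
  interpret p: prob_kernel \<mu> p by fact
  interpret q: prob_kernel \<mu> q by fact
  interpret \<mu>: prob_space \<mu> by (rule p.prob_base)
  obtain G :: "'b set set" where G: "countable G" "Int_stable G" "UNIV \<in> G"
      "sets borel = sigma_sets UNIV G" "\<And>U. U \<in> G \<Longrightarrow> open U"
    using borel_countable_Int_stable_generator by blast
  have "AE x in \<mu>. emeasure (p x) B = emeasure (q x) B" if "B \<in> G" for B
  proof -
    have B [measurable]: "B \<in> sets borel" using G(5)[OF that] by simp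
    show ?thesis
      by (rule \<mu>.density_unique_finite_measure) (use eq B in \<open>auto simp: p.sets_base\<close>)
  qed
  then have "AE x in \<mu>. \<forall>B\<in>G. emeasure (p x) B = emeasure (q x) B"
    using G(1) by (simp add: AE_ball_countable)
  then show ?thesis
  proof eventually_elim
    case (elim x)
    show ?case
      by (rule measure_eqI_generator_eq[OF G(2), of UNIV _ _ "\<lambda>_. UNIV"])
        (use elim G prob_space.emeasure_space_1[OF p.kernel_prob[of x]] in auto)
  qed
qed

section \<open>Comparison of measures on open sets, and disintegration on products of Polish
  spaces\<close>

lemma measure_le_from_open:
  fixes M N :: "'a::polish_space measure"
  assumes "sets M = sets borel" "sets N = sets borel" "emeasure M UNIV \<noteq> \<infinity>" "emeasure N UNIV \<noteq> \<infinity>"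
    and le: "\<And>U. open U \<Longrightarrow> emeasure M U \<le> emeasure N U" and B: "B \<in> sets borel"
  shows "emeasure M B \<le> emeasure N B"
proof -
  have [simp]: "space M = UNIV" "space N = UNIV"
    using sets_eq_imp_space_eq[OF assms(1)] sets_eq_imp_space_eq[OF assms(2)] by simp_all
  have "emeasure M B = (INF U\<in>{U. B \<subseteq> U \<and> open U}. emeasure M U)"
    using assms B by (intro outer_regular) auto
  also have "\<dots> \<le> (INF U\<in>{U. B \<subseteq> U \<and> open U}. emeasure N U)"
    by (intro INF_mono) (use le in auto)
  also have "\<dots> = emeasure N B"
    using assms B by (intro outer_regular[symmetric]) auto
  finally show ?thesis .
qed

text \<open>Outer regularity carries the inequality from open to Borel sets; applied to complements,
  with equal total masses, it becomes an equality. This is how the one-sided conclusion of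
  \<open>ex_kernel\<close> can recover a given measure.\<close>

lemma measure_eq_from_open:
  fixes M N :: "'a::polish_space measure"
  assumes "sets M = sets borel" "sets N = sets borel" "emeasure M UNIV \<noteq> \<infinity>"
    and tot: "emeasure M UNIV = emeasure N UNIV"
    and le: "\<And>U. open U \<Longrightarrow> emeasure M U \<le> emeasure N U"
  shows "M = N"
proof (rule measure_eqI)
  show "sets M = sets N" using assms by simp
  fix B assume "B \<in> sets M"
  then have B: "B \<in> sets borel" using assms(1) by simp
  have [simp]: "space M = UNIV" "space N = UNIV"
    using sets_eq_imp_space_eq[OF assms(1)] sets_eq_imp_space_eq[OF assms(2)] by simp_all
  have le': "emeasure M A \<le> emeasure N A" if "A \<in> sets borel" for A
  proof (rule measure_le_from_open[OF assms(1,2,3) _ le that])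
    show "emeasure N UNIV \<noteq> \<infinity>" using assms(3) tot by simp
  qed
  have "emeasure M B + emeasure M (- B) = emeasure M UNIV" "emeasure N B + emeasure N (- B) = emeasure N UNIV"
    using B assms(1,2) plus_emeasure[of B M "- B"] plus_emeasure[of B N "- B"] by (auto simp: Compl_partition)
  moreover have "emeasure M (- B) \<noteq> \<infinity>"
    using assms(3) emeasure_mono[of "- B" UNIV M] assms(1) by (auto simp: top_unique)
  moreover have "emeasure N B + emeasure M (- B) \<le> emeasure N B + emeasure N (- B)"
    using le'[of "- B"] B by (intro add_left_mono) auto
  ultimately have "emeasure M (- B) + emeasure N B \<le> emeasure M (- B) + emeasure M B"
    using tot by (simp add: add.commute)
  with \<open>emeasure M (- B) \<noteq> \<infinity>\<close> have "emeasure N B \<le> emeasure M B"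
    by (simp add: ennreal_add_left_cancel_le)
  with le'[OF B] show "emeasure M B = emeasure N B" by simp
qed

text \<open>In contrast to a setwise limit, \<pi> is countably additive in the second side of a
  rectangle, so the kernel obtained from the bimeasure A, B \<mapsto> \<pi>(A \<times> B) reproduces
  it exactly.\<close>

theorem ex_disintegration:
  fixes \<pi> :: "('a::polish_space \<times> 'b::polish_space) measure"
  assumes sets: "sets \<pi> = sets borel" and prob: "prob_space \<pi>"
  shows "\<exists>p. prob_kernel (distr \<pi> borel fst) p \<and> semidirect (distr \<pi> borel fst) p = \<pi>"
proof -
  interpret \<pi>: prob_space \<pi> by fact
  have [simp]: "space \<pi> = UNIV" using sets_eq_imp_space_eq[OF sets] by simp
  define \<mu> where "\<mu> = distr \<pi> borel fst"
  have fst [measurable]: "fst \<in> \<pi> \<rightarrow>\<^sub>M borel" and snd [measurable]: "snd \<in> \<pi> \<rightarrow>\<^sub>M borel"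
    using sets by (simp_all add: borel_measurable_continuous_onI continuous_on_fst continuous_on_snd cong: measurable_cong_sets)
  have s\<mu> [simp, measurable_cong]: "sets \<mu> = sets borel" and [simp]: "space \<mu> = UNIV" by (simp_all add: \<mu>_def)
  have p\<mu>: "prob_space \<mu>" unfolding \<mu>_def by (rule \<pi>.prob_space_distr) simp
  have rect: "A \<times> B \<in> sets \<pi>" if "A \<in> sets borel" "B \<in> sets borel" for A :: "'a set" and B :: "'b set"
    using that sets unfolding borel_prod[symmetric] by simp
  interpret \<mu>: prob_space \<mu> by fact
  have bm: "bimeasure \<mu> (\<lambda>A B. measure \<pi> (A \<times> B))"
  proof unfold_locales
    fix A A' :: "'a set" and B :: "'b set"
    assume "A \<in> sets \<mu>" "A' \<in> sets \<mu>" "B \<in> sets borel" "A \<inter> A' = {}"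
    then show "measure \<pi> ((A \<union> A') \<times> B) = measure \<pi> (A \<times> B) + measure \<pi> (A' \<times> B)"
      using rect unfolding Sigma_Un_distrib1 by (intro \<pi>.finite_measure_Union) auto
  next
    fix A :: "'a set" and B B' :: "'b set"
    assume "A \<in> sets \<mu>" "B \<in> sets borel" "B' \<in> sets borel" "B \<inter> B' = {}"
    then show "measure \<pi> (A \<times> (B \<union> B')) = measure \<pi> (A \<times> B) + measure \<pi> (A \<times> B')"
      using rect unfolding Sigma_Un_distrib2 by (intro \<pi>.finite_measure_Union) auto
  next
    fix A :: "'a set" assume A: "A \<in> sets \<mu>"
    then show "measure \<pi> (A \<times> UNIV) = measure \<mu> A"
      unfolding \<mu>_def by (subst measure_distr) (auto intro!: arg_cong2[where f=measure])
  next
    fix C :: "nat \<Rightarrow> 'b set" assume C: "\<And>n. closed (C n)" "decseq C" "(\<Inter>n. C n) = {}"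
    have "(\<lambda>n. measure \<pi> (UNIV \<times> C n)) \<longlonglongrightarrow> measure \<pi> (\<Inter>n. UNIV \<times> C n)"
      using C rect[of UNIV "C _"] by (intro \<pi>.finite_Lim_measure_decseq) (auto simp: decseq_def)
    also have "(\<Inter>n. UNIV \<times> C n) = {}" using C(3) by auto
    finally show "(\<lambda>n. measure \<pi> (space \<mu> \<times> C n)) \<longlonglongrightarrow> 0" by simp
  qed simp
  obtain p where p: "p \<in> \<mu> \<rightarrow>\<^sub>M prob_algebra borel"
    and le: "\<And>A V. A \<in> sets \<mu> \<Longrightarrow> open V \<Longrightarrow> (\<integral>\<^sup>+x\<in>A. emeasure (p x) V \<partial>\<mu>) \<le> ennreal (measure \<pi> (A \<times> V))"
    using bimeasure.ex_kernel[OF bm] by blast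
  interpret P: prob_kernel \<mu> p
    using p by unfold_locales (simp_all add: p\<mu> cong: measurable_cong_sets)
  have "semidirect \<mu> p = \<pi>"
  proof (rule measure_eqI_generator_eq[of "{A \<times> B | A B. A \<in> sets borel \<and> B \<in> sets borel}" UNIV _ _ "\<lambda>_. UNIV"])
    show "Int_stable {A \<times> B | A B. A \<in> sets (borel :: 'a measure) \<and> B \<in> sets (borel :: 'b measure)}"
      using Int_stable_pair_measure_generator .
    show "sets (semidirect \<mu> p) = sigma_sets UNIV {A \<times> B | A B. A \<in> sets borel \<and> B \<in> sets borel}"
      by (simp add: borel_prod[symmetric] sets_pair_measure)
    then show "sets \<pi> = sigma_sets UNIV {A \<times> B | A B. A \<in> sets borel \<and> B \<in> sets borel}"
      using sets by simp
    show "range (\<lambda>_. UNIV) \<subseteq> {A \<times> B |A B. A \<in> sets (borel :: 'a measure) \<and> B \<in> sets (borel :: 'b measure)}"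
      by (auto intro!: exI[of _ UNIV])
    show "emeasure (semidirect \<mu> p) UNIV \<noteq> \<infinity>"
      using prob_space.emeasure_space_1[OF P.prob_semidirect] by simp
    fix X :: "('a \<times> 'b) set" assume "X \<in> {A \<times> B | A B. A \<in> sets borel \<and> B \<in> sets borel}"
    then obtain A B where X: "X = A \<times> B" and A: "A \<in> sets borel" and B: "B \<in> sets borel" by auto
    \<comment> \<open>For the fixed \<open>A\<close>, this is the measure B \<mapsto> M(A \<times>
      B). For the semidirect product and for \<pi> it has the same total mass \<mu>(A), so an
      inequality on open sets suffices.\<close>
    define \<alpha> where "\<alpha> M = distr (density M (indicator (A \<times> UNIV))) borel snd" for M :: "('a \<times> 'b) measure"
    have \<alpha>: "emeasure (\<alpha> M) B = emeasure M (A \<times> B)" if M: "sets M = sets borel" and "B \<in> sets borel" for M B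
    proof -
      have [simp]: "space M = UNIV" using sets_eq_imp_space_eq[OF M] by simp
      have s: "snd \<in> M \<rightarrow>\<^sub>M borel"
        using M by (simp add: borel_measurable_continuous_onI continuous_on_snd cong: measurable_cong_sets)
      have r: "A \<times> UNIV \<in> sets M" "UNIV \<times> B \<in> sets M"
        using A that unfolding M borel_prod[symmetric] by auto
      have "emeasure (\<alpha> M) B = emeasure (density M (indicator (A \<times> UNIV))) (UNIV \<times> B)"
        using that s unfolding \<alpha>_def by (subst emeasure_distr) (auto intro!: arg_cong2[where f=emeasure])
      also have "\<dots> = (\<integral>\<^sup>+z. indicator (A \<times> B) z \<partial>M)"
        using r by (subst emeasure_density) (auto intro!: nn_integral_cong split: split_indicator)
      also have "\<dots> = emeasure M (A \<times> B)"
        using A that unfolding M by (intro nn_integral_indicator) (simp add: M borel_prod[symmetric])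
      finally show ?thesis .
    qed
    have "\<alpha> (semidirect \<mu> p) = \<alpha> \<pi>"
    proof (rule measure_eq_from_open)
      have "emeasure (semidirect \<mu> p) (A \<times> UNIV) = emeasure \<mu> A"
        using A prob_space.emeasure_space_1[OF P.kernel_prob] by (subst P.emeasure_semidirect_Times) auto
      moreover have "emeasure \<pi> (A \<times> UNIV) = emeasure \<mu> A"
        using A unfolding \<mu>_def by (subst emeasure_distr) (auto intro!: arg_cong2[where f=emeasure])
      ultimately show "emeasure (\<alpha> (semidirect \<mu> p)) UNIV = emeasure (\<alpha> \<pi>) UNIV"
        "emeasure (\<alpha> (semidirect \<mu> p)) UNIV \<noteq> \<infinity>"
        using sets by (auto simp: \<alpha>)
      show "emeasure (\<alpha> (semidirect \<mu> p)) U \<le> emeasure (\<alpha> \<pi>) U" if "open U" for U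
        using le[of A U] that A sets by (simp add: \<alpha> P.emeasure_semidirect_Times \<pi>.emeasure_eq_measure)
    qed (simp_all add: \<alpha>_def)
    then show "emeasure (semidirect \<mu> p) X = emeasure \<pi> X"
      unfolding X using \<alpha>[of "semidirect \<mu> p" B] \<alpha>[OF sets B] B by simp
  qed auto
  then show ?thesis using P.prob_kernel_axioms unfolding \<mu>_def by blast
qed

section \<open>Kernels with finite moments\<close>

lemma sets_mixture [simp]: "sets (mixture t p q) = sets borel"
  using sets.sigma_sets_eq[of borel] by (simp add: mixture_def)

text \<open>A mixture is a two-stage experiment: a Bernoulli variable decides between
  \<open>p\<close> and \<open>q\<close>. Integrals against mixtures then follow from the integral
  formula for \<open>bind\<close>.\<close>

lemma mixture_eq_bind:
  assumes "t \<in> {0..1}" and p: "sets p = sets borel" "prob_space p" and q: "sets q = sets borel" "prob_space q"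
  shows "mixture t p q = measure_pmf (bernoulli_pmf t) \<bind> (\<lambda>b. if b then q else p)"
    and "(\<lambda>b. if b then q else p) \<in> measure_pmf (bernoulli_pmf t) \<rightarrow>\<^sub>M subprob_algebra borel"
proof -
  show m: "(\<lambda>b. if b then q else p) \<in> measure_pmf (bernoulli_pmf t) \<rightarrow>\<^sub>M subprob_algebra borel"
    using p q by (simp add: space_subprob_algebra prob_space_imp_subprob_space)
  show "mixture t p q = measure_pmf (bernoulli_pmf t) \<bind> (\<lambda>b. if b then q else p)"
  proof (rule measure_eqI)
    show "sets (mixture t p q) = sets (measure_pmf (bernoulli_pmf t) \<bind> (\<lambda>b. if b then q else p))"
      using p q by (subst sets_bind[where N=borel]) auto
    fix A assume "A \<in> sets (mixture t p q)"
    then have A: "A \<in> sets borel" by simp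
    show "emeasure (mixture t p q) A = emeasure (measure_pmf (bernoulli_pmf t) \<bind> (\<lambda>b. if b then q else p)) A"
      using assms A m by (subst emeasure_bind[where N=borel]) (auto simp: emeasure_mixture ac_simps)
  qed
qed

lemma nn_integral_mixture:
  assumes "t \<in> {0..1}" "sets p = sets borel" "prob_space p" "sets q = sets borel" "prob_space q"
    and f: "f \<in> borel_measurable borel"
  shows "(\<integral>\<^sup>+y. f y \<partial>mixture t p q) = ennreal (1 - t) * (\<integral>\<^sup>+y. f y \<partial>p) + ennreal t * (\<integral>\<^sup>+y. f y \<partial>q)"
proof -
  have "(\<integral>\<^sup>+y. f y \<partial>mixture t p q) =
      (\<integral>\<^sup>+b. (\<integral>\<^sup>+y. f y \<partial>(if b then q else p)) \<partial>measure_pmf (bernoulli_pmf t))"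
    using mixture_eq_bind[OF assms(1-5)] f by (simp add: nn_integral_bind[where B=borel])
  then show ?thesis using assms(1) by (simp add: ac_simps)
qed

lemma prob_space_mixture:
  assumes "t \<in> {0..1}" "sets p = sets borel" "prob_space p" "sets q = sets borel" "prob_space q"
  shows "prob_space (mixture t p q)"
proof
  have "space p = UNIV" "space q = UNIV" 
    using sets_eq_imp_space_eq[OF assms(2)] sets_eq_imp_space_eq[OF assms(4)] by simp_all
  then have "emeasure p UNIV = 1" "emeasure q UNIV = 1"
    using prob_space.emeasure_space_1[OF assms(3)] prob_space.emeasure_space_1[OF assms(5)] by simp_all
  then show "emeasure (mixture t p q) (space (mixture t p q)) = 1"
    using assms by (simp add: mixture_def[of t p q] emeasure_mixture[of p q UNIV t, unfolded mixture_def]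
        ennreal_plus[symmetric] del: ennreal_plus)
qed

lemma integral_mixture:
  fixes f :: "'a::topological_space \<Rightarrow> real"
  assumes t: "t \<in> {0..1}" and p: "sets p = sets borel" "prob_space p" and q: "sets q = sets borel" "prob_space q"
    and f: "f \<in> borel_measurable borel" and ip: "integrable p f" and iq: "integrable q f"
  shows "(\<integral>y. f y \<partial>mixture t p q) = (1 - t) * (\<integral>y. f y \<partial>p) + t * (\<integral>y. f y \<partial>q)"
proof -
  have part: "enn2real (\<integral>\<^sup>+y. ennreal (g y) \<partial>mixture t p q) =
      (1 - t) * enn2real (\<integral>\<^sup>+y. ennreal (g y) \<partial>p) + t * enn2real (\<integral>\<^sup>+y. ennreal (g y) \<partial>q)"
    "(\<integral>\<^sup>+y. ennreal (g y) \<partial>mixture t p q) < \<infinity>"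
    if "integrable p g" "integrable q g" "g \<in> borel_measurable borel" for g :: "'a \<Rightarrow> real"
  proof -
    have fin: "(\<integral>\<^sup>+y. ennreal (g y) \<partial>p) < \<infinity>" "(\<integral>\<^sup>+y. ennreal (g y) \<partial>q) < \<infinity>"
      using that real_integrable_def[of p g] real_integrable_def[of q g] by (auto simp: less_top)
    have eq: "(\<integral>\<^sup>+y. ennreal (g y) \<partial>mixture t p q) =
      ennreal (1 - t) * (\<integral>\<^sup>+y. ennreal (g y) \<partial>p) + ennreal t * (\<integral>\<^sup>+y. ennreal (g y) \<partial>q)"
      using that by (intro nn_integral_mixture[OF t p q]) auto
    show "enn2real (\<integral>\<^sup>+y. ennreal (g y) \<partial>mixture t p q) =
      (1 - t) * enn2real (\<integral>\<^sup>+y. ennreal (g y) \<partial>p) + t * enn2real (\<integral>\<^sup>+y. ennreal (g y) \<partial>q)"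
      unfolding eq using fin t by (subst enn2real_plus) (auto simp: enn2real_mult ennreal_mult_less_top)
    show "(\<integral>\<^sup>+y. ennreal (g y) \<partial>mixture t p q) < \<infinity>"
      unfolding eq using fin by (auto simp: ennreal_mult_less_top)
  qed
  have ng: "integrable p (\<lambda>y. - f y)" "integrable q (\<lambda>y. - f y)" "(\<lambda>y. - f y) \<in> borel_measurable borel"
    using ip iq f by auto
  have fm: "f \<in> borel_measurable (mixture t p q)" using f by (simp cong: measurable_cong_sets)
  have im: "integrable (mixture t p q) f"
    unfolding real_integrable_def using part(2)[OF ip iq f] part(2)[OF ng] fm by (auto simp: less_top)
  show ?thesis
    unfolding real_lebesgue_integral_def[OF im] real_lebesgue_integral_def[OF ip] real_lebesgue_integral_def[OF iq]
      part(1)[OF ip iq f] part(1)[OF ng] by (simp add: algebra_simps)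
qed

section \<open>The weight, the admissible kernels, and the transport cost as an infimum over
  them\<close>

locale weight =
  fixes \<gamma> :: "real \<Rightarrow> real" and xo :: "'a::polish_space"
  assumes gamma_nonneg: "\<And>u. u \<ge> 0 \<Longrightarrow> \<gamma> u \<ge> 0"
    and gamma_lsc: "lsc_map (top_of_set {0..}) \<gamma>"
    and gamma_zero: "\<gamma> 0 = 0"
begin

abbreviation w :: "'a \<Rightarrow> real" where "w \<equiv> weight1 \<gamma> xo"

lemma w_nonneg [simp]: "0 \<le> w x"
  by (simp add: weight1_def gamma_nonneg)

lemma w_xo [simp]: "w xo = 0"
  by (simp add: weight1_def gamma_zero)

lemma w_open: "open {x. a < w x}"
proof -
  have "openin (top_of_set {0..}) {z\<in>{0..}. a < \<gamma> z}"
    using gamma_lsc unfolding lsc_map_def by simp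
  then obtain T where T: "open T" "{z\<in>{0..}. a < \<gamma> z} = {0..} \<inter> T"
    by (auto simp: openin_open)
  have "a < \<gamma> u \<longleftrightarrow> u \<in> T" if "0 \<le> u" for u
    using T(2) that by blast
  then have "{x. a < w x} = (\<lambda>x. dist x xo) -` T"
    by (auto simp: weight1_def)
  moreover have "open ((\<lambda>x. dist x xo) -` T)"
    by (intro open_vimage T continuous_intros)
  ultimately show ?thesis by simp
qed

lemma w_closed: "closed {x. w x \<le> a}"
proof -
  have "- {x. w x \<le> a} = {x. a < w x}" by auto
  then show ?thesis using w_open by (simp add: closed_def)
qed

lemma w_measurable [measurable]: "w \<in> borel_measurable borel"
  by (rule borel_measurable_iff_greater[THEN iffD2]) (use w_open in auto)

lemma weight2_eq: "weight2 \<gamma> xo (x, y) = w x + w y"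
  by (simp add: weight2_def weight1_def dist_commute)

lemma P_gammaD:
  assumes "p \<in> P_gamma \<gamma> xo"
  shows "sets p = sets borel" "space p = UNIV" "prob_space p" "(\<integral>\<^sup>+x. ennreal (w x) \<partial>p) < \<infinity>"
  using assms sets_eq_imp_space_eq[of p borel] by (auto simp: P_gamma_def P_weight_def)

lemma P_gammaI:
  "sets p = sets borel \<Longrightarrow> prob_space p \<Longrightarrow> (\<integral>\<^sup>+x. ennreal (w x) \<partial>p) < \<infinity> \<Longrightarrow> p \<in> P_gamma \<gamma> xo"
  by (auto simp: P_gamma_def P_weight_def)

lemma return_in_P_gamma: "return borel xo \<in> P_gamma \<gamma> xo"
  by (intro P_gammaI) (auto simp: nn_integral_return prob_space_return)

lemma PhiD:
  assumes "\<phi> \<in> Phi_weight w"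
  shows "continuous_on UNIV \<phi>" "\<phi> \<in> borel_measurable borel" "\<exists>a\<ge>0. \<exists>b\<ge>0. \<forall>z. \<bar>\<phi> z\<bar> \<le> a + b * w z"
  using assms by (auto simp: Phi_weight_def borel_measurable_continuous_onI)

lemma integrable_Phi:
  assumes \<phi>: "\<phi> \<in> Phi_weight w" and p: "p \<in> P_gamma \<gamma> xo"
  shows "integrable p \<phi>"
proof -
  note P = P_gammaD[OF p]
  interpret prob_space p by (rule P)
  obtain a b where ab: "a \<ge> 0" "b \<ge> 0" "\<And>z. \<bar>\<phi> z\<bar> \<le> a + b * w z" using PhiD[OF \<phi>] by blast
  have [measurable_cong]: "sets p = sets borel" by (rule P)
  have "integrable p w"
    by (rule integrableI_nonneg) (use P in auto)
  then have "integrable p (\<lambda>z. a + b * w z)" by simp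
  moreover have "\<phi> \<in> borel_measurable p"
    using PhiD(2)[OF \<phi>] measurable_cong_sets[OF P(1) refl] by blast
  moreover have "norm (\<phi> z) \<le> norm (a + b * w z)" for z
    using ab(3)[of z] by simp
  ultimately show ?thesis by (rule Bochner_Integration.integrable_bound[OF _ _ AE_I2])
qed

lemma kernelD:
  assumes "p \<in> P_gamma_kernels \<gamma> xo"
  shows "p \<in> borel \<rightarrow>\<^sub>M prob_algebra borel" "p x \<in> P_gamma \<gamma> xo"
  using assms by (auto simp: P_gamma_kernels_def)

lemma prob_kernelI:
  "\<mu> \<in> P_gamma \<gamma> xo \<Longrightarrow> p \<in> P_gamma_kernels \<gamma> xo \<Longrightarrow> prob_kernel \<mu> p"
  by (rule prob_kernel.intro) (rule P_gammaD kernelD, assumption)+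

lemma const_kernel: "p \<in> P_gamma \<gamma> xo \<Longrightarrow> (\<lambda>_. p) \<in> P_gamma_kernels \<gamma> xo"
  using P_gammaD[of p] by (auto simp: P_gamma_kernels_def space_prob_algebra intro!: measurable_const)

text \<open>Where \<open>p x\<close> has infinite moment it is replaced by the Dirac mass at
  \<open>xo\<close>, which is admissible because \<open>w xo = 0\<close>. The set of such
  \<open>x\<close> is Borel, since the moment depends measurably on \<open>x\<close>.\<close>

lemma ex_kernel_version:
  assumes "prob_kernel \<mu> p" and ae: "AE x in \<mu>. p x \<in> P_gamma \<gamma> xo"
  shows "\<exists>q\<in>P_gamma_kernels \<gamma> xo. AE x in \<mu>. q x = p x"
proof -
  interpret prob_kernel \<mu> p by fact
  define S where "S = {x. (\<integral>\<^sup>+y. ennreal (w y) \<partial>p x) < \<infinity>}"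
  have "(\<lambda>x. \<integral>\<^sup>+y. ennreal (w y) \<partial>p x) \<in> borel_measurable borel"
    by (intro nn_integral_measurable_subprob_algebra2[where N=borel]) (auto simp: measurable_split_conv kernel_subprob)
  then have [measurable]: "S \<in> sets borel"
    unfolding S_def by measurable
  have S: "p x \<in> P_gamma \<gamma> xo \<longleftrightarrow> x \<in> S" for x
    using kernel_prob[of x] by (auto simp: S_def P_gamma_def P_weight_def)
  let ?q = "\<lambda>x. if x \<in> S then p x else return borel xo"
  have "?q \<in> borel \<rightarrow>\<^sub>M prob_algebra borel"
    using kernel by (intro measurable_If_set) (auto simp: space_prob_algebra prob_space_return)
  then have "?q \<in> P_gamma_kernels \<gamma> xo"
    using S return_in_P_gamma by (auto simp: P_gamma_kernels_def)
  moreover have "AE x in \<mu>. ?q x = p x"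
    using ae by eventually_elim (auto simp: S)
  ultimately show ?thesis by (rule bexI[of _ ?q, rotated])
qed

lemma mixture_in_P_gamma:
  assumes "t \<in> {0..1}" and p: "p \<in> P_gamma \<gamma> xo" and q: "q \<in> P_gamma \<gamma> xo"
  shows "mixture t p q \<in> P_gamma \<gamma> xo"
proof (rule P_gammaI)
  note P = P_gammaD[OF p] and Q = P_gammaD[OF q]
  show "prob_space (mixture t p q)" using assms(1) P Q by (intro prob_space_mixture)
  show "(\<integral>\<^sup>+x. ennreal (w x) \<partial>mixture t p q) < \<infinity>"
    using assms(1) P Q by (subst nn_integral_mixture) (auto simp: ennreal_mult_less_top)
qed simp

lemma mixture_kernel:
  assumes t: "t \<in> {0..1}" and p: "p \<in> P_gamma_kernels \<gamma> xo" and q: "q \<in> P_gamma_kernels \<gamma> xo"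
  shows "(\<lambda>x. mixture t (p x) (q x)) \<in> P_gamma_kernels \<gamma> xo"
proof -
  note P = P_gammaD[OF kernelD(2)[OF p]] and Q = P_gammaD[OF kernelD(2)[OF q]]
  have "(\<lambda>x. mixture t (p x) (q x)) \<in> borel \<rightarrow>\<^sub>M prob_algebra borel"
  proof (rule measurable_prob_algebra_generated[where G="sets borel" and \<Omega>=UNIV])
    show "sets borel = sigma_sets UNIV (sets (borel :: 'a measure))"
      using sets.sigma_sets_eq[of "borel :: 'a measure"] by simp
    show "Int_stable (sets (borel :: 'a measure))" by (auto simp: Int_stable_def)
    fix A :: "'a set" assume A: "A \<in> sets borel"
    have "(\<lambda>x. emeasure (p x) A) \<in> borel_measurable borel" "(\<lambda>x. emeasure (q x) A) \<in> borel_measurable borel"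
      using A measurable_prob_algebraD[OF kernelD(1)[OF p]] measurable_prob_algebraD[OF kernelD(1)[OF q]]
      by (auto intro: measurable_emeasure_kernel)
    then show "(\<lambda>x. emeasure (mixture t (p x) (q x)) A) \<in> borel_measurable borel"
      using A P Q by (subst emeasure_mixture) auto
  qed (use t P Q in \<open>auto intro: prob_space_mixture\<close>)
  then show ?thesis using t p q by (auto simp: P_gamma_kernels_def intro: mixture_in_P_gamma)
qed

lemma bind_mixture_kernel:
  assumes t: "t \<in> {0..1}" and \<mu>: "\<mu> \<in> P_gamma \<gamma> xo"
    and p: "p \<in> P_gamma_kernels \<gamma> xo" and q: "q \<in> P_gamma_kernels \<gamma> xo"
  shows "\<mu> \<bind> (\<lambda>x. mixture t (p x) (q x)) = mixture t (\<mu> \<bind> p) (\<mu> \<bind> q)"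
proof -
  interpret p: prob_kernel \<mu> p using \<mu> p by (rule prob_kernelI)
  interpret q: prob_kernel \<mu> q using \<mu> q by (rule prob_kernelI)
  interpret r: prob_kernel \<mu> "\<lambda>x. mixture t (p x) (q x)"
    using \<mu> mixture_kernel[OF t p q] by (rule prob_kernelI)
  show ?thesis
  proof (rule measure_eqI)
    fix A assume "A \<in> sets (\<mu> \<bind> (\<lambda>x. mixture t (p x) (q x)))"
    then have A [measurable]: "A \<in> sets borel" by simp
    note [measurable] = measurable_emeasure_kernel[OF measurable_prob_algebraD[OF p.kernel_base] A]
      measurable_emeasure_kernel[OF measurable_prob_algebraD[OF q.kernel_base] A]
    show "emeasure (\<mu> \<bind> (\<lambda>x. mixture t (p x) (q x))) A = emeasure (mixture t (\<mu> \<bind> p) (\<mu> \<bind> q)) A"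
      unfolding emeasure_mixture[OF p.sets_bind_kernel q.sets_bind_kernel A]
        emeasure_bind_prob_algebra[OF p.base_in p.kernel A] emeasure_bind_prob_algebra[OF p.base_in q.kernel A]
        emeasure_bind_prob_algebra[OF p.base_in r.kernel A]
      by (simp add: emeasure_mixture A nn_integral_add nn_integral_cmult)
  qed simp
qed

text \<open>The kernel \<open>p\<close> is itself one of the versions, so the choice made in
  \<open>I_cost\<close> is not vacuous, and whichever version it picks differs from \<open>p\<close>
  on a null set only.\<close>

lemma disintegrates_semidirect:
  assumes \<mu>: "\<mu> \<in> P_gamma \<gamma> xo" and p: "p \<in> P_gamma_kernels \<gamma> xo"
  shows "disintegrates \<gamma> xo (semidirect \<mu> p) q \<longleftrightarrow>
    q \<in> P_gamma_kernels \<gamma> xo \<and> (AE x in \<mu>. p x = q x)"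
proof -
  interpret prob_kernel \<mu> p using \<mu> p by (rule prob_kernelI)
  show ?thesis
  proof (intro iffI conjI)
    assume d: "disintegrates \<gamma> xo (semidirect \<mu> p) q"
    then show q: "q \<in> P_gamma_kernels \<gamma> xo" by (simp add: disintegrates_def)
    show "AE x in \<mu>. p x = q x"
    proof (rule kernel_unique)
      fix A B :: "'a set" assume "A \<in> sets borel" "B \<in> sets borel"
      then show "(\<integral>\<^sup>+x\<in>A. emeasure (p x) B \<partial>\<mu>) = (\<integral>\<^sup>+x\<in>A. emeasure (q x) B \<partial>\<mu>)"
        using d by (simp add: disintegrates_def emeasure_semidirect_Times distr_fst_semidirect)
    qed (use \<mu> q in \<open>auto intro: prob_kernelI prob_kernel_axioms\<close>)
  next
    assume q: "q \<in> P_gamma_kernels \<gamma> xo \<and> (AE x in \<mu>. p x = q x)"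
    show "disintegrates \<gamma> xo (semidirect \<mu> p) q"
      unfolding disintegrates_def distr_fst_semidirect
    proof (intro conjI ballI)
      fix A B :: "'a set" assume "A \<in> sets borel" "B \<in> sets borel"
      then show "emeasure (semidirect \<mu> p) (A \<times> B) = (\<integral>\<^sup>+x\<in>A. emeasure (q x) B \<partial>\<mu>)"
        using q by (subst emeasure_semidirect_Times) (auto intro!: nn_integral_cong_AE elim!: eventually_mono)
    qed (use q in auto)
  qed
qed

lemma I_cost_semidirect:
  assumes \<mu>: "\<mu> \<in> P_gamma \<gamma> xo" and p: "p \<in> P_gamma_kernels \<gamma> xo"
  shows "I_cost \<gamma> xo c (semidirect \<mu> p) = (\<integral>\<^sup>+x. c x (p x) \<partial>\<mu>)"
proof -
  interpret prob_kernel \<mu> p using \<mu> p by (rule prob_kernelI)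
  define q where "q = (SOME q. disintegrates \<gamma> xo (semidirect \<mu> p) q)"
  have "disintegrates \<gamma> xo (semidirect \<mu> p) q"
    unfolding q_def by (rule someI[of _ p]) (use disintegrates_semidirect[OF \<mu> p] p in auto)
  then have "AE x in \<mu>. p x = q x" using disintegrates_semidirect[OF \<mu> p] by simp
  then have "(\<integral>\<^sup>+x. c x (q x) \<partial>\<mu>) = (\<integral>\<^sup>+x. c x (p x) \<partial>\<mu>)"
    by (intro nn_integral_cong_AE) (auto elim!: eventually_mono)
  then show ?thesis by (simp add: I_cost_def q_def[symmetric] distr_fst_semidirect)
qed

lemma semidirect_in_couplings:
  assumes "prob_kernel \<mu> p"
  shows "semidirect \<mu> p \<in> couplings \<mu> (\<mu> \<bind> p)"
proof -
  interpret prob_kernel \<mu> p by fact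
  show ?thesis unfolding couplings_def
    using prob_semidirect distr_fst_semidirect distr_snd_semidirect sets_semidirect by blast
qed

text \<open>The moment of the second marginal is the \<mu>-integral of the moments of
  \<open>p x\<close>, and a function with finite integral is finite almost everywhere.\<close>

lemma AE_kernel_in_P_gamma:
  assumes "prob_kernel \<mu> p" and \<nu>: "\<mu> \<bind> p \<in> P_gamma \<gamma> xo"
  shows "AE x in \<mu>. p x \<in> P_gamma \<gamma> xo"
proof -
  interpret prob_kernel \<mu> p by fact
  have m: "(\<lambda>x. \<integral>\<^sup>+y. ennreal (w y) \<partial>p x) \<in> borel_measurable \<mu>"
    using kernel_base by (intro nn_integral_measurable_subprob_algebra2[where N=borel])
      (auto simp: measurable_split_conv measurable_prob_algebraD)
  have "(\<integral>\<^sup>+x. \<integral>\<^sup>+y. ennreal (w y) \<partial>p x \<partial>\<mu>) \<noteq> \<infinity>"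
    using P_gammaD(4)[OF \<nu>] by (subst nn_integral_bind_kernel[symmetric]) auto
  from nn_integral_noteq_infinite[OF m this] show ?thesis
    by eventually_elim (auto intro!: P_gammaI simp: kernel_prob less_top)
qed

lemma coupling_is_semidirect:
  assumes \<mu>: "\<mu> \<in> P_gamma \<gamma> xo" and \<nu>: "\<nu> \<in> P_gamma \<gamma> xo" and \<pi>: "\<pi> \<in> couplings \<mu> \<nu>"
  shows "\<exists>p\<in>P_gamma_kernels \<gamma> xo. \<pi> = semidirect \<mu> p \<and> \<mu> \<bind> p = \<nu>"
proof -
  from \<pi> have \<pi>': "sets \<pi> = sets borel" "prob_space \<pi>" "distr \<pi> borel fst = \<mu>" "distr \<pi> borel snd = \<nu>"
    by (auto simp: couplings_def)
  from ex_disintegration[OF \<pi>'(1,2)] obtain p where p: "prob_kernel \<mu> p" "semidirect \<mu> p = \<pi>"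
    unfolding \<pi>'(3) by blast
  interpret prob_kernel \<mu> p by fact
  have \<nu>': "\<mu> \<bind> p = \<nu>" using distr_snd_semidirect unfolding p(2) \<pi>'(4) by simp
  then have "AE x in \<mu>. p x \<in> P_gamma \<gamma> xo" using \<nu> by (intro AE_kernel_in_P_gamma[OF p(1)]) simp
  from ex_kernel_version[OF p(1) this] obtain q where q: "q \<in> P_gamma_kernels \<gamma> xo" "AE x in \<mu>. q x = p x"
    by blast
  interpret q: prob_kernel \<mu> q using \<mu> q(1) by (rule prob_kernelI)
  have "semidirect \<mu> q = semidirect \<mu> p"
    unfolding semidirect_def
    by (rule bind_cong_AE[OF refl pair_kernel_base[THEN measurable_prob_algebraD] q.pair_kernel_base[THEN measurable_prob_algebraD], symmetric]) (use q(2) in \<open>auto elim!: eventually_mono\<close>)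
  then have "semidirect \<mu> q = \<pi>" using p(2) by simp
  moreover from this have "\<mu> \<bind> q = \<nu>" using q.distr_snd_semidirect \<pi>'(4) by simp
  ultimately show ?thesis using q(1) by blast
qed

lemma T_cost_eq:
  assumes \<mu>: "\<mu> \<in> P_gamma \<gamma> xo" and \<nu>: "\<nu> \<in> P_gamma \<gamma> xo"
  shows "T_cost \<gamma> xo c \<nu> \<mu> = (INF p\<in>{p \<in> P_gamma_kernels \<gamma> xo. \<mu> \<bind> p = \<nu>}. \<integral>\<^sup>+x. c x (p x) \<partial>\<mu>)"
  unfolding T_cost_def
proof (rule antisym)
  show "(INF \<pi>\<in>couplings \<mu> \<nu>. I_cost \<gamma> xo c \<pi>) \<le>
    (INF p\<in>{p \<in> P_gamma_kernels \<gamma> xo. \<mu> \<bind> p = \<nu>}. \<integral>\<^sup>+x. c x (p x) \<partial>\<mu>)"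
  proof (rule INF_greatest)
    fix p assume "p \<in> {p \<in> P_gamma_kernels \<gamma> xo. \<mu> \<bind> p = \<nu>}"
    then have p: "p \<in> P_gamma_kernels \<gamma> xo" "\<mu> \<bind> p = \<nu>" by auto
    have "semidirect \<mu> p \<in> couplings \<mu> \<nu>"
      using semidirect_in_couplings[OF prob_kernelI[OF \<mu> p(1)]] p(2) by simp
    then show "(INF \<pi>\<in>couplings \<mu> \<nu>. I_cost \<gamma> xo c \<pi>) \<le> (\<integral>\<^sup>+x. c x (p x) \<partial>\<mu>)"
      using I_cost_semidirect[OF \<mu> p(1), of c] by (metis INF_lower)
  qed
  show "(INF p\<in>{p \<in> P_gamma_kernels \<gamma> xo. \<mu> \<bind> p = \<nu>}. \<integral>\<^sup>+x. c x (p x) \<partial>\<mu>) \<le>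
    (INF \<pi>\<in>couplings \<mu> \<nu>. I_cost \<gamma> xo c \<pi>)"
  proof (rule INF_greatest)
    fix \<pi> assume "\<pi> \<in> couplings \<mu> \<nu>"
    from coupling_is_semidirect[OF \<mu> \<nu> this] obtain p where
      p: "p \<in> P_gamma_kernels \<gamma> xo" "\<pi> = semidirect \<mu> p" "\<mu> \<bind> p = \<nu>" by blast
    then show "(INF p\<in>{p \<in> P_gamma_kernels \<gamma> xo. \<mu> \<bind> p = \<nu>}. \<integral>\<^sup>+x. c x (p x) \<partial>\<mu>) \<le> I_cost \<gamma> xo c \<pi>"
      using I_cost_semidirect[OF \<mu> p(1), of c] by (intro INF_lower2[of p]) auto
  qed
qed

end

section \<open>Separation with bounded multipliers\<close>

text \<open>Because of the bound \<open>\<bar>a i\<bar> \<le> N\<close> the multipliers can be chosen one at a time, by separating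
  a convex subset of the plane from a point.\<close>

lemma convex_separation:
  fixes D :: "'d set" and J :: "'d \<Rightarrow> real" and z :: "'i \<Rightarrow> 'd \<Rightarrow> real"
  assumes "finite \<Psi>" and N: "0 \<le> N"
    and conv: "\<And>p q t. p \<in> D \<Longrightarrow> q \<in> D \<Longrightarrow> t \<in> {0..1} \<Longrightarrow>
      \<exists>r\<in>D. J r \<le> (1 - t) * J p + t * J q \<and> (\<forall>i\<in>\<Psi>. z i r = (1 - t) * z i p + t * z i q)"
    and le: "\<And>p. p \<in> D \<Longrightarrow> \<alpha> \<le> J p + N * (\<Sum>i\<in>\<Psi>. \<bar>z i p\<bar>)"
  shows "\<exists>a. \<forall>p\<in>D. \<alpha> \<le> J p + (\<Sum>i\<in>\<Psi>. a i * z i p)"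
  using assms(1) conv le
proof (induction \<Psi> arbitrary: J)
  case empty
  then show ?case by auto
next
  case (insert i \<Psi>)
  \<comment> \<open>The constraints in \<open>\<Psi>\<close> stay penalised for the moment, so that
    the multiplier of \<open>z i\<close> can be found from the pairs (\<open>z i p\<close>,
    \<open>H p\<close>) alone.\<close>
  define H where "H p = J p + N * (\<Sum>i\<in>\<Psi>. \<bar>z i p\<bar>)" for p
  have H: "\<alpha> \<le> H p + N * \<bar>z i p\<bar>" if "p \<in> D" for p
    using insert.prems(2)[OF that] insert.hyps by (simp add: H_def algebra_simps)
  have Hconv: "\<exists>r\<in>D. H r \<le> (1 - t) * H p + t * H q \<and> z i r = (1 - t) * z i p + t * z i q"
    if pq: "p \<in> D" "q \<in> D" and t: "t \<in> {0..1}" for p q t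
  proof -
    obtain r where r: "r \<in> D" "J r \<le> (1 - t) * J p + t * J q"
      "\<And>j. j \<in> insert i \<Psi> \<Longrightarrow> z j r = (1 - t) * z j p + t * z j q"
      using insert.prems(1)[OF pq t] by blast
    have "(\<Sum>j\<in>\<Psi>. \<bar>z j r\<bar>) \<le> (\<Sum>j\<in>\<Psi>. (1 - t) * \<bar>z j p\<bar> + t * \<bar>z j q\<bar>)"
    proof (rule sum_mono)
      fix j assume "j \<in> \<Psi>"
      then have "\<bar>z j r\<bar> = \<bar>(1 - t) * z j p + t * z j q\<bar>" using r(3) by simp
      also have "\<dots> \<le> \<bar>(1 - t) * z j p\<bar> + \<bar>t * z j q\<bar>" by (rule abs_triangle_ineq)
      finally show "\<bar>z j r\<bar> \<le> (1 - t) * \<bar>z j p\<bar> + t * \<bar>z j q\<bar>" using t by (simp add: abs_mult)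
    qed
    then have "N * (\<Sum>j\<in>\<Psi>. \<bar>z j r\<bar>) \<le> N * ((1 - t) * (\<Sum>j\<in>\<Psi>. \<bar>z j p\<bar>) + t * (\<Sum>j\<in>\<Psi>. \<bar>z j q\<bar>))"
      using N by (intro mult_left_mono) (simp_all add: sum.distrib sum_distrib_left)
    then have "H r \<le> (1 - t) * H p + t * H q"
      using r(2) by (simp add: H_def algebra_simps)
    then show ?thesis using r(1,3) by auto
  qed
  \<comment> \<open>The multiplier has to be at least every slope in \<open>S\<close> and at most
    every slope coming from a point with \<open>z i p < 0\<close>. The element \<open>- N\<close>
    keeps \<open>S\<close> nonempty when no point has \<open>z i p > 0\<close>.\<close>
  define S where "S = insert (- N) {(\<alpha> - H p) / z i p | p. p \<in> D \<and> 0 < z i p}"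
  have cross: "(\<alpha> - H p) / z i p \<le> (H q - \<alpha>) / (- z i q)"
    if p: "p \<in> D" "0 < z i p" and q: "q \<in> D" "z i q < 0" for p q
  proof -
    \<comment> \<open>The weight for which \<open>z i\<close> vanishes at the mixture; there the
      fact \<open>H\<close> reduces to a lower bound on the penalised objective alone.\<close>
    define t where "t = z i p / (z i p - z i q)"
    have t: "t \<in> {0..1}" "1 - t = - z i q / (z i p - z i q)" using p q by (auto simp: t_def field_simps)
    obtain r where r: "r \<in> D" "H r \<le> (1 - t) * H p + t * H q" "z i r = (1 - t) * z i p + t * z i q"
      using Hconv[OF p(1) q(1) t(1)] by blast
    have "z i r = 0" unfolding r(3) t(2) by (simp add: t_def field_simps)
    then have "\<alpha> \<le> (1 - t) * H p + t * H q" using H[OF r(1)] r(2) by simp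
    also have "\<dots> = (- z i q * H p + z i p * H q) / (z i p - z i q)"
      unfolding t(2) by (simp add: t_def add_divide_distrib diff_divide_distrib)
    finally have "\<alpha> * (z i p - z i q) \<le> - z i q * H p + z i p * H q"
      using p q by (simp add: pos_le_divide_eq)
    then show ?thesis using p q by (simp add: field_simps)
  qed
  have S_le_N: "s \<le> N" if "s \<in> S" for s
    using that H N by (fastforce simp: S_def field_simps)
  have bdd: "bdd_above S" using S_le_N by (auto simp: bdd_above_def)
  define a0 where "a0 = Sup S"
  have key: "\<alpha> \<le> H p + a0 * z i p" if p: "p \<in> D" for p
  proof -
    consider "z i p = 0" | "0 < z i p" | "z i p < 0" by linarith
    then show ?thesis
    proof cases
      case 1
      then show ?thesis using H[OF p] by simp
    next
      case 2
      then have "(\<alpha> - H p) / z i p \<le> a0"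
        unfolding a0_def using p by (intro cSup_upper bdd) (auto simp: S_def)
      then show ?thesis using 2 by (simp add: pos_divide_le_eq)
    next
      case 3
      have "a0 \<le> (H p - \<alpha>) / (- z i p)"
        unfolding a0_def
      proof (rule cSup_least)
        fix s assume "s \<in> S"
        then consider "s = - N" | q where "q \<in> D" "0 < z i q" "s = (\<alpha> - H q) / z i q" by (auto simp: S_def)
        then show "s \<le> (H p - \<alpha>) / (- z i p)"
        proof cases
          case 1
          then show ?thesis using H[OF p] 3 by (simp add: field_simps)
        next
          case 2
          then show ?thesis using cross[OF _ _ p 3] by simp
        qed
      qed (simp add: S_def)
      then show ?thesis using 3 by (simp add: field_simps)
    qed
  qed
  \<comment> \<open>The objective \<open>J p + a0 * z i p\<close> inherits the convexity hypothesis
    because \<open>z i\<close> is affine along mixtures, and \<open>key\<close> is the remaining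
    hypothesis with one constraint fewer.\<close>
  have "\<exists>a. \<forall>p\<in>D. \<alpha> \<le> (J p + a0 * z i p) + (\<Sum>i\<in>\<Psi>. a i * z i p)"
  proof (rule insert.IH)
    fix p assume "p \<in> D"
    then show "\<alpha> \<le> J p + a0 * z i p + N * (\<Sum>i\<in>\<Psi>. \<bar>z i p\<bar>)" using key by (simp add: H_def algebra_simps)
  next
    fix p q and t :: real assume pq: "p \<in> D" "q \<in> D" and t: "t \<in> {0..1}"
    obtain r where r: "r \<in> D" "J r \<le> (1 - t) * J p + t * J q"
      "\<And>j. j \<in> insert i \<Psi> \<Longrightarrow> z j r = (1 - t) * z j p + t * z j q"
      using insert.prems(1)[OF pq t] by blast
    have "J r + a0 * z i r \<le> (1 - t) * (J p + a0 * z i p) + t * (J q + a0 * z i q)"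
      unfolding r(3)[OF insertI1] using r(2) by (simp add: algebra_simps)
    with r(1,3) show "\<exists>r\<in>D. J r + a0 * z i r \<le> (1 - t) * (J p + a0 * z i p) + t * (J q + a0 * z i q) \<and>
        (\<forall>i\<in>\<Psi>. z i r = (1 - t) * z i p + t * z i q)"
      by blast
  qed
  then obtain a where a: "\<And>p. p \<in> D \<Longrightarrow> \<alpha> \<le> (J p + a0 * z i p) + (\<Sum>i\<in>\<Psi>. a i * z i p)" by blast
  have "(\<Sum>j\<in>\<Psi>. (a(i := a0)) j * z j p) = (\<Sum>j\<in>\<Psi>. a j * z j p)" for p
    using insert.hyps by (intro sum.cong) auto
  then show ?case using a insert.hyps by (intro exI[of _ "a(i := a0)"]) (auto simp: add.assoc)
qed

section \<open>Stable convergence of couplings\<close>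

text \<open>Convergence of integrals controls the subbasic sets, and the property passes to finite
  intersections and arbitrary unions. Membership in \<open>P_weight w\<close> is a separate
  hypothesis, because all open sets consist of such measures.\<close>

lemma eventually_sigma_topology:
  assumes U: "openin (sigma_topology w) U" "l \<in> U"
    and P: "\<forall>\<^sub>F i in F. f i \<in> P_weight w"
    and lim: "\<And>\<phi>. \<phi> \<in> Phi_weight w \<Longrightarrow> ((\<lambda>i. \<integral>z. \<phi> z \<partial>f i) \<longlongrightarrow> (\<integral>z. \<phi> z \<partial>l)) F"
  shows "\<forall>\<^sub>F i in F. f i \<in> U"
proof -
  have "generate_topology_on {{\<mu> \<in> P_weight w. (\<integral>z. \<phi> z \<partial>\<mu>) \<in> U} | \<phi> U. \<phi> \<in> Phi_weight w \<and> open U} U"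
    using U(1) by (simp add: sigma_topology_def openin_topology_generated_by_iff)
  then show ?thesis using U(2)
  proof induction
    case (UN K)
    then obtain k where k: "k \<in> K" "l \<in> k" by auto
    then have "\<forall>\<^sub>F i in F. f i \<in> k" using UN by blast
    then show ?case by eventually_elim (use k in auto)
  next
    case (Basis s)
    then obtain \<phi> V where s: "s = {\<mu> \<in> P_weight w. (\<integral>z. \<phi> z \<partial>\<mu>) \<in> V}" "\<phi> \<in> Phi_weight w" "open V" by auto
    then have "\<forall>\<^sub>F i in F. (\<integral>z. \<phi> z \<partial>f i) \<in> V"
      using Basis(2) by (intro topological_tendstoD[OF lim]) auto
    with P show ?case by eventually_elim (auto simp: s)
  qed (auto intro: eventually_conj)
qed

text \<open>The finer filter plays the role of a subnet. It is the infimum of \<open>F\<close> and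
  the pulled-back neighbourhood filter of a cluster point \<open>m\<close> in the cube; it is proper
  precisely because \<open>m\<close> is a cluster point.\<close>

lemma ex_cluster_filter:
  fixes V :: "'i \<Rightarrow> 'k \<Rightarrow> real"
  assumes F: "F \<noteq> bot" and V: "\<forall>\<^sub>F i in F. \<forall>k. V i k \<in> {0..1}"
  obtains F' m where "F' \<le> F" "F' \<noteq> bot" "\<And>k. ((\<lambda>i. V i k) \<longlongrightarrow> m k) F'"
proof -
  define K where "K = (UNIV :: 'k set) \<rightarrow>\<^sub>E {0..1::real}"
  have "compactin (product_topology (\<lambda>_. euclidean) UNIV) K"
    unfolding K_def compactin_PiE by simp
  then have "compact K" by (simp add: euclidean_product_topology)
  moreover have "filtermap V F \<noteq> bot" using F by (simp add: filtermap_bot_iff)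
  moreover have "eventually (\<lambda>x. x \<in> K) (filtermap V F)"
    using V unfolding eventually_filtermap by eventually_elim (auto simp: K_def)
  ultimately obtain m where m: "inf (nhds m) (filtermap V F) \<noteq> bot"
    unfolding compact_filter by blast
  define F' where "F' = inf F (filtercomap V (nhds m))"
  have "F' \<noteq> bot"
  proof
    assume "F' = bot"
    then obtain P Q where PQ: "eventually P F" "eventually Q (filtercomap V (nhds m))" "\<And>i. P i \<Longrightarrow> Q i \<Longrightarrow> False"
      unfolding F'_def trivial_limit_def eventually_inf by blast
    then obtain R where R: "eventually R (nhds m)" "\<And>i. R (V i) \<Longrightarrow> Q i"
      unfolding eventually_filtercomap by blast
    have "eventually (\<lambda>y. \<not> R y) (filtermap V F)"
      unfolding eventually_filtermap using PQ(1) by eventually_elim (use PQ R in blast)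
    then have "eventually (\<lambda>_. False) (inf (nhds m) (filtermap V F))"
      using R(1) unfolding eventually_inf by blast
    then show False using m by (simp add: trivial_limit_def)
  qed
  moreover have "((\<lambda>i. V i k) \<longlongrightarrow> m k) F'" for k
  proof -
    have "filterlim V (nhds m) F'"
      unfolding F'_def by (rule filterlim_mono[OF filterlim_filtercomap order_refl]) simp
    then show ?thesis
    proof (intro topological_tendstoI)
      fix S :: "real set" assume S: "open S" "m k \<in> S"
      have "open ((\<lambda>f :: 'k \<Rightarrow> real. f k) -` S)"
        using S(1) by (intro open_vimage continuous_on_product_coordinates)
      then have "eventually (\<lambda>f. f k \<in> S) (nhds m)"
        using S(2) by (auto simp: eventually_nhds)
      then show "\<forall>\<^sub>F i in F'. V i k \<in> S"
        using \<open>filterlim V (nhds m) F'\<close> by (auto simp: filterlim_iff)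
    qed
  qed
  moreover have "F' \<le> F" by (simp add: F'_def)
  ultimately show thesis using that by blast
qed

text \<open>This says that \<open>measure N S\<close> is at most the limit inferior of
  \<open>measure (M i) S\<close> along \<open>F\<close>. Only lower bounds are recorded, as they
  survive disjoint unions and increasing unions.\<close>

definition eventually_above :: "'i filter \<Rightarrow> ('i \<Rightarrow> 'z measure) \<Rightarrow> 'z measure \<Rightarrow> 'z set \<Rightarrow> bool" where
  "eventually_above F M N S \<longleftrightarrow> (\<forall>e>0. \<forall>\<^sub>F i in F. measure N S - e < measure (M i) S)"

lemma eventually_above_Un:
  assumes M: "\<forall>\<^sub>F i in F. sets (M i) = sets N \<and> prob_space (M i)" and N: "prob_space N"
    and S: "S \<in> sets N" "T \<in> sets N" "S \<inter> T = {}"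
    and above: "eventually_above F M N S" "eventually_above F M N T"
  shows "eventually_above F M N (S \<union> T)"
  unfolding eventually_above_def
proof (intro allI impI)
  fix e :: real assume "e > 0"
  interpret N: prob_space N by fact
  have "\<forall>\<^sub>F i in F. measure N S - e / 2 < measure (M i) S" "\<forall>\<^sub>F i in F. measure N T - e / 2 < measure (M i) T"
    using above \<open>e > 0\<close> by (simp_all add: eventually_above_def)
  with M show "\<forall>\<^sub>F i in F. measure N (S \<union> T) - e < measure (M i) (S \<union> T)"
  proof eventually_elim
    case (elim i)
    interpret Mi: prob_space "M i" using elim by simp
    have "measure (M i) (S \<union> T) = measure (M i) S + measure (M i) T"
      using elim S by (intro Mi.finite_measure_Union) auto
    moreover have "measure N (S \<union> T) = measure N S + measure N T"
      using S by (intro N.finite_measure_Union) auto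
    ultimately show ?case using elim by linarith
  qed
qed

lemma eventually_above_incseq:
  assumes M: "\<forall>\<^sub>F i in F. sets (M i) = sets N \<and> prob_space (M i)" and N: "prob_space N"
    and S: "\<And>n::nat. S n \<in> sets N" "incseq S"
    and above: "\<And>n. eventually_above F M N (S n)"
  shows "eventually_above F M N (\<Union>n. S n)"
  unfolding eventually_above_def
proof (intro allI impI)
  fix e :: real assume e: "e > 0"
  interpret N: prob_space N by fact
  have "(\<lambda>n. measure N (S n)) \<longlonglongrightarrow> measure N (\<Union>n. S n)"
    using S by (intro N.finite_Lim_measure_incseq) auto
  then have "\<forall>\<^sub>F n in sequentially. measure N (\<Union>n. S n) - e / 2 < measure N (S n)"
    using e by (intro order_tendstoD) auto
  then obtain n where n: "measure N (\<Union>n. S n) - e / 2 < measure N (S n)"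
    using eventually_happens'[OF sequentially_bot] by blast
  have "\<forall>\<^sub>F i in F. measure N (S n) - e / 2 < measure (M i) (S n)"
    using above[of n] e by (simp add: eventually_above_def)
  with M show "\<forall>\<^sub>F i in F. measure N (\<Union>n. S n) - e < measure (M i) (\<Union>n. S n)"
  proof eventually_elim
    case (elim i)
    interpret Mi: prob_space "M i" using elim by simp
    have "measure (M i) (S n) \<le> measure (M i) (\<Union>n. S n)"
      using elim S by (intro Mi.finite_measure_mono) auto
    then show ?case using elim n by linarith
  qed
qed

text \<open>Stable convergence of the couplings of \<open>\<mu>\<close> given by the kernels \<open>\<kappa> i\<close>: the portmanteau
  inequality for open sets, with an arbitrary Borel constraint on the first coordinate.\<close>

locale kernel_limit =
  fixes F :: "'i filter" and \<mu> :: "'a::second_countable_topology measure"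
    and \<kappa> :: "'i \<Rightarrow> 'a \<Rightarrow> 'b::second_countable_topology measure" and p :: "'a \<Rightarrow> 'b measure"
  assumes nontrivial: "F \<noteq> bot" and kernels: "\<forall>\<^sub>F i in F. prob_kernel \<mu> (\<kappa> i)"
    and limit: "prob_kernel \<mu> p"
    and above: "\<And>A Q. A \<in> sets borel \<Longrightarrow> open Q \<Longrightarrow>
      eventually_above F (\<lambda>i. semidirect \<mu> (\<kappa> i)) (semidirect \<mu> p) (A \<times> UNIV \<inter> Q)"

text \<open>The limit on rectangles is a bimeasure: additivity passes to the limit, the first
  marginal is constant along \<open>F\<close>, and \<open>tight\<close> yields
  \<open>closed_empty\<close>. The kernel extracted from it lies below the limit on rectangles with
  open second side, hence eventually almost below the couplings themselves.\<close>

theorem ex_limit_kernel: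
  fixes \<kappa> :: "'i \<Rightarrow> 'a::second_countable_topology \<Rightarrow> 'b::polish_space measure"
  assumes F: "F \<noteq> bot" and \<kappa>: "\<forall>\<^sub>F i in F. prob_kernel \<mu> (\<kappa> i)"
    and tight: "\<And>(C :: nat \<Rightarrow> 'b set) e. (\<And>n. closed (C n)) \<Longrightarrow> decseq C \<Longrightarrow> (\<Inter>n. C n) = {} \<Longrightarrow> 0 < e \<Longrightarrow>
      \<exists>n. \<forall>\<^sub>F i in F. measure (\<mu> \<bind> \<kappa> i) (C n) \<le> e"
  obtains F' p where "F' \<le> F" "kernel_limit F' \<mu> \<kappa> p"
proof -
  define V where "V i k = (case k of (A, B) \<Rightarrow> measure (semidirect \<mu> (\<kappa> i)) (A \<times> B))" for i and k :: "'a set \<times> 'b set"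
  have V01: "\<forall>\<^sub>F i in F. \<forall>k. V i k \<in> {0..1}"
    using \<kappa>
  proof eventually_elim
    case (elim i)
    interpret prob_kernel \<mu> "\<kappa> i" by fact
    show ?case using prob_space.prob_le_1[OF prob_semidirect] by (auto simp: V_def)
  qed
  obtain F' v where F': "F' \<le> F" "F' \<noteq> bot" and v: "\<And>k. ((\<lambda>i. V i k) \<longlongrightarrow> v k) F'"
    using ex_cluster_filter[OF F V01] by metis
  define m where "m A B = v (A, B)" for A B
  have m: "((\<lambda>i. measure (semidirect \<mu> (\<kappa> i)) (A \<times> B)) \<longlongrightarrow> m A B) F'" for A B
    using v[of "(A, B)"] by (simp add: V_def m_def)
  have ev: "\<forall>\<^sub>F i in F'. prob_kernel \<mu> (\<kappa> i)" using F'(1) \<kappa> by (auto simp: le_filter_def)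
  obtain i0 where "prob_kernel \<mu> (\<kappa> i0)" using eventually_happens'[OF F'(2) ev] by blast
  then interpret K0: prob_kernel \<mu> "\<kappa> i0" .
  have rect: "A \<times> B \<in> sets borel" if "A \<in> sets borel" "B \<in> sets borel" for A :: "'a set" and B :: "'b set"
    using that unfolding borel_prod[symmetric] by simp
  have unique: "a = b" if "((\<lambda>i. f i) \<longlongrightarrow> a) F'" "((\<lambda>i. g i) \<longlongrightarrow> b) F'" "\<forall>\<^sub>F i in F'. f i = g i" for f g and a b :: real
    using tendsto_unique[OF F'(2) that(1)] that(2) tendsto_cong[OF that(3)] by metis
  have bm: "bimeasure \<mu> m"
  proof (intro bimeasure.intro bimeasure_axioms.intro)
    show "prob_space \<mu>" by (rule K0.prob_base)
    show "0 \<le> m A B" for A B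
      by (rule tendsto_lowerbound[OF m _ F'(2)]) auto
    show "m (A \<union> A') B = m A B + m A' B" if "A \<in> sets \<mu>" "A' \<in> sets \<mu>" "B \<in> sets borel" "A \<inter> A' = {}" for A A' B
    proof (rule unique[OF m tendsto_add[OF m m]])
      show "\<forall>\<^sub>F i in F'. measure (semidirect \<mu> (\<kappa> i)) ((A \<union> A') \<times> B) =
          measure (semidirect \<mu> (\<kappa> i)) (A \<times> B) + measure (semidirect \<mu> (\<kappa> i)) (A' \<times> B)"
        using ev
      proof eventually_elim
        case (elim i)
        interpret prob_kernel \<mu> "\<kappa> i" by fact
        interpret S: prob_space "semidirect \<mu> (\<kappa> i)" by (rule prob_semidirect)
        show ?case unfolding Sigma_Un_distrib1 using that rect by (intro S.finite_measure_Union) auto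
      qed
    qed
    show "m A (B \<union> B') = m A B + m A B'" if "A \<in> sets \<mu>" "B \<in> sets borel" "B' \<in> sets borel" "B \<inter> B' = {}" for A B B'
    proof (rule unique[OF m tendsto_add[OF m m]])
      show "\<forall>\<^sub>F i in F'. measure (semidirect \<mu> (\<kappa> i)) (A \<times> (B \<union> B')) =
          measure (semidirect \<mu> (\<kappa> i)) (A \<times> B) + measure (semidirect \<mu> (\<kappa> i)) (A \<times> B')"
        using ev
      proof eventually_elim
        case (elim i)
        interpret prob_kernel \<mu> "\<kappa> i" by fact
        interpret S: prob_space "semidirect \<mu> (\<kappa> i)" by (rule prob_semidirect)
        show ?case unfolding Sigma_Un_distrib2 using that rect by (intro S.finite_measure_Union) auto
      qed
    qed
    show "m A UNIV = measure \<mu> A" if "A \<in> sets \<mu>" for A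
    proof (rule unique[OF m tendsto_const])
      show "\<forall>\<^sub>F i in F'. measure (semidirect \<mu> (\<kappa> i)) (A \<times> UNIV) = measure \<mu> A"
        using ev
      proof eventually_elim
        case (elim i)
        interpret prob_kernel \<mu> "\<kappa> i" by fact
        have "emeasure (semidirect \<mu> (\<kappa> i)) (A \<times> UNIV) = emeasure \<mu> A"
          using that prob_space.emeasure_space_1[OF kernel_prob] by (subst emeasure_semidirect_Times) auto
        then show ?case by (simp add: measure_def)
      qed
    qed
    fix C :: "nat \<Rightarrow> 'b set" assume C: "\<And>n. closed (C n)" "decseq C" "(\<Inter>n. C n) = {}"
    have snd_eq: "measure (semidirect \<mu> (\<kappa> i)) (UNIV \<times> B) = measure (\<mu> \<bind> \<kappa> i) B"
      if "prob_kernel \<mu> (\<kappa> i)" "B \<in> sets borel" for i B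
    proof -
      interpret prob_kernel \<mu> "\<kappa> i" by fact
      have "emeasure (semidirect \<mu> (\<kappa> i)) (UNIV \<times> B) = emeasure (\<mu> \<bind> \<kappa> i) B"
        using that by (simp add: emeasure_semidirect_Times emeasure_bind_prob_algebra[OF base_in kernel])
      then show ?thesis by (simp add: measure_def)
    qed
    have le: "m UNIV (C n') \<le> e" if n: "\<forall>\<^sub>F i in F. measure (\<mu> \<bind> \<kappa> i) (C n) \<le> e" "n \<le> n'" for n n' e
    proof (rule tendsto_upperbound[OF m _ F'(2)])
      have "\<forall>\<^sub>F i in F'. measure (\<mu> \<bind> \<kappa> i) (C n) \<le> e" using n(1) F'(1) by (auto simp: le_filter_def)
      with ev show "\<forall>\<^sub>F i in F'. measure (semidirect \<mu> (\<kappa> i)) (UNIV \<times> C n') \<le> e"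
      proof eventually_elim
        case (elim i)
        interpret prob_kernel \<mu> "\<kappa> i" by fact
        interpret B: prob_space "\<mu> \<bind> \<kappa> i" by (rule prob_bind_kernel)
        have "measure (\<mu> \<bind> \<kappa> i) (C n') \<le> measure (\<mu> \<bind> \<kappa> i) (C n)"
          using C n(2) by (intro B.finite_measure_mono) (auto simp: decseq_def)
        with elim C(1)[of n'] show ?case by (simp add: snd_eq)
      qed
    qed
    show "(\<lambda>n. m (space \<mu>) (C n)) \<longlonglongrightarrow> 0"
    proof (rule order_tendstoI)
      fix a :: real assume "a < 0"
      moreover have "0 \<le> m UNIV (C n)" for n
        by (rule tendsto_lowerbound[OF m _ F'(2)]) auto
      ultimately show "\<forall>\<^sub>F n in sequentially. a < m (space \<mu>) (C n)"
        by (intro always_eventually allI) (simp add: less_le_trans)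
    next
      fix a :: real assume a: "0 < a"
      then obtain n where n: "\<forall>\<^sub>F i in F. measure (\<mu> \<bind> \<kappa> i) (C n) \<le> a / 2"
        using tight[OF C, of "a / 2"] by auto
      have "m UNIV (C n') < a" if "n \<le> n'" for n' using le[OF n that] a by simp
      then show "\<forall>\<^sub>F n in sequentially. m (space \<mu>) (C n) < a"
        using a by (intro eventually_sequentiallyI[of n]) simp
    qed
  qed
  obtain p where pm: "p \<in> \<mu> \<rightarrow>\<^sub>M prob_algebra borel"
    and p_le: "\<And>A V. A \<in> sets \<mu> \<Longrightarrow> open V \<Longrightarrow> (\<integral>\<^sup>+x\<in>A. emeasure (p x) V \<partial>\<mu>) \<le> ennreal (m A V)"
    using bimeasure.ex_kernel[OF bm] by blast
  have pk: "prob_kernel \<mu> p"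
    using pm K0.prob_base by (intro prob_kernel.intro) (simp_all cong: measurable_cong_sets)
  interpret P: prob_kernel \<mu> p by (rule pk)
  interpret PS: prob_space "semidirect \<mu> p" by (rule P.prob_semidirect)
  let ?M = "\<lambda>i. semidirect \<mu> (\<kappa> i)" and ?N = "semidirect \<mu> p"
  have M: "\<forall>\<^sub>F i in F'. sets (?M i) = sets ?N \<and> prob_space (?M i)"
    using ev by eventually_elim (simp add: prob_kernel.sets_semidirect prob_kernel.prob_semidirect pk)
  have base: "eventually_above F' ?M ?N (A \<times> W)" if "A \<in> sets borel" "open W" for A W
    unfolding eventually_above_def
  proof (intro allI impI)
    fix e :: real assume "e > 0"
    have "emeasure ?N (A \<times> W) \<le> ennreal (m A W)"
      using p_le[of A W] that by (simp add: P.emeasure_semidirect_Times)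
    moreover have "0 \<le> m A W" by (rule tendsto_lowerbound[OF m _ F'(2)]) auto
    ultimately have "measure ?N (A \<times> W) - e < m A W"
      using \<open>e > 0\<close> by (simp add: PS.emeasure_eq_measure)
    then show "\<forall>\<^sub>F i in F'. measure ?N (A \<times> W) - e < measure (?M i) (A \<times> W)"
      by (rule order_tendstoD[OF m])
  qed
  \<comment> \<open>The product \<open>E \<times> W\<close> is what has been absorbed so far.
    Cutting the first coordinate along \<open>A n\<close>, and enlarging \<open>W\<close> by
    \<open>U n\<close> on the part inside \<open>A n\<close>, removes one rectangle and keeps the
    two pieces disjoint. The second side stays open, and the first needs to be measurable
    only.\<close>
  have rects: "eventually_above F' ?M ?N (E \<times> W \<union> E \<times> UNIV \<inter> (\<Union>j<n. A j \<times> U j))"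
    if "E \<in> sets borel" "open W" "\<And>j. A j \<in> sets borel" "\<And>j. open (U j)" for E W A U and n :: nat
    using that(1,2)
  proof (induction n arbitrary: E W)
    case 0
    then show ?case using base by simp
  next
    case (Suc n)
    have "E \<times> W \<union> E \<times> UNIV \<inter> (\<Union>j<Suc n. A j \<times> U j) =
        ((E - A n) \<times> W \<union> (E - A n) \<times> UNIV \<inter> (\<Union>j<n. A j \<times> U j)) \<union>
        ((E \<inter> A n) \<times> (W \<union> U n) \<union> (E \<inter> A n) \<times> UNIV \<inter> (\<Union>j<n. A j \<times> U j))"
      by (auto simp: less_Suc_eq)
    moreover have "eventually_above F' ?M ?N \<dots>"
    proof (rule eventually_above_Un[OF M PS.prob_space_axioms])
      show "(E - A n) \<times> W \<union> (E - A n) \<times> UNIV \<inter> (\<Union>j<n. A j \<times> U j) \<in> sets ?N"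
        "(E \<inter> A n) \<times> (W \<union> U n) \<union> (E \<inter> A n) \<times> UNIV \<inter> (\<Union>j<n. A j \<times> U j) \<in> sets ?N"
        using Suc.prems that(3,4) by (auto intro!: sets.Un sets.Int sets.finite_UN rect)
      show "eventually_above F' ?M ?N ((E - A n) \<times> W \<union> (E - A n) \<times> UNIV \<inter> (\<Union>j<n. A j \<times> U j))"
        by (rule Suc.IH) (use Suc.prems that(3) in auto)
      show "eventually_above F' ?M ?N ((E \<inter> A n) \<times> (W \<union> U n) \<union> (E \<inter> A n) \<times> UNIV \<inter> (\<Union>j<n. A j \<times> U j))"
        by (rule Suc.IH) (use Suc.prems that(3,4) in auto)
    qed auto
    ultimately show ?case by simp
  qed
  have "eventually_above F' ?M ?N (A \<times> UNIV \<inter> Q)" if A: "A \<in> sets borel" and Q: "open Q" for A Q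
  proof -
    obtain BA :: "'a set set" where BA: "countable BA" "topological_basis BA" using ex_countable_basis by blast
    obtain BB :: "'b set set" where BB: "countable BB" "topological_basis BB" using ex_countable_basis by blast
    \<comment> \<open>By second countability \<open>Q\<close> is a countable union of open
      rectangles; the finite partial unions are covered by \<open>rects\<close>.\<close>
    define R where "R = {r \<in> BA \<times> BB. fst r \<times> snd r \<subseteq> Q}"
    have UR: "Q = (\<Union>r\<in>R. fst r \<times> snd r)"
    proof safe
      fix x y assume "(x, y) \<in> Q"
      then obtain S T where ST: "open S" "open T" "(x, y) \<in> S \<times> T" "S \<times> T \<subseteq> Q" using Q open_prod_elim by metis
      obtain S' where S': "S' \<in> BA" "x \<in> S'" "S' \<subseteq> S" using topological_basisE[OF BA(2) ST(1)] ST(3) by blast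
      obtain T' where T': "T' \<in> BB" "y \<in> T'" "T' \<subseteq> T" using topological_basisE[OF BB(2) ST(2)] ST(3) by blast
      show "(x, y) \<in> (\<Union>r\<in>R. fst r \<times> snd r)"
        using S' T' ST(4) by (intro UN_I[of "(S', T')"]) (auto simp: R_def)
    qed (auto simp: R_def)
    have "countable R" unfolding R_def by (rule countable_subset[of _ "BA \<times> BB"]) (use BA(1) BB(1) in auto)
    show ?thesis
    proof (cases "R = {}")
      case True
      then show ?thesis using UR base[of A "{}"] A by simp
    next
      case False
      define f where "f = from_nat_into R"
      have f: "range f = R" using False \<open>countable R\<close> by (simp add: f_def range_from_nat_into)
      have "f j \<in> R" for j using f by blast
      then have fo: "open (fst (f j))" "open (snd (f j))" for j
        using topological_basis_open[OF BA(2)] topological_basis_open[OF BB(2)] by (auto simp: R_def mem_Times_iff)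
      define S where "S n = A \<times> UNIV \<inter> (\<Union>j<n. fst (f j) \<times> snd (f j))" for n :: nat
      have "A \<times> UNIV \<inter> Q = (\<Union>n. S n)"
        unfolding UR f[symmetric] S_def by (auto intro: exI[of _ "Suc _"])
      moreover have "eventually_above F' ?M ?N (\<Union>n. S n)"
      proof (rule eventually_above_incseq[OF M PS.prob_space_axioms])
        show "S n \<in> sets ?N" for n
          unfolding S_def using A fo by (auto intro!: sets.Int sets.finite_UN rect)
        show "incseq S" by (force simp: incseq_def S_def)
        show "eventually_above F' ?M ?N (S n)" for n
          using rects[of A "{}" "\<lambda>j. fst (f j)" "\<lambda>j. snd (f j)" n] A fo by (simp add: S_def)
      qed
      ultimately show ?thesis by simp
    qed
  qed
  with F' ev pk show thesis by (intro that[of F' p] kernel_limit.intro)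
qed

section \<open>Layer-cake sums and the portmanteau inequality for lower semicontinuous
  functions\<close>

text \<open>For positive \<open>r\<close> and \<open>\<delta>\<close> this is the largest multiple
  of \<open>\<delta>\<close> strictly below \<open>r\<close>, capped at \<open>N * \<delta>\<close>.
  Written as a sum of indicators it integrates to finitely many measures of superlevel sets.\<close>

definition layers :: "nat \<Rightarrow> real \<Rightarrow> real \<Rightarrow> real" where
  "layers N \<delta> r = (\<Sum>k=1..N. if real k * \<delta> < r then \<delta> else 0)"

lemma layers_Suc: "layers (Suc N) \<delta> r = layers N \<delta> r + (if real (Suc N) * \<delta> < r then \<delta> else 0)"
  by (simp add: layers_def)

lemma layers_full: "0 < \<delta> \<Longrightarrow> real N * \<delta> < r \<Longrightarrow> layers N \<delta> r = real N * \<delta>"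
proof (induction N)
  case (Suc N)
  then have "real N * \<delta> < r" by (simp add: algebra_simps)
  with Suc show ?case by (simp add: layers_Suc algebra_simps)
qed (simp add: layers_def)

lemma layers_le: "0 < \<delta> \<Longrightarrow> 0 \<le> r \<Longrightarrow> layers N \<delta> r \<le> r"
proof (induction N)
  case (Suc N)
  then show ?case using layers_full[of \<delta> "Suc N" r] by (cases "real (Suc N) * \<delta> < r") (auto simp: layers_Suc)
qed (simp add: layers_def)

lemma layers_ge: "0 < \<delta> \<Longrightarrow> 0 \<le> r \<Longrightarrow> min r (real N * \<delta>) \<le> layers N \<delta> r + \<delta>"
proof (induction N)
  case (Suc N)
  show ?case
  proof (cases "real (Suc N) * \<delta> < r")
    case True
    then show ?thesis using layers_full[OF Suc.prems(1) True] Suc.prems by simp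
  next
    case False
    then show ?thesis
      using Suc layers_full[OF Suc.prems(1), of N r]
      by (cases "real N * \<delta> < r") (auto simp: layers_Suc algebra_simps)
  qed
qed (simp add: layers_def)

lemma nn_integral_layers:
  assumes [measurable]: "h \<in> borel_measurable M" and "prob_space M" and \<delta>: "0 < \<delta>"
  shows "(\<integral>\<^sup>+z. ennreal (layers N \<delta> (h z)) \<partial>M) = ennreal (\<Sum>k=1..N. \<delta> * measure M {z \<in> space M. real k * \<delta> < h z})"
proof -
  interpret prob_space M by fact
  have "(\<integral>\<^sup>+z. ennreal (layers N \<delta> (h z)) \<partial>M) =
      (\<integral>\<^sup>+z. (\<Sum>k=1..N. ennreal \<delta> * indicator {z \<in> space M. real k * \<delta> < h z} z) \<partial>M)"
  proof (rule nn_integral_cong)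
    fix z assume z: "z \<in> space M"
    have "ennreal (layers N \<delta> (h z)) = (\<Sum>k=1..N. ennreal (if real k * \<delta> < h z then \<delta> else 0))"
      unfolding layers_def using \<delta> by (subst sum_ennreal) auto
    also have "\<dots> = (\<Sum>k=1..N. ennreal \<delta> * indicator {z \<in> space M. real k * \<delta> < h z} z)"
      by (rule sum.cong[OF refl]) (use z in \<open>simp split: split_indicator\<close>)
    finally show "ennreal (layers N \<delta> (h z)) =
      (\<Sum>k=1..N. ennreal \<delta> * indicator {z \<in> space M. real k * \<delta> < h z} z)" .
  qed
  also have "\<dots> = (\<Sum>k=1..N. ennreal \<delta> * emeasure M {z \<in> space M. real k * \<delta> < h z})"
    by (subst nn_integral_sum) (auto simp: nn_integral_cmult)
  also have "\<dots> = ennreal (\<Sum>k=1..N. \<delta> * measure M {z \<in> space M. real k * \<delta> < h z})"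
    using \<delta> by (subst sum_ennreal[symmetric]) (auto simp: emeasure_eq_measure ennreal_mult)
  finally show ?thesis .
qed

text \<open>After truncation at \<open>n\<close> the integral is finite and, up to
  \<open>\<delta>\<close>, bounded by a finite sum over superlevel sets. Each of these has its lower
  bound eventually, and finitely many bounds hold at once.\<close>

lemma nn_integral_eventually_above:
  assumes M: "\<forall>\<^sub>F i in F. sets (M i) = sets N \<and> prob_space (M i)" and N: "prob_space N"
    and h [measurable]: "h \<in> borel_measurable N" and h0: "\<And>z. 0 \<le> h z"
    and above: "\<And>r. 0 \<le> r \<Longrightarrow> eventually_above F M N {z \<in> space N. r < h z}"
    and t: "t < (\<integral>\<^sup>+z. ennreal (h z) \<partial>N)"
  shows "\<forall>\<^sub>F i in F. t < (\<integral>\<^sup>+z. ennreal (h z) \<partial>M i)"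
proof -
  interpret N: prob_space N by fact
  have "(\<integral>\<^sup>+z. ennreal (h z) \<partial>N) = (\<integral>\<^sup>+z. (SUP n. ennreal (min (h z) (real n))) \<partial>N)"
  proof (intro nn_integral_cong)
    fix z
    obtain n where "h z \<le> real n" using real_arch_simple by blast
    then show "ennreal (h z) = (SUP n. ennreal (min (h z) (real n)))"
      by (intro antisym SUP_upper2[of n] SUP_least) (auto intro: ennreal_leI)
  qed
  also have "\<dots> = (SUP n. \<integral>\<^sup>+z. ennreal (min (h z) (real n)) \<partial>N)"
    by (rule nn_integral_monotone_convergence_SUP) (auto simp: incseq_def le_fun_def intro!: ennreal_leI)
  finally obtain n where n: "t < (\<integral>\<^sup>+z. ennreal (min (h z) (real n)) \<partial>N)"
    using t by (auto simp: less_SUP_iff)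
  have "(\<integral>\<^sup>+z. ennreal (min (h z) (real n)) \<partial>N) \<le> (\<integral>\<^sup>+z. ennreal (real n) \<partial>N)"
    by (intro nn_integral_mono ennreal_leI) simp
  also have "\<dots> < \<infinity>" using N.emeasure_space_1 by simp
  finally obtain v where v: "(\<integral>\<^sup>+z. ennreal (min (h z) (real n)) \<partial>N) = ennreal v" "0 \<le> v"
    by (cases "\<integral>\<^sup>+z. ennreal (min (h z) (real n)) \<partial>N") auto
  obtain t' where t': "t = ennreal t'" "0 \<le> t'" "t' < v"
    using n unfolding v(1) by (cases t) (auto simp: ennreal_less_iff)
  \<comment> \<open>A third of the gap: one for rounding to layers, one for the errors on the
    superlevel sets, and one left over for strictness.\<close>
  define \<delta> where "\<delta> = (v - t') / 3"
  have \<delta>: "0 < \<delta>" using t' by (simp add: \<delta>_def)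
  obtain K :: nat where K: "real n \<le> real K * \<delta>" using reals_Archimedean3[OF \<delta>] less_imp_le by blast
  let ?S = "\<lambda>k. {z \<in> space N. real k * \<delta> < h z}"
  have "ennreal v \<le> (\<integral>\<^sup>+z. ennreal (layers K \<delta> (h z)) + ennreal \<delta> \<partial>N)"
    unfolding v(1)[symmetric]
  proof (intro nn_integral_mono)
    fix z
    have "min (h z) (real n) \<le> layers K \<delta> (h z) + \<delta>"
      using layers_ge[OF \<delta> h0, of z K] K by linarith
    moreover have "0 \<le> layers K \<delta> (h z)" unfolding layers_def using \<delta> by (intro sum_nonneg) auto
    ultimately show "ennreal (min (h z) (real n)) \<le> ennreal (layers K \<delta> (h z)) + ennreal \<delta>"
      using \<delta> by (subst ennreal_plus[symmetric]) (auto intro: ennreal_leI simp del: ennreal_plus)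
  qed
  also have "\<dots> = (\<integral>\<^sup>+z. ennreal (layers K \<delta> (h z)) \<partial>N) + ennreal \<delta>"
    using N.emeasure_space_1 by (subst nn_integral_add) (auto simp: layers_def)
  also have "\<dots> = ennreal ((\<Sum>k=1..K. \<delta> * measure N (?S k)) + \<delta>)"
  proof -
    have "0 \<le> (\<Sum>k=1..K. \<delta> * measure N (?S k))" using \<delta> by (intro sum_nonneg) auto
    then show ?thesis using \<delta> by (subst nn_integral_layers[OF h N]) (auto simp: ennreal_plus)
  qed
  finally have v_le: "v \<le> (\<Sum>k=1..K. \<delta> * measure N (?S k)) + \<delta>"
    using \<delta> by (subst (asm) ennreal_le_iff) (auto intro!: sum_nonneg add_nonneg_nonneg)
  \<comment> \<open>Chosen so that \<open>K\<close> errors of size \<open>\<delta> * e\<close> add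
    up to less than \<open>\<delta>\<close>.\<close>
  define e where "e = 1 / (real K + 1)"
  have e: "0 < e" "real K * e < 1" by (auto simp: e_def)
  have "\<forall>\<^sub>F i in F. \<forall>k\<in>{1..K}. measure N (?S k) - e < measure (M i) (?S k)"
    using above \<delta> e by (intro eventually_ball_finite) (auto simp: eventually_above_def)
  with M show ?thesis
  proof eventually_elim
    case (elim i)
    interpret Mi: prob_space "M i" using elim by simp
    have s: "sets (M i) = sets N" using elim by simp
    note [measurable_cong] = s
    have sp: "space (M i) = space N" using s by (rule sets_eq_imp_space_eq)
    have "(\<Sum>k=1..K. \<delta> * measure N (?S k)) - real K * \<delta> * e = (\<Sum>k=1..K. \<delta> * (measure N (?S k) - e))"
      by (simp add: sum_subtractf algebra_simps)
    also have "\<dots> \<le> (\<Sum>k=1..K. \<delta> * measure (M i) (?S k))"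
      using elim \<delta> by (intro sum_mono mult_left_mono) (auto intro: less_imp_le)
    finally have le: "(\<Sum>k=1..K. \<delta> * measure N (?S k)) - real K * \<delta> * e \<le> (\<Sum>k=1..K. \<delta> * measure (M i) (?S k))" .
    have "\<delta> * (real K * e) < \<delta> * 1" using \<delta> e by (intro mult_strict_left_mono) auto
    then have "t' < (\<Sum>k=1..K. \<delta> * measure (M i) (?S k))"
    proof -
      have "v = t' + 3 * \<delta>" by (simp add: \<delta>_def field_simps)
      moreover have "\<delta> * (real K * e) = real K * \<delta> * e" by simp
      ultimately show ?thesis using le v_le \<open>\<delta> * (real K * e) < \<delta> * 1\<close> \<delta> by linarith
    qed
    then have "t < ennreal (\<Sum>k=1..K. \<delta> * measure (M i) (?S k))"
      unfolding t'(1) using t'(2) by (simp add: ennreal_less_iff)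
    also have "\<dots> = (\<integral>\<^sup>+z. ennreal (layers K \<delta> (h z)) \<partial>M i)"
      using \<delta> by (subst nn_integral_layers) (auto simp: Mi.prob_space_axioms sp)
    also have "\<dots> \<le> (\<integral>\<^sup>+z. ennreal (h z) \<partial>M i)"
      by (intro nn_integral_mono ennreal_leI layers_le \<delta> h0)
    finally show ?case .
  qed
qed

context kernel_limit
begin

abbreviation "\<pi>\<^sub>i i \<equiv> semidirect \<mu> (\<kappa> i)"
abbreviation "\<pi>\<^sub>0 \<equiv> semidirect \<mu> p"

sublocale L: prob_kernel \<mu> p by (rule limit)

lemma semidirect_ev: "\<forall>\<^sub>F i in F. sets (\<pi>\<^sub>i i) = sets \<pi>\<^sub>0 \<and> prob_space (\<pi>\<^sub>i i)"
  using kernels by eventually_elim (simp add: prob_kernel.sets_semidirect prob_kernel.prob_semidirect)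

lemma cylinder_borel: "(A :: 'a set) \<in> sets borel \<Longrightarrow> A \<times> (UNIV :: 'b set) \<in> sets borel"
  unfolding borel_prod[symmetric] by simp

text \<open>For levels \<open>r \<ge> 0\<close>, the superlevel sets of the cut-off function are
  cylinders over \<open>A\<close> intersected with open sets, which is the form provided by
  \<open>above\<close>.\<close>

lemma lsc_nn_integral_above:
  assumes A: "A \<in> sets borel" and g: "\<And>r. open {z. r < g z}" "\<And>z. 0 \<le> g z"
    and t: "t < (\<integral>\<^sup>+z. ennreal (indicator (A \<times> UNIV) z * g z) \<partial>\<pi>\<^sub>0)"
  shows "\<forall>\<^sub>F i in F. t < (\<integral>\<^sup>+z. ennreal (indicator (A \<times> UNIV) z * g z) \<partial>\<pi>\<^sub>i i)"
proof (rule nn_integral_eventually_above[OF semidirect_ev L.prob_semidirect _ _ _ t])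
  have [measurable]: "g \<in> borel_measurable borel"
    by (rule borel_measurable_iff_greater[THEN iffD2]) (use g in auto)
  note [measurable] = cylinder_borel[OF A]
  show "(\<lambda>z. indicator (A \<times> UNIV) z * g z) \<in> borel_measurable \<pi>\<^sub>0" by measurable
  show "0 \<le> indicator (A \<times> UNIV) z * g z" for z using g by simp
  fix r :: real assume r: "0 \<le> r"
  have "{z \<in> space \<pi>\<^sub>0. r < indicator (A \<times> UNIV) z * g z} = A \<times> UNIV \<inter> {z. r < g z}"
    using r by (auto split: split_indicator_asm split_indicator)
  then show "eventually_above F \<pi>\<^sub>i \<pi>\<^sub>0 {z \<in> space \<pi>\<^sub>0. r < indicator (A \<times> UNIV) z * g z}"
    using above[OF A g(1)] by simp
qed

text \<open>Over \<open>A\<close> both G + f and G - f are nonnegative, so the portmanteau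
  inequality bounds their integrals from below. To subtract G, its integral over \<open>A\<close>
  must also be bounded from above; this follows from the lower bound over the complement of
  \<open>A\<close> and the convergence of the total integral of G.\<close>

lemma dominated_integral_tendsto:
  fixes f :: "'a \<times> 'b \<Rightarrow> real" and G :: "'b \<Rightarrow> real"
  assumes A: "A \<in> sets borel" and f: "continuous_on UNIV f" and G: "continuous_on UNIV G"
    and dom: "\<And>x y. x \<in> A \<Longrightarrow> \<bar>f (x, y)\<bar> \<le> G y" and G0: "\<And>y. 0 \<le> G y"
    and int: "\<forall>\<^sub>F i in F. integrable (\<mu> \<bind> \<kappa> i) G" "integrable (\<mu> \<bind> p) G"
    and lim: "((\<lambda>i. \<integral>y. G y \<partial>(\<mu> \<bind> \<kappa> i)) \<longlongrightarrow> (\<integral>y. G y \<partial>(\<mu> \<bind> p))) F"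
  shows "((\<lambda>i. \<integral>z. indicator (A \<times> UNIV) z * f z \<partial>\<pi>\<^sub>i i) \<longlongrightarrow> (\<integral>z. indicator (A \<times> UNIV) z * f z \<partial>\<pi>\<^sub>0)) F"
proof -
  let ?C = "A \<times> (UNIV :: 'b set)" and ?D = "(- A) \<times> (UNIV :: 'b set)"
  have cyl [measurable]: "?C \<in> sets borel" "?D \<in> sets borel" using A cylinder_borel by auto
  have fm [measurable]: "f \<in> borel_measurable borel" and Gm [measurable]: "G \<in> borel_measurable borel"
    using f G by (auto intro: borel_measurable_continuous_onI)
  have Gs: "continuous_on UNIV (\<lambda>z :: 'a \<times> 'b. G (snd z))"
    by (rule continuous_on_compose2[OF G]) (auto intro: continuous_intros)
  then have Gsm [measurable]: "(\<lambda>z :: 'a \<times> 'b. G (snd z)) \<in> borel_measurable borel"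
    by (rule borel_measurable_continuous_onI)
  have facts: "integrable (semidirect \<mu> q) (\<lambda>z. G (snd z))"
      "(\<integral>z. G (snd z) \<partial>semidirect \<mu> q) = (\<integral>y. G y \<partial>(\<mu> \<bind> q))"
      "integrable (semidirect \<mu> q) (\<lambda>z. indicator ?C z * G (snd z))"
      "integrable (semidirect \<mu> q) (\<lambda>z. indicator ?D z * G (snd z))"
      "integrable (semidirect \<mu> q) (\<lambda>z. indicator ?C z * f z)"
    if q: "prob_kernel \<mu> q" and i: "integrable (\<mu> \<bind> q) G" for q
  proof -
    interpret prob_kernel \<mu> q by fact
    show 1: "integrable (semidirect \<mu> q) (\<lambda>z. G (snd z))"
      using i unfolding distr_snd_semidirect[symmetric] by (rule integrable_distr[OF snd_measurable])
    show "(\<integral>z. G (snd z) \<partial>semidirect \<mu> q) = (\<integral>y. G y \<partial>(\<mu> \<bind> q))"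
      by (rule integral_snd_semidirect[OF Gm])
    show "integrable (semidirect \<mu> q) (\<lambda>z. indicator ?C z * G (snd z))"
      "integrable (semidirect \<mu> q) (\<lambda>z. indicator ?D z * G (snd z))"
      "integrable (semidirect \<mu> q) (\<lambda>z. indicator ?C z * f z)"
      by (rule Bochner_Integration.integrable_bound[OF 1], measurable, 
          auto intro!: AE_I2 simp: G0 dom split: split_indicator)+
  qed
  have lower: "\<forall>\<^sub>F i in F. (\<integral>z. indicator S z * g z \<partial>\<pi>\<^sub>0) - e < (\<integral>z. indicator S z * g z \<partial>\<pi>\<^sub>i i)"
    if S: "S = B \<times> UNIV" "B \<in> sets borel" and g: "continuous_on UNIV g" "\<And>z. z \<in> S \<Longrightarrow> 0 \<le> g z"
      and ig: "\<forall>\<^sub>F i in F. integrable (\<pi>\<^sub>i i) (\<lambda>z. indicator S z * g z)" "integrable \<pi>\<^sub>0 (\<lambda>z. indicator S z * g z)"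
      and e: "0 < e" for S B g and e :: real
  proof -
    \<comment> \<open>The function is nonnegative on \<open>S\<close> only. Cutting it off at 0
      changes nothing after multiplication by the indicator and gives a function that is nonnegative
      everywhere.\<close>
    let ?g = "\<lambda>z. max 0 (g z)"
    have eq: "indicator S z * ?g z = indicator S z * g z" for z
      using g(2) by (auto split: split_indicator)
    have op: "open {z. r < ?g z}" for r
      by (rule open_Collect_less) (auto intro: continuous_intros g)
    let ?I = "\<integral>z. indicator S z * g z \<partial>\<pi>\<^sub>0"
    have nn: "0 \<le> indicator S z * g z" for z using g(2) by (auto split: split_indicator)
    have I: "(\<integral>\<^sup>+z. ennreal (indicator S z * g z) \<partial>\<pi>\<^sub>0) = ennreal ?I"
      using ig(2) nn by (intro nn_integral_eq_integral) auto
    have nnI: "0 \<le> (\<integral>z. indicator S z * g z \<partial>M)" for M using nn by simp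
    show ?thesis
    proof (cases "?I - e < 0")
      case True
      have "?I - e < (\<integral>z. indicator S z * g z \<partial>\<pi>\<^sub>i i)" for i
        using nnI[of "\<pi>\<^sub>i i"] True by linarith
      then show ?thesis by simp
    next
      case False
      then have "ennreal (?I - e) < (\<integral>\<^sup>+z. ennreal (indicator (B \<times> UNIV) z * ?g z) \<partial>\<pi>\<^sub>0)"
        unfolding S(1)[symmetric] eq I using e by (simp add: ennreal_less_iff)
      from lsc_nn_integral_above[OF S(2) op _ this]
      have "\<forall>\<^sub>F i in F. ennreal (?I - e) < (\<integral>\<^sup>+z. ennreal (indicator S z * g z) \<partial>\<pi>\<^sub>i i)"
        unfolding S(1)[symmetric] eq by simp
      with ig(1) show ?thesis
      proof eventually_elim
        case (elim i)
        have "(\<integral>\<^sup>+z. ennreal (indicator S z * g z) \<partial>\<pi>\<^sub>i i) = ennreal (\<integral>z. indicator S z * g z \<partial>\<pi>\<^sub>i i)"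
          using elim nn by (intro nn_integral_eq_integral) auto
        with elim False show ?case by (simp add: ennreal_less_iff)
      qed
    qed
  qed
  have fi: "\<forall>\<^sub>F i in F. prob_kernel \<mu> (\<kappa> i) \<and> integrable (\<mu> \<bind> \<kappa> i) G"
    using kernels int(1) by eventually_elim simp
  let ?LC = "\<lambda>M. \<integral>z. indicator ?C z * G (snd z) \<partial>M" and ?LD = "\<lambda>M. \<integral>z. indicator ?D z * G (snd z) \<partial>M"
    and ?Lf = "\<lambda>M. \<integral>z. indicator ?C z * f z \<partial>M"
    and ?Lp = "\<lambda>M. \<integral>z. indicator ?C z * (G (snd z) + f z) \<partial>M"
    and ?Lm = "\<lambda>M. \<integral>z. indicator ?C z * (G (snd z) - f z) \<partial>M"
  have split: "integrable M (\<lambda>z. indicator ?C z * (G (snd z) + f z))" "integrable M (\<lambda>z. indicator ?C z * (G (snd z) - f z))"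
      "?Lp M = ?LC M + ?Lf M" "?Lm M = ?LC M - ?Lf M" "?LC M + ?LD M = (\<integral>y. G y \<partial>(\<mu> \<bind> q))"
    if q: "prob_kernel \<mu> q" "integrable (\<mu> \<bind> q) G" and M: "M = semidirect \<mu> q" for M q
  proof -
    note [simp] = facts[OF q]
    show "integrable M (\<lambda>z. indicator ?C z * (G (snd z) + f z))" "integrable M (\<lambda>z. indicator ?C z * (G (snd z) - f z))"
      "?Lp M = ?LC M + ?Lf M" "?Lm M = ?LC M - ?Lf M"
      unfolding M distrib_left right_diff_distrib by simp_all
    have "?LC M + ?LD M = (\<integral>z. indicator ?C z * G (snd z) + indicator ?D z * G (snd z) \<partial>M)"
      unfolding M by simp
    also have "\<dots> = (\<integral>z. G (snd z) \<partial>M)"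
      by (intro Bochner_Integration.integral_cong) (auto split: split_indicator)
    finally show "?LC M + ?LD M = (\<integral>y. G y \<partial>(\<mu> \<bind> q))" unfolding M by simp
  qed
  note s0 = split[OF limit int(2) refl] and f0 = facts[OF limit int(2)]
  show ?thesis
  proof (rule tendstoI)
    fix e :: real assume "0 < e"
    \<comment> \<open>Each one-sided bound for \<open>?Lf\<close> collects three errors: that of
      \<open>?Lp\<close> or \<open>?Lm\<close>, that of \<open>?LD\<close>, and that of the total
      integral of \<open>G\<close>.\<close>
    then have e: "0 < e / 4" by simp
    have "\<forall>\<^sub>F i in F. ?Lp \<pi>\<^sub>0 - e / 4 < ?Lp (\<pi>\<^sub>i i)"
      by (rule lower[OF refl A _ _ _ s0(1) e])
        (use fi split(1) f Gs dom in \<open>auto intro!: continuous_intros elim!: eventually_mono simp: abs_le_iff\<close>, 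
          smt (verit) dom)
    moreover have "\<forall>\<^sub>F i in F. ?Lm \<pi>\<^sub>0 - e / 4 < ?Lm (\<pi>\<^sub>i i)"
      by (rule lower[OF refl A _ _ _ s0(2) e])
        (use fi split(2) f Gs dom in \<open>auto intro!: continuous_intros elim!: eventually_mono simp: abs_le_iff\<close>)
    moreover have "\<forall>\<^sub>F i in F. ?LC \<pi>\<^sub>0 - e / 4 < ?LC (\<pi>\<^sub>i i)"
      by (rule lower[OF refl A _ _ _ f0(3) e])
        (use fi facts(3) Gs G0 in \<open>auto elim!: eventually_mono\<close>)
    moreover have "\<forall>\<^sub>F i in F. ?LD \<pi>\<^sub>0 - e / 4 < ?LD (\<pi>\<^sub>i i)"
      by (rule lower[OF refl _ _ _ _ f0(4) e])
        (use A fi facts(4) Gs G0 in \<open>auto elim!: eventually_mono\<close>)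
    moreover have "\<forall>\<^sub>F i in F. dist (\<integral>y. G y \<partial>(\<mu> \<bind> \<kappa> i)) (\<integral>y. G y \<partial>(\<mu> \<bind> p)) < e / 4"
      using lim e by (rule tendstoD)
    ultimately show "\<forall>\<^sub>F i in F. dist (?Lf (\<pi>\<^sub>i i)) (?Lf \<pi>\<^sub>0) < e"
      using fi
    proof eventually_elim
      case (elim i)
      then have q: "prob_kernel \<mu> (\<kappa> i)" "integrable (\<mu> \<bind> \<kappa> i) G" by auto
      note si = split[OF q refl]
      show ?case using elim si(3-5) s0(3-5) unfolding dist_real_def by linarith
    qed
  qed
qed

end

section \<open>Lower semicontinuity of the transport cost\<close>

text \<open>Tent functions \<open>max 0 (1 - k * infdist y C)\<close> converge to the indicator of
  the closed set. They turn a bound on its mass into a bound on the integral of one bounded test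
  function, an open condition. The empty set is treated apart because \<open>infdist\<close> to it
  is 0 by convention.\<close>

lemma closed_approx:
  fixes \<nu> :: "'a::metric_space measure"
  assumes s: "sets \<nu> = sets borel" and "prob_space \<nu>" and C: "closed C" and e: "measure \<nu> C < e"
  obtains \<psi> :: "'a \<Rightarrow> real" where "continuous_on UNIV \<psi>" "\<And>y. 0 \<le> \<psi> y" "\<And>y. \<psi> y \<le> 1" "\<And>y. y \<in> C \<Longrightarrow> \<psi> y = 1"
    "(\<integral>y. \<psi> y \<partial>\<nu>) < e"
proof (cases "C = {}")
  case True
  then show ?thesis using e by (intro that[of "\<lambda>_. 0"]) auto
next
  case False
  interpret prob_space \<nu> by fact
  note [measurable_cong] = s
  have [simp]: "space \<nu> = UNIV" using sets_eq_imp_space_eq[OF s] by simp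
  define \<psi> where "\<psi> k y = max 0 (1 - real k * infdist y C)" for k :: nat and y
  have c: "continuous_on UNIV (\<psi> k)" for k unfolding \<psi>_def by (intro continuous_intros)
  then have m [measurable]: "\<psi> k \<in> borel_measurable borel" for k by (rule borel_measurable_continuous_onI)
  have b: "0 \<le> \<psi> k y" "\<psi> k y \<le> 1" for k y by (auto simp: \<psi>_def infdist_nonneg)
  have C1: "\<psi> k y = 1" if "y \<in> C" for k y using that by (simp add: \<psi>_def)
  have [measurable]: "C \<in> sets \<nu>" using C s by simp
  have "(\<lambda>k. \<psi> k y) \<longlonglongrightarrow> indicator C y" for y
  proof (cases "y \<in> C")
    case True
    then show ?thesis by (simp add: C1)
  next
    case out: False
    then have pos: "0 < infdist y C" using infdist_pos_not_in_closed[OF C False] by simp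
    obtain k0 :: nat where k0: "1 \<le> real k0 * infdist y C" using reals_Archimedean3[OF pos] less_imp_le by blast
    have "\<psi> k y = 0" if "k0 \<le> k" for k
    proof -
      have "real k0 * infdist y C \<le> real k * infdist y C" using that pos by (intro mult_right_mono) auto
      then show ?thesis using k0 by (simp add: \<psi>_def)
    qed
    then have "\<forall>\<^sub>F k in sequentially. \<psi> k y = 0" by (intro eventually_sequentiallyI[of k0])
    with out show ?thesis by (simp add: tendsto_eventually)
  qed
  then have "(\<lambda>k. \<integral>y. \<psi> k y \<partial>\<nu>) \<longlonglongrightarrow> (\<integral>y. indicator C y \<partial>\<nu>)"
    by (intro integral_dominated_convergence[where w="\<lambda>_. 1"]) (use b in auto)
  then have "(\<lambda>k. \<integral>y. \<psi> k y \<partial>\<nu>) \<longlonglongrightarrow> measure \<nu> C" by simp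
  then have "\<forall>\<^sub>F k in sequentially. (\<integral>y. \<psi> k y \<partial>\<nu>) < e" using e by (rule order_tendstoD)
  then obtain k where "(\<integral>y. \<psi> k y \<partial>\<nu>) < e" using eventually_happens'[OF sequentially_bot] by blast
  then show ?thesis using c b C1 by (intro that[of "\<psi> k"]) auto
qed

lemma measure_le_integral:
  fixes \<psi> :: "'a \<Rightarrow> real"
  assumes "finite_measure M" and C: "C \<in> sets M" and \<psi>: "integrable M \<psi>" "\<And>y. 0 \<le> \<psi> y" "\<And>y. y \<in> C \<Longrightarrow> \<psi> y = 1"
  shows "measure M C \<le> (\<integral>y. \<psi> y \<partial>M)"
proof -
  interpret finite_measure M by fact
  have "measure M C = (\<integral>y. indicator C y \<partial>M)" using C sets.sets_into_space[OF C] by (simp add: Int_absorb2)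
  also have "\<dots> \<le> (\<integral>y. \<psi> y \<partial>M)"
  proof (rule integral_mono)
    show "integrable M (indicat_real C)"
      using C by (intro integrable_real_indicator) (simp_all add: less_top[symmetric])
  qed (use \<psi> in \<open>auto split: split_indicator\<close>)
  finally show ?thesis .
qed

lemma measure_eq_from_continuous:
  fixes M N :: "'a::polish_space measure"
  assumes M: "sets M = sets borel" "prob_space M" and N: "sets N = sets borel" "prob_space N"
    and eq: "\<And>\<psi>. continuous_on UNIV \<psi> \<Longrightarrow> (\<And>y. 0 \<le> \<psi> y) \<Longrightarrow> (\<And>y. \<psi> y \<le> 1) \<Longrightarrow>
      (\<integral>y. \<psi> y \<partial>M) = (\<integral>y. \<psi> y \<partial>N :: real)"
  shows "M = N"
proof -
  interpret M: prob_space M by fact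
  interpret N: prob_space N by fact
  have [simp]: "space M = UNIV" "space N = UNIV"
    using sets_eq_imp_space_eq[OF M(1)] sets_eq_imp_space_eq[OF N(1)] by simp_all
  have cl: "measure N C \<le> measure M C" if C: "closed C" for C
  proof (rule field_le_epsilon)
    fix e :: real assume "e > 0"
    then obtain \<psi> where \<psi>: "continuous_on UNIV \<psi>" "\<And>y. 0 \<le> \<psi> y" "\<And>y. \<psi> y \<le> 1" "\<And>y. y \<in> C \<Longrightarrow> \<psi> y = 1"
      "(\<integral>y. \<psi> y \<partial>M) < measure M C + e"
      using closed_approx[OF M C, of "measure M C + e"] by auto
    have \<psi>m: "\<psi> \<in> borel_measurable N"
      using borel_measurable_continuous_onI[OF \<psi>(1)] measurable_cong_sets[OF N(1) refl] by blast
    have Cm: "C \<in> sets N" using C N(1) by simp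
    have "measure N C \<le> (\<integral>y. \<psi> y \<partial>N)"
    proof (rule measure_le_integral[OF N.finite_measure_axioms Cm _ \<psi>(2,4)])
      show "integrable N \<psi>" using \<psi> \<psi>m by (intro N.integrable_const_bound[of _ 1]) auto
    qed
    also have "\<dots> = (\<integral>y. \<psi> y \<partial>M)" using eq[OF \<psi>(1-3)] by simp
    finally show "measure N C \<le> measure M C + e" using \<psi>(5) by simp
  qed
  show ?thesis
  proof (rule measure_eq_from_open[OF M(1) N(1)])
    fix U :: "'a set" assume U: "open U"
    have "measure M U = 1 - measure M (- U)" "measure N U = 1 - measure N (- U)"
      using M.prob_compl[of "- U"] N.prob_compl[of "- U"] U M(1) N(1) by (auto simp: Compl_eq_Diff_UNIV[symmetric])
    then show "emeasure M U \<le> emeasure N U"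
      using cl[of "- U"] U by (simp add: M.emeasure_eq_measure N.emeasure_eq_measure ennreal_leI closed_Compl)
  qed (use M.emeasure_space_1 N.emeasure_space_1 in auto)
qed

text \<open>Over a compact \<open>K\<close>, continuity in \<open>y\<close> is uniform in
  \<open>x\<close>, so the supremum inherits it. This supplies a continuous dominating function that
  depends on the second coordinate alone.\<close>

lemma continuous_on_compact_SUP:
  fixes g :: "'a::topological_space \<times> 'b::topological_space \<Rightarrow> real"
  assumes g: "continuous_on UNIV g" and K: "compact K" "K \<noteq> {}"
  shows "continuous_on UNIV (\<lambda>y. SUP x\<in>K. g (x, y))" and "\<And>y. bdd_above ((\<lambda>x. g (x, y)) ` K)"
proof -
  show bdd: "bdd_above ((\<lambda>x. g (x, y)) ` K)" for y
  proof -
    have "continuous_on K (\<lambda>x. g (x, y))"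
      by (rule continuous_on_compose2[OF g]) (auto intro: continuous_intros)
    then show ?thesis
      using K(1) by (intro bounded_imp_bdd_above compact_imp_bounded compact_continuous_image)
  qed
  have gs: "continuous_on (UNIV \<times> K) (\<lambda>z. g (snd z, fst z))"
    by (rule continuous_on_compose2[OF g]) (auto intro!: continuous_intros)
  show "continuous_on UNIV (\<lambda>y. SUP x\<in>K. g (x, y))"
    unfolding continuous_on_def
  proof (intro ballI tendstoI)
    fix y0 :: 'b and e :: real assume "0 < e"
    then obtain X0 where X0: "y0 \<in> X0" "open X0"
      "\<forall>y\<in>X0 \<inter> UNIV. \<forall>x\<in>K. dist (g (x, y)) (g (x, y0)) \<le> e / 2"
      using continuous_on_prod_compactE[OF gs K(1), of y0 "e / 2"] by auto
    have le: "(SUP x\<in>K. g (x, y)) \<le> (SUP x\<in>K. g (x, y')) + e / 2"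
      if "\<And>x. x \<in> K \<Longrightarrow> \<bar>g (x, y) - g (x, y')\<bar> \<le> e / 2" for y y'
    proof (rule cSUP_least[OF K(2)])
      fix x assume x: "x \<in> K"
      have "g (x, y') \<le> (SUP x\<in>K. g (x, y'))" using x bdd by (rule cSUP_upper)
      then show "g (x, y) \<le> (SUP x\<in>K. g (x, y')) + e / 2" using that[OF x] by linarith
    qed
    have "\<forall>\<^sub>F y in at y0 within UNIV. y \<in> X0"
      using X0(1,2) by (auto simp: eventually_at_topological)
    then show "\<forall>\<^sub>F y in at y0 within UNIV. dist (SUP x\<in>K. g (x, y)) (SUP x\<in>K. g (x, y0)) < e"
    proof eventually_elim
      case (elim y)
      have d: "\<bar>g (x, y) - g (x, y0)\<bar> \<le> e / 2" if "x \<in> K" for x using X0(3) elim that by (auto simp: dist_real_def)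
      have "(SUP x\<in>K. g (x, y)) \<le> (SUP x\<in>K. g (x, y0)) + e / 2" by (rule le) (rule d)
      moreover have "(SUP x\<in>K. g (x, y0)) \<le> (SUP x\<in>K. g (x, y)) + e / 2"
        by (rule le) (use d in \<open>simp add: abs_minus_commute\<close>)
      ultimately show ?case using \<open>0 < e\<close> by (simp add: dist_real_def)
    qed
  qed
qed

section \<open>Splicing two kernels along a Borel set\<close>

definition patch :: "'a set \<Rightarrow> ('a \<Rightarrow> 'b) \<Rightarrow> ('a \<Rightarrow> 'b) \<Rightarrow> 'a \<Rightarrow> 'b" where
  "patch K p r x = (if x \<in> K then p x else r x)"

lemma prob_kernel_patch:
  assumes p: "prob_kernel \<mu> p" and r: "prob_kernel \<mu> r" and K: "K \<in> sets borel"
  shows "prob_kernel \<mu> (patch K p r)"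
proof -
  interpret p: prob_kernel \<mu> p by fact
  interpret r: prob_kernel \<mu> r by fact
  have "patch K p r \<in> borel \<rightarrow>\<^sub>M prob_algebra borel"
    unfolding patch_def[abs_def] using p.kernel r.kernel K by (intro measurable_If_set) auto
  then show ?thesis by (intro prob_kernel.intro p.sets_base p.prob_base)
qed

lemma nn_integral_patch:
  assumes p: "prob_kernel \<mu> p" and r: "prob_kernel \<mu> r" and K: "K \<in> sets borel"
    and h [measurable]: "h \<in> borel_measurable borel"
  shows "(\<integral>\<^sup>+z. h z \<partial>semidirect \<mu> (patch K p r)) =
    (\<integral>\<^sup>+z. indicator (K \<times> UNIV) z * h z \<partial>semidirect \<mu> p) +
    (\<integral>\<^sup>+z. indicator ((- K) \<times> UNIV) z * h z \<partial>semidirect \<mu> r)"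
proof -
  interpret p: prob_kernel \<mu> p by fact
  interpret r: prob_kernel \<mu> r by fact
  interpret q: prob_kernel \<mu> "patch K p r" using assms by (intro prob_kernel_patch)
  have cyl [measurable]: "K \<times> UNIV \<in> sets (borel :: ('a \<times> 'b) measure)"
      "(- K) \<times> UNIV \<in> sets (borel :: ('a \<times> 'b) measure)"
    using K unfolding borel_prod[symmetric] by auto
  have m: "(\<lambda>x. \<integral>\<^sup>+y. h (x, y) \<partial>k x) \<in> borel_measurable \<mu>" if k: "prob_kernel \<mu> k" for k
  proof -
    interpret k: prob_kernel \<mu> k by fact
    have "(\<lambda>(x, y). h (x, y)) \<in> borel_measurable (borel \<Otimes>\<^sub>M borel)" by (simp add: borel_prod)
    from nn_integral_measurable_subprob_algebra2[OF this k.kernel_subprob]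
    show ?thesis by (simp cong: measurable_cong_sets)
  qed
  have "(\<integral>\<^sup>+z. h z \<partial>semidirect \<mu> (patch K p r)) = (\<integral>\<^sup>+x. \<integral>\<^sup>+y. h (x, y) \<partial>patch K p r x \<partial>\<mu>)"
    by (rule q.nn_integral_semidirect[OF h])
  also have "\<dots> = (\<integral>\<^sup>+x. indicator K x * (\<integral>\<^sup>+y. h (x, y) \<partial>p x) + indicator (- K) x * (\<integral>\<^sup>+y. h (x, y) \<partial>r x) \<partial>\<mu>)"
    by (intro nn_integral_cong) (auto simp: patch_def split: split_indicator)
  also have "\<dots> = (\<integral>\<^sup>+x. indicator K x * (\<integral>\<^sup>+y. h (x, y) \<partial>p x) \<partial>\<mu>) +
      (\<integral>\<^sup>+x. indicator (- K) x * (\<integral>\<^sup>+y. h (x, y) \<partial>r x) \<partial>\<mu>)"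
    using K m[OF p] m[OF r] by (intro nn_integral_add) auto
  also have "(\<integral>\<^sup>+x. indicator K x * (\<integral>\<^sup>+y. h (x, y) \<partial>p x) \<partial>\<mu>) = (\<integral>\<^sup>+z. indicator (K \<times> UNIV) z * h z \<partial>semidirect \<mu> p)"
  proof -
    have hm: "(\<lambda>z. indicator (K \<times> UNIV) z * h z) \<in> borel_measurable borel" by measurable
    show ?thesis
      unfolding p.nn_integral_semidirect[OF hm] by (intro nn_integral_cong) (auto split: split_indicator)
  qed
  also have "(\<integral>\<^sup>+x. indicator (- K) x * (\<integral>\<^sup>+y. h (x, y) \<partial>r x) \<partial>\<mu>) = (\<integral>\<^sup>+z. indicator ((- K) \<times> UNIV) z * h z \<partial>semidirect \<mu> r)"
  proof -
    have hm: "(\<lambda>z. indicator ((- K) \<times> UNIV) z * h z) \<in> borel_measurable borel" by measurable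
    show ?thesis
      unfolding r.nn_integral_semidirect[OF hm] by (intro nn_integral_cong) (auto split: split_indicator)
  qed
  finally show ?thesis .
qed

lemma integral_patch:
  fixes f :: "'a::second_countable_topology \<times> 'b::second_countable_topology \<Rightarrow> real"
  assumes p: "prob_kernel \<mu> p" and r: "prob_kernel \<mu> r" and K: "K \<in> sets borel"
    and f [measurable]: "f \<in> borel_measurable borel"
    and ip: "integrable (semidirect \<mu> p) f" and ir: "integrable (semidirect \<mu> r) f"
  shows "(\<integral>z. f z \<partial>semidirect \<mu> (patch K p r)) =
    (\<integral>z. indicator (K \<times> UNIV) z * f z \<partial>semidirect \<mu> p) +
    (\<integral>z. indicator ((- K) \<times> UNIV) z * f z \<partial>semidirect \<mu> r)"
proof -
  interpret p: prob_kernel \<mu> p by fact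
  interpret r: prob_kernel \<mu> r by fact
  interpret q: prob_kernel \<mu> "patch K p r" using assms by (intro prob_kernel_patch)
  have cyl [measurable]: "K \<times> UNIV \<in> sets (borel :: ('a \<times> 'b) measure)"
      "(- K) \<times> UNIV \<in> sets (borel :: ('a \<times> 'b) measure)"
    using K unfolding borel_prod[symmetric] by auto
  let ?p = "\<lambda>z. indicator (K \<times> UNIV) z * f z" and ?r = "\<lambda>z. indicator ((- K) \<times> UNIV) z * f z"
  have ip': "integrable (semidirect \<mu> p) ?p"
    by (rule Bochner_Integration.integrable_bound[OF ip], measurable) (auto split: split_indicator)
  have ir': "integrable (semidirect \<mu> r) ?r"
    by (rule Bochner_Integration.integrable_bound[OF ir], measurable) (auto split: split_indicator)
  have nn: "(\<integral>\<^sup>+z. ennreal (g z) \<partial>semidirect \<mu> (patch K p r)) =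
      (\<integral>\<^sup>+z. ennreal (indicator (K \<times> UNIV) z * g z) \<partial>semidirect \<mu> p) +
      (\<integral>\<^sup>+z. ennreal (indicator ((- K) \<times> UNIV) z * g z) \<partial>semidirect \<mu> r)"
    if [measurable]: "g \<in> borel_measurable borel" for g :: "'a \<times> 'b \<Rightarrow> real"
    by (subst nn_integral_patch[OF p r K])
      (auto intro!: arg_cong2[where f="(+)"] nn_integral_cong split: split_indicator)
  have neg: "indicator S z * - f z = - (indicator S z * f z)" for S z by simp
  have fin: "(\<integral>\<^sup>+z. ennreal (?p z) \<partial>semidirect \<mu> p) < \<infinity>" "(\<integral>\<^sup>+z. ennreal (- ?p z) \<partial>semidirect \<mu> p) < \<infinity>"
    "(\<integral>\<^sup>+z. ennreal (?r z) \<partial>semidirect \<mu> r) < \<infinity>" "(\<integral>\<^sup>+z. ennreal (- ?r z) \<partial>semidirect \<mu> r) < \<infinity>"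
    using ip' ir' unfolding real_integrable_def by (auto simp: less_top)
  have nn1: "(\<integral>\<^sup>+z. ennreal (f z) \<partial>semidirect \<mu> (patch K p r)) =
      (\<integral>\<^sup>+z. ennreal (?p z) \<partial>semidirect \<mu> p) + (\<integral>\<^sup>+z. ennreal (?r z) \<partial>semidirect \<mu> r)"
    by (rule nn) simp
  have nn2: "(\<integral>\<^sup>+z. ennreal (- f z) \<partial>semidirect \<mu> (patch K p r)) =
      (\<integral>\<^sup>+z. ennreal (- ?p z) \<partial>semidirect \<mu> p) + (\<integral>\<^sup>+z. ennreal (- ?r z) \<partial>semidirect \<mu> r)"
    using nn[of "\<lambda>z. - f z"] unfolding neg by simp
  have iq: "integrable (semidirect \<mu> (patch K p r)) f"
    unfolding real_integrable_def nn1 nn2 using fin by (auto simp: less_top)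
  show ?thesis
    unfolding real_lebesgue_integral_def[OF iq] real_lebesgue_integral_def[OF ip'] real_lebesgue_integral_def[OF ir'] nn1 nn2
    using fin by (simp add: enn2real_plus)
qed

context weight
begin

lemma semidirect_in_P_gamma2:
  assumes \<mu>: "\<mu> \<in> P_gamma \<gamma> xo" and p: "prob_kernel \<mu> p" and \<nu>: "\<mu> \<bind> p \<in> P_gamma \<gamma> xo"
  shows "semidirect \<mu> p \<in> P_weight (weight2 \<gamma> xo)"
proof -
  interpret prob_kernel \<mu> p by fact
  have w2: "weight2 \<gamma> xo z = w (fst z) + w (snd z)" for z by (cases z) (simp add: weight2_eq)
  have "(\<integral>\<^sup>+z. ennreal (weight2 \<gamma> xo z) \<partial>semidirect \<mu> p) =
      (\<integral>\<^sup>+z. ennreal (w (fst z)) + ennreal (w (snd z)) \<partial>semidirect \<mu> p)"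
    unfolding w2 by simp
  also have "\<dots> = (\<integral>\<^sup>+z. ennreal (w (fst z)) \<partial>semidirect \<mu> p) + (\<integral>\<^sup>+z. ennreal (w (snd z)) \<partial>semidirect \<mu> p)"
    using fst_measurable snd_measurable by (intro nn_integral_add) auto
  also have "(\<integral>\<^sup>+z. ennreal (w (fst z)) \<partial>semidirect \<mu> p) = (\<integral>\<^sup>+x. ennreal (w x) \<partial>\<mu>)"
    by (subst (2) distr_fst_semidirect[symmetric], subst nn_integral_distr[OF fst_measurable]) auto
  also have "(\<integral>\<^sup>+z. ennreal (w (snd z)) \<partial>semidirect \<mu> p) = (\<integral>\<^sup>+x. ennreal (w x) \<partial>(\<mu> \<bind> p))"
    by (rule nn_integral_snd_semidirect) simp
  finally show ?thesis
    using P_gammaD(4)[OF \<mu>] P_gammaD(4)[OF \<nu>] by (auto simp: P_weight_def prob_semidirect)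
qed

lemma patch_kernel:
  assumes p: "p \<in> P_gamma_kernels \<gamma> xo" and r: "r \<in> P_gamma_kernels \<gamma> xo" and K: "K \<in> sets borel"
  shows "patch K p r \<in> P_gamma_kernels \<gamma> xo"
proof -
  have "patch K p r \<in> borel \<rightarrow>\<^sub>M prob_algebra borel"
    unfolding patch_def[abs_def] using kernelD(1)[OF p] kernelD(1)[OF r] K by (intro measurable_If_set) auto
  then show ?thesis using kernelD(2)[OF p] kernelD(2)[OF r] by (auto simp: P_gamma_kernels_def patch_def)
qed

lemma bind_patch_in_P_gamma:
  assumes \<mu>: "\<mu> \<in> P_gamma \<gamma> xo" and p: "p \<in> P_gamma_kernels \<gamma> xo" "\<mu> \<bind> p \<in> P_gamma \<gamma> xo"
    and r: "r \<in> P_gamma_kernels \<gamma> xo" "\<mu> \<bind> r \<in> P_gamma \<gamma> xo" and K: "K \<in> sets borel"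
  shows "\<mu> \<bind> patch K p r \<in> P_gamma \<gamma> xo"
proof -
  note pk = prob_kernelI[OF \<mu> p(1)] and rk = prob_kernelI[OF \<mu> r(1)]
  interpret p: prob_kernel \<mu> p by (rule pk)
  interpret r: prob_kernel \<mu> r by (rule rk)
  interpret q: prob_kernel \<mu> "patch K p r" using pk rk K by (rule prob_kernel_patch)
  have m: "(\<lambda>x. \<integral>\<^sup>+y. ennreal (w y) \<partial>k x) \<in> borel_measurable \<mu>" if "prob_kernel \<mu> k" for k
  proof -
    interpret k: prob_kernel \<mu> k by fact
    show ?thesis
      using k.kernel_subprob by (intro nn_integral_measurable_subprob_algebra2[where N=borel])
        (auto simp: measurable_split_conv cong: measurable_cong_sets)
  qed
  have "(\<integral>\<^sup>+y. ennreal (w y) \<partial>(\<mu> \<bind> patch K p r)) = (\<integral>\<^sup>+x. \<integral>\<^sup>+y. ennreal (w y) \<partial>patch K p r x \<partial>\<mu>)"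
    by (rule q.nn_integral_bind_kernel) simp
  also have "\<dots> \<le> (\<integral>\<^sup>+x. (\<integral>\<^sup>+y. ennreal (w y) \<partial>p x) + (\<integral>\<^sup>+y. ennreal (w y) \<partial>r x) \<partial>\<mu>)"
    by (intro nn_integral_mono) (auto simp: patch_def)
  also have "\<dots> = (\<integral>\<^sup>+x. \<integral>\<^sup>+y. ennreal (w y) \<partial>p x \<partial>\<mu>) + (\<integral>\<^sup>+x. \<integral>\<^sup>+y. ennreal (w y) \<partial>r x \<partial>\<mu>)"
    by (rule nn_integral_add[OF m[OF pk] m[OF rk]])
  also have "\<dots> = (\<integral>\<^sup>+y. ennreal (w y) \<partial>(\<mu> \<bind> p)) + (\<integral>\<^sup>+y. ennreal (w y) \<partial>(\<mu> \<bind> r))"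
    by (simp add: p.nn_integral_bind_kernel r.nn_integral_bind_kernel)
  also have "\<dots> < \<infinity>" using P_gammaD(4)[OF p(2)] P_gammaD(4)[OF r(2)] by simp
  finally show ?thesis by (intro P_gammaI q.prob_bind_kernel q.sets_bind_kernel)
qed

text \<open>Inner regularity gives compact sets of mass close to 1. Intersecting them with the
  sublevel sets of \<open>w\<close>, closed by lower semicontinuity, keeps them compact and bounds
  \<open>w\<close> on them. The point \<open>xo\<close> makes every set nonempty and respects the
  bound, since \<open>w xo = 0\<close>.\<close>

lemma ex_compact_exhaustion:
  assumes \<mu>: "\<mu> \<in> P_gamma \<gamma> xo"
  obtains K :: "nat \<Rightarrow> 'a set" where "\<And>n. compact (K n)" "incseq K" "\<And>n. xo \<in> K n"
    "\<And>n x. x \<in> K n \<Longrightarrow> w x \<le> real n" "AE x in \<mu>. x \<in> (\<Union>n. K n)"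
proof -
  note M = P_gammaD[OF \<mu>]
  interpret prob_space \<mu> by (rule M)
  have "\<exists>C. compact C \<and> 1 - inverse (real (Suc j)) < measure \<mu> C" for j
  proof -
    have "ennreal (1 - inverse (real (Suc j))) < 1" by (simp add: ennreal_less_one_iff)
    also have "1 = emeasure \<mu> UNIV" using emeasure_space_1 M(2) by simp
    also have "\<dots> = (SUP K\<in>{K. K \<subseteq> UNIV \<and> compact K}. emeasure \<mu> K)"
      by (rule inner_regular) (use M emeasure_space_1 in auto)
    finally obtain C where "compact C" "ennreal (1 - inverse (real (Suc j))) < emeasure \<mu> C"
      by (auto simp: less_SUP_iff)
    then show ?thesis by (auto simp: emeasure_eq_measure ennreal_less_iff inverse_le_1_iff intro!: exI[of _ C])
  qed
  then obtain C where C: "\<And>j. compact (C j)" "\<And>j. 1 - inverse (real (Suc j)) < measure \<mu> (C j)" by metis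
  define K where "K n = insert xo ((\<Union>j\<le>n. C j) \<inter> {x. w x \<le> real n})" for n
  have Cm: "C j \<in> sets \<mu>" for j using C(1)[of j] M(1) by (simp add: compact_imp_closed)
  have "measure \<mu> (\<Union>j. C j) = 1"
  proof (rule antisym)
    show "measure \<mu> (\<Union>j. C j) \<le> 1" by simp
    have "1 - inverse (real (Suc j)) \<le> measure \<mu> (\<Union>j. C j)" for j
      using C(2)[of j] finite_measure_mono[of "C j" "\<Union>j. C j"] Cm by fastforce
    moreover have "(\<lambda>j. 1 - inverse (real (Suc j))) \<longlonglongrightarrow> 1 - 0"
      by (intro tendsto_intros LIMSEQ_inverse_real_of_nat)
    ultimately show "1 \<le> measure \<mu> (\<Union>j. C j)" by (intro LIMSEQ_le_const2[where X="\<lambda>j. 1 - inverse (real (Suc j))"]) auto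
  qed
  then have "AE x in \<mu>. x \<in> (\<Union>j. C j)"
    using Cm by (intro AE_in_set_eq_1[THEN iffD2]) auto
  then have "AE x in \<mu>. x \<in> (\<Union>n. K n)"
  proof eventually_elim
    case (elim x)
    then obtain j where j: "x \<in> C j" by auto
    obtain n :: nat where n: "w x \<le> real n" using real_arch_simple by blast
    have "x \<in> K (max j n)" using j n by (auto simp: K_def intro!: bexI[of _ j])
    then show ?case by blast
  qed
  moreover have "compact (K n)" for n
    unfolding K_def using C(1) w_closed by (intro compact_insert compact_Int_closed compact_UN) auto
  moreover have "incseq K" unfolding K_def incseq_def by force
  moreover have "xo \<in> K n" "\<And>x. x \<in> K n \<Longrightarrow> w x \<le> real n" for n by (auto simp: K_def)
  ultimately show thesis using that by blast
qed

end

lemma semidirect_cong_AE: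
  assumes "prob_kernel \<mu> p" "prob_kernel \<mu> q" "AE x in \<mu>. p x = q x"
  shows "semidirect \<mu> p = semidirect \<mu> q"
proof -
  interpret p: prob_kernel \<mu> p by fact
  interpret q: prob_kernel \<mu> q by fact
  show ?thesis
    unfolding semidirect_def
    by (rule bind_cong_AE[OF refl p.pair_kernel_base[THEN measurable_prob_algebraD]
          q.pair_kernel_base[THEN measurable_prob_algebraD]])
      (use assms(3) in \<open>auto elim!: eventually_mono\<close>)
qed

text \<open>Stable convergence is tested on functions of the second coordinate, with the constant 1
  as dominating function; bounded continuous functions then identify the marginal.\<close>

lemma kernel_limit_second_marginal:
  fixes \<kappa> :: "'i \<Rightarrow> 'a::second_countable_topology \<Rightarrow> 'b::polish_space measure"
  assumes lim: "kernel_limit F \<mu> \<kappa> q" and \<nu>: "sets \<nu> = sets borel" "prob_space \<nu>"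
    and conv: "\<And>\<psi> :: 'b \<Rightarrow> real. continuous_on UNIV \<psi> \<Longrightarrow> (\<And>y. 0 \<le> \<psi> y) \<Longrightarrow> (\<And>y. \<psi> y \<le> 1) \<Longrightarrow>
      ((\<lambda>i. \<integral>y. \<psi> y \<partial>(\<mu> \<bind> \<kappa> i)) \<longlongrightarrow> (\<integral>y. \<psi> y \<partial>\<nu>)) F"
  shows "\<mu> \<bind> q = \<nu>"
proof -
  interpret kernel_limit F \<mu> \<kappa> q by (rule lim)
  show ?thesis
  proof (rule measure_eq_from_continuous)
    fix \<psi> :: "'b \<Rightarrow> real" assume \<psi>: "continuous_on UNIV \<psi>" "\<And>y. 0 \<le> \<psi> y" "\<And>y. \<psi> y \<le> 1"
    have \<psi>s: "continuous_on UNIV (\<lambda>z :: 'a \<times> 'b. \<psi> (snd z))"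
      by (rule continuous_on_compose2[OF \<psi>(1)]) (auto intro: continuous_intros)
    have int: "(\<integral>z. indicator (UNIV \<times> UNIV) z * \<psi> (snd z) \<partial>semidirect \<mu> k) = (\<integral>y. \<psi> y \<partial>(\<mu> \<bind> k))"
      if k: "prob_kernel \<mu> k" for k
    proof -
      interpret k: prob_kernel \<mu> k by fact
      show ?thesis using k.integral_snd_semidirect[OF borel_measurable_continuous_onI[OF \<psi>(1)]] by simp
    qed
    have "((\<lambda>i. \<integral>z. indicator (UNIV \<times> UNIV) z * \<psi> (snd z) \<partial>semidirect \<mu> (\<kappa> i)) \<longlongrightarrow>
        (\<integral>z. indicator (UNIV \<times> UNIV) z * \<psi> (snd z) \<partial>semidirect \<mu> q)) F"
    proof (rule dominated_integral_tendsto[where G="\<lambda>_. 1"])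
      have one: "integrable (\<mu> \<bind> k) (\<lambda>_. 1 :: real) \<and> (\<integral>y. 1 \<partial>(\<mu> \<bind> k)) = (1 :: real)" if "prob_kernel \<mu> k" for k
      proof -
        interpret k: prob_kernel \<mu> k by fact
        interpret b: prob_space "\<mu> \<bind> k" by (rule k.prob_bind_kernel)
        have "space (\<mu> \<bind> k) = UNIV" using sets_eq_imp_space_eq[OF k.sets_bind_kernel] by simp
        then show ?thesis using b.prob_space by simp
      qed
      show "\<forall>\<^sub>F i in F. integrable (\<mu> \<bind> \<kappa> i) (\<lambda>_. 1 :: real)"
        using kernels by eventually_elim (use one in blast)
      show "integrable (\<mu> \<bind> q) (\<lambda>_. 1 :: real)" using one limit by blast
      show "((\<lambda>i. \<integral>y. 1 \<partial>(\<mu> \<bind> \<kappa> i)) \<longlongrightarrow> (\<integral>y. (1 :: real) \<partial>(\<mu> \<bind> q))) F"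
      proof (rule tendsto_eventually)
        show "\<forall>\<^sub>F i in F. (\<integral>y. 1 \<partial>(\<mu> \<bind> \<kappa> i)) = (\<integral>y. (1 :: real) \<partial>(\<mu> \<bind> q))"
          using kernels
        proof eventually_elim
          case (elim i)
          show ?case by (rule trans[OF conjunct2[OF one[OF elim]] conjunct2[OF one[OF limit], symmetric]])
        qed
      qed
    qed (use \<psi> \<psi>s in auto)
    then have "((\<lambda>i. \<integral>y. \<psi> y \<partial>(\<mu> \<bind> \<kappa> i)) \<longlongrightarrow> (\<integral>y. \<psi> y \<partial>(\<mu> \<bind> q))) F"
      unfolding int[OF limit]
    proof (rule tendsto_cong[THEN iffD1, rotated])
      show "\<forall>\<^sub>F i in F. (\<integral>z. indicator (UNIV \<times> UNIV) z * \<psi> (snd z) \<partial>semidirect \<mu> (\<kappa> i)) = (\<integral>y. \<psi> y \<partial>(\<mu> \<bind> \<kappa> i))"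
        using kernels by eventually_elim (rule int)
    qed
    then show "(\<integral>y. \<psi> y \<partial>(\<mu> \<bind> q)) = (\<integral>y. \<psi> y \<partial>\<nu>)"
      using conv[OF \<psi>] nontrivial by (intro tendsto_unique)
  qed (use \<nu> L.prob_bind_kernel in auto)
qed

section \<open>Cost functionals along limits of kernels\<close>

locale weighted_cost = weight \<gamma> xo for \<gamma> and xo :: "'a::polish_space" +
  fixes c :: "'a \<Rightarrow> 'a measure \<Rightarrow> ennreal"
  assumes c_measurable: "(\<lambda>(x, p). c x p) \<in> borel_measurable (borel \<Otimes>\<^sub>M P_gamma_algebra \<gamma> xo)"
begin

lemma cost_measurable:
  assumes p: "p \<in> P_gamma_kernels \<gamma> xo"
  shows "(\<lambda>x. c x (p x)) \<in> borel_measurable borel"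
proof -
  have "p \<in> borel \<rightarrow>\<^sub>M P_gamma_algebra \<gamma> xo"
    unfolding P_gamma_algebra_def using kernelD[OF p] by (intro measurable_restrict_space2) auto
  then have "(\<lambda>x. (x, p x)) \<in> borel \<rightarrow>\<^sub>M borel \<Otimes>\<^sub>M P_gamma_algebra \<gamma> xo" by measurable
  from measurable_compose[OF this c_measurable] show ?thesis by simp
qed

lemma cost_measurable_base:
  "\<mu> \<in> P_gamma \<gamma> xo \<Longrightarrow> p \<in> P_gamma_kernels \<gamma> xo \<Longrightarrow> (\<lambda>x. c x (p x)) \<in> borel_measurable \<mu>"
  using cost_measurable[of p] measurable_cong_sets[OF P_gammaD(1) refl, of \<mu>] by blast

lemma Phi2D:
  assumes "f \<in> Phi_weight (weight2 \<gamma> xo)"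
  shows "continuous_on UNIV f" "f \<in> borel_measurable borel"
    "\<exists>a\<ge>0. \<exists>b\<ge>0. \<forall>x y. \<bar>f (x, y)\<bar> \<le> a + b * (w x + w y)"
proof -
  show c: "continuous_on UNIV f" using assms by (simp add: Phi_weight_def)
  then show "f \<in> borel_measurable borel" by (rule borel_measurable_continuous_onI)
  obtain a b where "a \<ge> 0" "b \<ge> 0" "\<forall>z. \<bar>f z\<bar> \<le> a + b * weight2 \<gamma> xo z"
    using assms by (auto simp: Phi_weight_def)
  then show "\<exists>a\<ge>0. \<exists>b\<ge>0. \<forall>x y. \<bar>f (x, y)\<bar> \<le> a + b * (w x + w y)"
    unfolding weight2_eq[symmetric] by blast
qed

lemma integrable_Phi2:
  assumes f: "f \<in> Phi_weight (weight2 \<gamma> xo)" and \<mu>: "\<mu> \<in> P_gamma \<gamma> xo"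
    and p: "prob_kernel \<mu> p" and \<nu>: "\<mu> \<bind> p \<in> P_gamma \<gamma> xo"
  shows "integrable (semidirect \<mu> p) f"
proof -
  interpret prob_kernel \<mu> p by fact
  interpret S: prob_space "semidirect \<mu> p" by (rule prob_semidirect)
  obtain a b where ab: "\<And>z. \<bar>f z\<bar> \<le> a + b * weight2 \<gamma> xo z"
    using f by (auto simp: Phi_weight_def)
  have "(\<lambda>z. w (fst z) + w (snd z)) \<in> borel_measurable borel"
    by (intro borel_measurable_add measurable_compose[OF _ w_measurable])
      (auto intro!: borel_measurable_continuous_onI continuous_intros)
  then have wm: "weight2 \<gamma> xo \<in> borel_measurable borel"
    by (rule measurable_cong[THEN iffD1, rotated]) (auto simp: weight2_eq)
  have "integrable (semidirect \<mu> p) (weight2 \<gamma> xo)"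
  proof (rule integrableI_nonneg)
    show "AE z in semidirect \<mu> p. 0 \<le> weight2 \<gamma> xo z" by (auto simp: weight2_eq)
    show "(\<integral>\<^sup>+z. ennreal (weight2 \<gamma> xo z) \<partial>semidirect \<mu> p) < \<infinity>"
      using semidirect_in_P_gamma2[OF \<mu> p \<nu>] by (simp add: P_weight_def)
  qed (use wm in \<open>simp cong: measurable_cong_sets\<close>)
  then have "integrable (semidirect \<mu> p) (\<lambda>z. a + b * weight2 \<gamma> xo z)" by simp
  moreover have "f \<in> borel_measurable (semidirect \<mu> p)" using Phi2D(2)[OF f] by (simp cong: measurable_cong_sets)
  moreover have "norm (f z) \<le> norm (a + b * weight2 \<gamma> xo z)" for z using ab[of z] by simp
  ultimately show ?thesis by (rule Bochner_Integration.integrable_bound[OF _ _ AE_I2])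
qed

text \<open>Freezing the kernels off a compact set on which \<open>w\<close> is bounded upgrades stable convergence
  to convergence in \<open>\<sigma>(P\<^sub>\<gamma>(X \<times> X))\<close>: there \<open>f\<close> is dominated by a function of the second
  coordinate alone, which lies in \<open>\<Phi>\<^sub>\<gamma>(X)\<close>.\<close>

lemma patch_tendsto:
  assumes lim: "kernel_limit F \<mu> (\<lambda>p. p) q" and \<mu>: "\<mu> \<in> P_gamma \<gamma> xo"
    and ev: "\<forall>\<^sub>F p in F. p \<in> P_gamma_kernels \<gamma> xo \<and> \<mu> \<bind> p \<in> P_gamma \<gamma> xo"
    and q: "q \<in> P_gamma_kernels \<gamma> xo" "\<mu> \<bind> q \<in> P_gamma \<gamma> xo"
    and r: "r \<in> P_gamma_kernels \<gamma> xo" "\<mu> \<bind> r \<in> P_gamma \<gamma> xo"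
    and Phi: "\<And>\<psi>. \<psi> \<in> Phi_weight w \<Longrightarrow> ((\<lambda>p. \<integral>y. \<psi> y \<partial>(\<mu> \<bind> p)) \<longlongrightarrow> (\<integral>y. \<psi> y \<partial>(\<mu> \<bind> q))) F"
    and K: "compact K" "xo \<in> K" "\<And>x. x \<in> K \<Longrightarrow> w x \<le> B"
    and f: "f \<in> Phi_weight (weight2 \<gamma> xo)"
  shows "((\<lambda>p. \<integral>z. f z \<partial>semidirect \<mu> (patch K p r)) \<longlongrightarrow> (\<integral>z. f z \<partial>semidirect \<mu> (patch K q r))) F"
proof -
  interpret kernel_limit F \<mu> "\<lambda>p. p" q by (rule lim)
  note f' = Phi2D[OF f]
  obtain a b where ab: "0 \<le> a" "0 \<le> b" "\<And>x y. \<bar>f (x, y)\<bar> \<le> a + b * (w x + w y)" using f'(3) by blast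
  have Km: "K \<in> sets borel" using K(1) by (simp add: compact_imp_closed)
  have Kne: "K \<noteq> {}" using K(2) by auto
  define G where "G y = (SUP x\<in>K. \<bar>f (x, y)\<bar>)" for y
  have absf: "continuous_on UNIV (\<lambda>z. \<bar>f z\<bar>)" using f'(1) by (intro continuous_intros)
  note sup = continuous_on_compact_SUP[OF absf K(1) Kne]
  have Gc: "continuous_on UNIV G" unfolding G_def by (rule sup)
  have dom: "\<bar>f (x, y)\<bar> \<le> G y" if "x \<in> K" for x y
    unfolding G_def using that sup(2)[of y] by (rule cSUP_upper)
  have G0: "0 \<le> G y" for y using dom[OF K(2), of y] by linarith
  have "G y \<le> (a + b * B) + b * w y" for y
    unfolding G_def
  proof (rule cSUP_least[OF Kne])
    fix x assume "x \<in> K"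
    then have "b * w x \<le> b * B" using K(3) ab(2) by (intro mult_left_mono) auto
    with ab(3)[of x y] show "\<bar>f (x, y)\<bar> \<le> (a + b * B) + b * w y" by (simp add: algebra_simps)
  qed
  moreover have "0 \<le> B" using K(2) K(3)[of xo] by simp
  ultimately have GPhi: "G \<in> Phi_weight w"
    using Gc G0 ab(1,2) unfolding Phi_weight_def mem_Collect_eq
    by (intro conjI exI[of _ "a + b * B"] exI[of _ b] allI) auto
  have conv: "((\<lambda>p. \<integral>z. indicator (K \<times> UNIV) z * f z \<partial>semidirect \<mu> p) \<longlongrightarrow>
      (\<integral>z. indicator (K \<times> UNIV) z * f z \<partial>semidirect \<mu> q)) F"
  proof (rule dominated_integral_tendsto[OF Km f'(1) Gc dom G0])
    show "\<forall>\<^sub>F p in F. integrable (\<mu> \<bind> p) G" using ev by eventually_elim (auto intro: integrable_Phi[OF GPhi])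
    show "integrable (\<mu> \<bind> q) G" by (rule integrable_Phi[OF GPhi q(2)])
  qed (use Phi[OF GPhi] in auto)
  have split: "(\<integral>z. f z \<partial>semidirect \<mu> (patch K p r)) =
      (\<integral>z. indicator (K \<times> UNIV) z * f z \<partial>semidirect \<mu> p) + (\<integral>z. indicator ((- K) \<times> UNIV) z * f z \<partial>semidirect \<mu> r)"
    if p: "p \<in> P_gamma_kernels \<gamma> xo" "\<mu> \<bind> p \<in> P_gamma \<gamma> xo" for p
    using prob_kernelI[OF \<mu> p(1)] prob_kernelI[OF \<mu> r(1)] f'(2) Km p r
    by (intro integral_patch integrable_Phi2[OF f \<mu>])
  have "((\<lambda>p. (\<integral>z. indicator (K \<times> UNIV) z * f z \<partial>semidirect \<mu> p) + (\<integral>z. indicator ((- K) \<times> UNIV) z * f z \<partial>semidirect \<mu> r))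
      \<longlongrightarrow> (\<integral>z. f z \<partial>semidirect \<mu> (patch K q r))) F"
    unfolding split[OF q] by (intro tendsto_intros conv)
  then show ?thesis
    by (rule tendsto_cong[THEN iffD1, rotated]) (use ev in eventually_elim, simp add: split)
qed

lemma bounded_in_Phi:
  assumes "continuous_on UNIV \<psi>" "\<And>y. 0 \<le> \<psi> y" "\<And>y. \<psi> y \<le> 1"
  shows "\<psi> \<in> Phi_weight w"
  using assms unfolding Phi_weight_def mem_Collect_eq
  by (intro conjI exI[of _ 1] exI[of _ 0] allI) auto

text \<open>Any kernel \<open>r\<close> met along the filter has finite cost, so its cost
  \<open>\<rho> n\<close> off \<open>K n\<close> tends to 0. Patching with \<open>r\<close> off
  \<open>K n\<close> gives a convergence to which (C1) applies, at the price of the error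
  \<open>\<rho> n\<close>; letting \<open>n\<close> grow removes it.\<close>

lemma lsc_along_limit:
  assumes C1: "C1 \<gamma> xo c" and \<mu>: "\<mu> \<in> P_gamma \<gamma> xo"
    and lim: "kernel_limit F \<mu> (\<lambda>p. p) q"
    and ev: "\<forall>\<^sub>F p in F. p \<in> P_gamma_kernels \<gamma> xo \<and> \<mu> \<bind> p \<in> P_gamma \<gamma> xo \<and> (\<integral>\<^sup>+x. c x (p x) \<partial>\<mu>) \<le> ennreal \<alpha>"
    and q: "q \<in> P_gamma_kernels \<gamma> xo" "\<mu> \<bind> q \<in> P_gamma \<gamma> xo"
    and Phi: "\<And>\<psi>. \<psi> \<in> Phi_weight w \<Longrightarrow> ((\<lambda>p. \<integral>y. \<psi> y \<partial>(\<mu> \<bind> p)) \<longlongrightarrow> (\<integral>y. \<psi> y \<partial>(\<mu> \<bind> q))) F"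
  shows "(\<integral>\<^sup>+x. c x (q x) \<partial>\<mu>) \<le> ennreal \<alpha>"
proof -
  interpret kernel_limit F \<mu> "\<lambda>p. p" q by (rule lim)
  obtain r where r: "r \<in> P_gamma_kernels \<gamma> xo" "\<mu> \<bind> r \<in> P_gamma \<gamma> xo" "(\<integral>\<^sup>+x. c x (r x) \<partial>\<mu>) \<le> ennreal \<alpha>"
    using eventually_happens'[OF nontrivial ev] by blast
  obtain K :: "nat \<Rightarrow> 'a set" where K: "\<And>n. compact (K n)" "incseq K" "\<And>n. xo \<in> K n"
    "\<And>n x. x \<in> K n \<Longrightarrow> w x \<le> real n" "AE x in \<mu>. x \<in> (\<Union>n. K n)"
    using ex_compact_exhaustion[OF \<mu>] by blast
  have Km: "K n \<in> sets borel" for n using K(1) by (simp add: compact_imp_closed)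
  then have Km' [measurable]: "K n \<in> sets \<mu>" for n by simp
  note [measurable] = cost_measurable_base[OF \<mu> q(1)] cost_measurable_base[OF \<mu> r(1)]
  have patch_cost: "(\<integral>\<^sup>+x. c x (patch (K n) p r x) \<partial>\<mu>) = (\<integral>\<^sup>+x\<in>K n. c x (p x) \<partial>\<mu>) + (\<integral>\<^sup>+x\<in>- K n. c x (r x) \<partial>\<mu>)"
    if p: "p \<in> P_gamma_kernels \<gamma> xo" for p n
  proof -
    note [measurable] = cost_measurable_base[OF \<mu> p]
    have "(\<integral>\<^sup>+x. c x (patch (K n) p r x) \<partial>\<mu>) = (\<integral>\<^sup>+x. c x (p x) * indicator (K n) x + c x (r x) * indicator (- K n) x \<partial>\<mu>)"
      by (intro nn_integral_cong) (auto simp: patch_def split: split_indicator)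
    also have "\<dots> = (\<integral>\<^sup>+x\<in>K n. c x (p x) \<partial>\<mu>) + (\<integral>\<^sup>+x\<in>- K n. c x (r x) \<partial>\<mu>)"
      using Km by (intro nn_integral_add) (auto intro!: borel_measurable_times_ennreal borel_measurable_indicator)
    finally show ?thesis .
  qed
  define \<rho> where "\<rho> n = (\<integral>\<^sup>+x\<in>- K n. c x (r x) \<partial>\<mu>)" for n
  \<comment> \<open>If the bound failed, the patched \<open>q\<close> would lie in an open set on
    which the cost exceeds \<open>ennreal \<alpha> + \<rho> n\<close>. The patched kernels of the
    filter would eventually lie there too, although their cost is at most that value.\<close>
  have bound: "(\<integral>\<^sup>+x\<in>K n. c x (q x) \<partial>\<mu>) \<le> ennreal \<alpha> + \<rho> n" for n
  proof (rule ccontr)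
    assume neg: "\<not> ?thesis"
    let ?fib = "{\<pi> \<in> P_gamma2 \<gamma> xo. distr \<pi> borel fst = \<mu>}"
    let ?b = "ennreal \<alpha> + \<rho> n"
    let ?s = "\<lambda>p. semidirect \<mu> (patch (K n) p r)"
    have pk: "patch (K n) p r \<in> P_gamma_kernels \<gamma> xo" "\<mu> \<bind> patch (K n) p r \<in> P_gamma \<gamma> xo"
        "?s p \<in> P_weight (weight2 \<gamma> xo)" "?s p \<in> ?fib" "I_cost \<gamma> xo c (?s p) = (\<integral>\<^sup>+x\<in>K n. c x (p x) \<partial>\<mu>) + \<rho> n"
      if p: "p \<in> P_gamma_kernels \<gamma> xo" "\<mu> \<bind> p \<in> P_gamma \<gamma> xo" for p
    proof -
      show 1: "patch (K n) p r \<in> P_gamma_kernels \<gamma> xo" by (rule patch_kernel[OF p(1) r(1) Km])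
      show 2: "\<mu> \<bind> patch (K n) p r \<in> P_gamma \<gamma> xo" by (rule bind_patch_in_P_gamma[OF \<mu> p r(1,2) Km])
      show 3: "?s p \<in> P_weight (weight2 \<gamma> xo)" by (rule semidirect_in_P_gamma2[OF \<mu> prob_kernelI[OF \<mu> 1] 2])
      interpret k: prob_kernel \<mu> "patch (K n) p r" by (rule prob_kernelI[OF \<mu> 1])
      show "?s p \<in> ?fib" using 3 k.distr_fst_semidirect by (simp add: P_gamma2_def)
      show "I_cost \<gamma> xo c (?s p) = (\<integral>\<^sup>+x\<in>K n. c x (p x) \<partial>\<mu>) + \<rho> n"
        unfolding I_cost_semidirect[OF \<mu> 1] patch_cost[OF p(1)] \<rho>_def ..
    qed
    have "openin (subtopology (sigma_P2 \<gamma> xo) ?fib)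
        {\<pi> \<in> topspace (subtopology (sigma_P2 \<gamma> xo) ?fib). ?b < I_cost \<gamma> xo c \<pi>}"
      using C1 \<mu> by (simp add: C1_def lsc_map_def)
    then obtain T where T: "openin (sigma_P2 \<gamma> xo) T"
        "{\<pi> \<in> topspace (subtopology (sigma_P2 \<gamma> xo) ?fib). ?b < I_cost \<gamma> xo c \<pi>} = T \<inter> ?fib"
      by (auto simp: openin_subtopology)
    have top: "topspace (subtopology (sigma_P2 \<gamma> xo) ?fib) = ?fib"
      by (auto simp: sigma_P2_def topspace_sigma_topology P_gamma2_def)
    have inT: "\<pi> \<in> T \<longleftrightarrow> ?b < I_cost \<gamma> xo c \<pi>" if "\<pi> \<in> ?fib" for \<pi>
      using T(2) that unfolding top by blast
    have "?b < (\<integral>\<^sup>+x\<in>K n. c x (q x) \<partial>\<mu>)" using neg by (simp add: not_le)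
    also have "\<dots> \<le> (\<integral>\<^sup>+x\<in>K n. c x (q x) \<partial>\<mu>) + \<rho> n" by (rule add_increasing2) auto
    finally have "?s q \<in> T" using inT[OF pk(4)[OF q]] pk(5)[OF q] by simp
    have ev': "\<forall>\<^sub>F p in F. p \<in> P_gamma_kernels \<gamma> xo \<and> \<mu> \<bind> p \<in> P_gamma \<gamma> xo"
      using ev by eventually_elim simp
    have "\<forall>\<^sub>F p in F. ?s p \<in> T"
    proof (rule eventually_sigma_topology[OF T(1)[unfolded sigma_P2_def] \<open>?s q \<in> T\<close>])
      show "\<forall>\<^sub>F p in F. ?s p \<in> P_weight (weight2 \<gamma> xo)" using ev' by eventually_elim (use pk(3) in blast)
      show "((\<lambda>p. \<integral>z. f z \<partial>?s p) \<longlongrightarrow> (\<integral>z. f z \<partial>?s q)) F" if "f \<in> Phi_weight (weight2 \<gamma> xo)" for f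
        by (rule patch_tendsto[OF lim \<mu> ev' q r(1,2) Phi K(1) K(3) K(4) that])
    qed
    with ev have "\<forall>\<^sub>F p in F. False"
    proof eventually_elim
      case (elim p)
      then have p: "p \<in> P_gamma_kernels \<gamma> xo" "\<mu> \<bind> p \<in> P_gamma \<gamma> xo" by auto
      have "?b < (\<integral>\<^sup>+x\<in>K n. c x (p x) \<partial>\<mu>) + \<rho> n" using elim inT[OF pk(4)[OF p]] pk(5)[OF p] by simp
      moreover have "(\<integral>\<^sup>+x\<in>K n. c x (p x) \<partial>\<mu>) \<le> (\<integral>\<^sup>+x. c x (p x) \<partial>\<mu>)"
        by (intro nn_integral_mono) (auto split: split_indicator)
      ultimately show False using elim by (meson add_right_mono leD order_trans)
    qed
    then show False using nontrivial by (simp add: eventually_False)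
  qed
  have \<rho>: "\<rho> \<longlonglongrightarrow> 0"
  proof -
    have "(\<lambda>n. \<integral>\<^sup>+x. c x (r x) * indicator (- K n) x \<partial>\<mu>) \<longlonglongrightarrow> (\<integral>\<^sup>+x. 0 \<partial>\<mu>)"
    proof (rule nn_integral_dominated_convergence[where w="\<lambda>x. c x (r x)"])
      show "AE x in \<mu>. (\<lambda>n. c x (r x) * indicator (- K n) x) \<longlonglongrightarrow> 0"
        using K(5)
      proof eventually_elim
        case (elim x)
        then obtain n0 where "x \<in> K n0" by auto
        then have "x \<in> K n" if "n0 \<le> n" for n using K(2) that by (auto simp: incseq_def)
        then have "\<forall>\<^sub>F n in sequentially. c x (r x) * indicator (- K n) x = 0"
          by (intro eventually_sequentiallyI[of n0]) (auto split: split_indicator)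
        then show ?case by (rule tendsto_eventually)
      qed
      show "(\<integral>\<^sup>+x. c x (r x) \<partial>\<mu>) < \<infinity>" using r(3) by (auto intro: le_less_trans)
      show "(\<lambda>x. c x (r x) * indicator (- K n) x) \<in> borel_measurable \<mu>" for n
        using Km by (intro borel_measurable_times_ennreal) auto
    qed (auto split: split_indicator)
    then show ?thesis by (simp add: \<rho>_def[abs_def])
  qed
  have ind_mono: "indicator (K m) x \<le> (indicator (K n) x :: ennreal)" if "m \<le> n" for m n x
    using incseqD[OF K(2) that] by (auto split: split_indicator)
  have mono: "(\<lambda>n. \<integral>\<^sup>+x\<in>K n. c x (q x) \<partial>\<mu>) \<longlonglongrightarrow> (SUP n. \<integral>\<^sup>+x\<in>K n. c x (q x) \<partial>\<mu>)"
    by (intro LIMSEQ_SUP) (auto simp: incseq_def intro!: nn_integral_mono mult_left_mono ind_mono)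
  have "(\<integral>\<^sup>+x. c x (q x) \<partial>\<mu>) = (\<integral>\<^sup>+x. (SUP n. c x (q x) * indicator (K n) x) \<partial>\<mu>)"
  proof (rule nn_integral_cong_AE)
    show "AE x in \<mu>. c x (q x) = (SUP n. c x (q x) * indicator (K n) x)"
      using K(5)
    proof eventually_elim
      case (elim x)
      then obtain n where "x \<in> K n" by auto
      then show ?case by (intro antisym SUP_upper2[of n] SUP_least) (auto split: split_indicator)
    qed
  qed
  also have "\<dots> = (SUP n. \<integral>\<^sup>+x\<in>K n. c x (q x) \<partial>\<mu>)"
    by (intro nn_integral_monotone_convergence_SUP)
      (auto simp: incseq_def le_fun_def intro!: mult_left_mono ind_mono)
  also have "\<dots> \<le> ennreal \<alpha> + 0"
    by (rule LIMSEQ_le[OF mono tendsto_add[OF tendsto_const \<rho>]]) (use bound in auto)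
  finally show ?thesis by simp
qed

text \<open>This is lower semicontinuity at \<nu>, in the form that exhibits the finitely many test
  functions and the radius used for separation. If no such neighbourhood existed, the kernels
  violating the bound would form a filter base along which the second marginals tend to \<nu>, and a
  limit kernel would transport \<mu> to \<nu> at cost at most \<alpha>.\<close>

theorem T_cost_lsc:
  assumes C1: "C1 \<gamma> xo c" and \<mu>: "\<mu> \<in> P_gamma \<gamma> xo" and \<nu>: "\<nu> \<in> P_gamma \<gamma> xo"
    and \<alpha>: "ennreal \<alpha> < T_cost \<gamma> xo c \<nu> \<mu>"
  shows "\<exists>\<Psi> \<epsilon>. finite \<Psi> \<and> \<Psi> \<subseteq> Phi_weight w \<and> 0 < \<epsilon> \<and>
    (\<forall>p\<in>P_gamma_kernels \<gamma> xo. \<mu> \<bind> p \<in> P_gamma \<gamma> xo \<longrightarrow>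
      (\<forall>\<psi>\<in>\<Psi>. \<bar>(\<integral>y. \<psi> y \<partial>(\<mu> \<bind> p)) - (\<integral>y. \<psi> y \<partial>\<nu>)\<bar> < \<epsilon>) \<longrightarrow> ennreal \<alpha> \<le> (\<integral>\<^sup>+x. c x (p x) \<partial>\<mu>))"
    (is ?goal)
proof (rule ccontr)
  assume neg: "\<not> ?goal"
  define I where "I = {\<Psi>. finite \<Psi> \<and> \<Psi> \<subseteq> Phi_weight w} \<times> {\<epsilon>::real. 0 < \<epsilon>}"
  define D where "D i = {p \<in> P_gamma_kernels \<gamma> xo. \<mu> \<bind> p \<in> P_gamma \<gamma> xo \<and>
      (\<forall>\<psi>\<in>fst i. \<bar>(\<integral>y. \<psi> y \<partial>(\<mu> \<bind> p)) - (\<integral>y. \<psi> y \<partial>\<nu>)\<bar> < snd i) \<and> (\<integral>\<^sup>+x. c x (p x) \<partial>\<mu>) < ennreal \<alpha>}"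
    for i :: "('a \<Rightarrow> real) set \<times> real"
  have Dne: "D i \<noteq> {}" if "i \<in> I" for i
  proof
    assume e: "D i = {}"
    have fin: "finite (fst i)" "fst i \<subseteq> Phi_weight w" "0 < snd i" using that by (auto simp: I_def)
    have "ennreal \<alpha> \<le> (\<integral>\<^sup>+x. c x (p x) \<partial>\<mu>)"
      if "p \<in> P_gamma_kernels \<gamma> xo" "\<mu> \<bind> p \<in> P_gamma \<gamma> xo"
        "\<forall>\<psi>\<in>fst i. \<bar>(\<integral>y. \<psi> y \<partial>(\<mu> \<bind> p)) - (\<integral>y. \<psi> y \<partial>\<nu>)\<bar> < snd i" for p
    proof (rule ccontr)
      assume "\<not> ennreal \<alpha> \<le> (\<integral>\<^sup>+x. c x (p x) \<partial>\<mu>)"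
      then have "p \<in> D i" unfolding D_def using that by (simp add: not_le)
      then show False using e by simp
    qed
    with fin have ?goal by (intro exI[of _ "fst i"] exI[of _ "snd i"] conjI ballI impI)
    with neg show False by contradiction
  qed
  define F where "F = (INF i\<in>I. principal (D i))"
  have i0: "({}, 1) \<in> I" by (simp add: I_def)
  have ev_F: "eventually P F \<longleftrightarrow> (\<exists>i\<in>I. \<forall>p\<in>D i. P p)" for P
    unfolding F_def
  proof (subst eventually_INF_base)
    show "I \<noteq> {}" using i0 by auto
    fix a b assume ab: "a \<in> I" "b \<in> I"
    have "(fst a \<union> fst b, min (snd a) (snd b)) \<in> I" using ab by (auto simp: I_def)
    moreover have "D (fst a \<union> fst b, min (snd a) (snd b)) \<subseteq> D a \<inter> D b" by (auto simp: D_def)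
    ultimately show "\<exists>x\<in>I. principal (D x) \<le> inf (principal (D a)) (principal (D b))"
      by (intro bexI[of _ "(fst a \<union> fst b, min (snd a) (snd b))"]) auto
  qed (simp add: eventually_principal)
  have Fne: "F \<noteq> bot"
    unfolding trivial_limit_def ev_F using Dne by fastforce
  have ev: "\<forall>\<^sub>F p in F. p \<in> P_gamma_kernels \<gamma> xo \<and> \<mu> \<bind> p \<in> P_gamma \<gamma> xo \<and> (\<integral>\<^sup>+x. c x (p x) \<partial>\<mu>) < ennreal \<alpha>"
    unfolding ev_F using i0 by (intro bexI[of _ "({}, 1)"]) (auto simp: D_def)
  have Phi: "((\<lambda>p. \<integral>y. \<psi> y \<partial>(\<mu> \<bind> p)) \<longlongrightarrow> (\<integral>y. \<psi> y \<partial>\<nu>)) F" if "\<psi> \<in> Phi_weight w" for \<psi>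
  proof (rule tendstoI)
    fix e :: real assume "0 < e"
    then show "\<forall>\<^sub>F p in F. dist (\<integral>y. \<psi> y \<partial>(\<mu> \<bind> p)) (\<integral>y. \<psi> y \<partial>\<nu>) < e"
      unfolding ev_F using that by (intro bexI[of _ "({\<psi>}, e)"]) (auto simp: D_def I_def dist_real_def)
  qed
  have kernels: "\<forall>\<^sub>F p in F. prob_kernel \<mu> p"
    using ev by eventually_elim (use prob_kernelI[OF \<mu>] in blast)
  \<comment> \<open>No compactness enters: a closed \<open>C n\<close> of small \<nu>-mass lies
    under one bounded test function of small \<nu>-integral, and the integrals of that function
    converge along \<open>F\<close>.\<close>
  have tight: "\<exists>n. \<forall>\<^sub>F p in F. measure (\<mu> \<bind> p) (C n) \<le> e"
    if C: "\<And>n::nat. closed (C n)" "decseq C" "(\<Inter>n. C n) = {}" and e: "0 < e" for C and e :: real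
  proof -
    note N = P_gammaD[OF \<nu>]
    interpret N: prob_space \<nu> by (rule N)
    have "(\<lambda>n. measure \<nu> (C n)) \<longlonglongrightarrow> measure \<nu> (\<Inter>n. C n)"
      using C N(1) by (intro N.finite_Lim_measure_decseq) auto
    then have "(\<lambda>n. measure \<nu> (C n)) \<longlonglongrightarrow> 0" using C(3) by simp
    then have "\<forall>\<^sub>F n in sequentially. measure \<nu> (C n) < e" using e by (rule order_tendstoD)
    then obtain n where n: "measure \<nu> (C n) < e" using eventually_happens'[OF sequentially_bot] by blast
    obtain \<psi> where \<psi>: "continuous_on UNIV \<psi>" "\<And>y. 0 \<le> \<psi> y" "\<And>y. \<psi> y \<le> 1" "\<And>y. y \<in> C n \<Longrightarrow> \<psi> y = 1"
      "(\<integral>y. \<psi> y \<partial>\<nu>) < e"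
      using closed_approx[OF N(1) N(3) C(1) n] by blast
    note \<psi>P = bounded_in_Phi[OF \<psi>(1-3)]
    have "\<forall>\<^sub>F p in F. (\<integral>y. \<psi> y \<partial>(\<mu> \<bind> p)) < e" using Phi[OF \<psi>P] \<psi>(5) by (rule order_tendstoD)
    with ev have "\<forall>\<^sub>F p in F. measure (\<mu> \<bind> p) (C n) \<le> e"
    proof eventually_elim
      case (elim p)
      then have pn: "\<mu> \<bind> p \<in> P_gamma \<gamma> xo" by simp
      note P = P_gammaD[OF pn]
      interpret P: prob_space "\<mu> \<bind> p" by (rule P)
      have Cm: "C n \<in> sets (\<mu> \<bind> p)" using C(1) P(1) by simp
      have "measure (\<mu> \<bind> p) (C n) \<le> (\<integral>y. \<psi> y \<partial>(\<mu> \<bind> p))"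
        by (rule measure_le_integral[OF P.finite_measure_axioms Cm integrable_Phi[OF \<psi>P pn] \<psi>(2,4)])
      then show ?case using elim by simp
    qed
    then show ?thesis by blast
  qed
  obtain F' q' where F': "F' \<le> F" and lim': "kernel_limit F' \<mu> (\<lambda>p. p) q'"
    using ex_limit_kernel[OF Fne kernels tight] by blast
  interpret L': kernel_limit F' \<mu> "\<lambda>p. p" q' by (rule lim')
  have Phi': "((\<lambda>p. \<integral>y. \<psi> y \<partial>(\<mu> \<bind> p)) \<longlongrightarrow> (\<integral>y. \<psi> y \<partial>\<nu>)) F'" if "\<psi> \<in> Phi_weight w" for \<psi>
    using Phi[OF that] F' by (rule tendsto_mono[rotated])
  have q'\<nu>: "\<mu> \<bind> q' = \<nu>"
    by (rule kernel_limit_second_marginal[OF lim' P_gammaD(1)[OF \<nu>] P_gammaD(3)[OF \<nu>]])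
      (intro Phi' bounded_in_Phi)
  \<comment> \<open>Since \<nu> has a finite moment, so have almost all \<open>q' x\<close>. Passing
    to a version leaves the semidirect product, and with it the convergence, unchanged.\<close>
  obtain q where q: "q \<in> P_gamma_kernels \<gamma> xo" "AE x in \<mu>. q x = q' x"
    using ex_kernel_version[OF L'.limit AE_kernel_in_P_gamma[OF L'.limit]] q'\<nu> \<nu> by blast
  have qk: "prob_kernel \<mu> q" by (rule prob_kernelI[OF \<mu> q(1)])
  have sq: "semidirect \<mu> q = semidirect \<mu> q'" by (rule semidirect_cong_AE[OF qk L'.limit q(2)])
  have q\<nu>: "\<mu> \<bind> q = \<nu>"
    unfolding prob_kernel.distr_snd_semidirect[OF qk, symmetric] sq L'.L.distr_snd_semidirect q'\<nu> ..
  have lim: "kernel_limit F' \<mu> (\<lambda>p. p) q"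
    using lim' qk unfolding kernel_limit_def sq by blast
  have "\<forall>\<^sub>F p in F'. p \<in> P_gamma_kernels \<gamma> xo \<and> \<mu> \<bind> p \<in> P_gamma \<gamma> xo \<and> (\<integral>\<^sup>+x. c x (p x) \<partial>\<mu>) \<le> ennreal \<alpha>"
    using filter_leD[OF F' ev] by eventually_elim auto
  then have "(\<integral>\<^sup>+x. c x (q x) \<partial>\<mu>) \<le> ennreal \<alpha>"
    by (rule lsc_along_limit[OF C1 \<mu> lim]) (use q(1) q\<nu> \<nu> Phi' in auto)
  moreover have "T_cost \<gamma> xo c \<nu> \<mu> \<le> (\<integral>\<^sup>+x. c x (q x) \<partial>\<mu>)"
    unfolding T_cost_eq[OF \<mu> \<nu>] using q(1) q\<nu> by (intro INF_lower) auto
  ultimately show False using \<alpha> by simp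
qed

end

section \<open>Duality\<close>

text \<open>The truncated subtractions \<open>f x - ennreal B\<close> and
  \<open>ennreal B - f x\<close> are the positive and negative parts of the shifted function. They
  satisfy \<open>?p x + ennreal B = f x + ?n x\<close>, and the negative part is at most
  \<open>B\<close>, so its integral is finite and may be subtracted even if that of \<open>f\<close>
  is infinite.\<close>

lemma ereal_integral_shift:
  assumes f [measurable]: "f \<in> borel_measurable M" and "prob_space M" and B: "0 \<le> B"
  shows "ereal_integral M (\<lambda>x. enn2ereal (f x) - ereal B) = enn2ereal (\<integral>\<^sup>+x. f x \<partial>M) - ereal B"
proof -
  interpret prob_space M by fact
  let ?p = "\<lambda>x. f x - ennreal B" and ?n = "\<lambda>x. ennreal B - f x"
  have p: "e2ennreal (enn2ereal (f x) - ereal B) = ?p x" for x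
    using B by (cases "f x") (auto simp: ennreal_minus e2ennreal_ereal enn2ereal_ennreal e2ennreal_infty)
  have n: "e2ennreal (- (enn2ereal (f x) - ereal B)) = ?n x" for x
    using B by (cases "f x") (auto simp: ennreal_minus e2ennreal_ereal enn2ereal_ennreal e2ennreal_neg)
  have "?p x + ennreal B = f x + ?n x" for x
  proof (cases "f x")
    case (real r)
    then show ?thesis using B
      by (cases "r \<le> B") (simp_all add: ennreal_minus ennreal_neg ennreal_plus[symmetric] del: ennreal_plus)
  qed simp
  then have "(\<integral>\<^sup>+x. ?p x + ennreal B \<partial>M) = (\<integral>\<^sup>+x. f x + ?n x \<partial>M)" by simp
  then have eq: "(\<integral>\<^sup>+x. ?p x \<partial>M) + ennreal B = (\<integral>\<^sup>+x. f x \<partial>M) + (\<integral>\<^sup>+x. ?n x \<partial>M)"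
    by (simp add: nn_integral_add emeasure_space_1)
  have "(\<integral>\<^sup>+x. ?n x \<partial>M) \<le> (\<integral>\<^sup>+x. ennreal B \<partial>M)"
    by (intro nn_integral_mono) (simp add: diff_le_self_ennreal)
  also have "\<dots> < \<infinity>" by (simp add: emeasure_space_1)
  finally obtain c where c: "0 \<le> c" "(\<integral>\<^sup>+x. ?n x \<partial>M) = ennreal c"
    by (cases "\<integral>\<^sup>+x. ?n x \<partial>M") auto
  show ?thesis
    unfolding ereal_integral_def p n c(2)
    using eq c B unfolding c(2)
    by (cases "\<integral>\<^sup>+x. ?p x \<partial>M"; cases "\<integral>\<^sup>+x. f x \<partial>M")
      (auto simp: enn2ereal_ennreal ennreal_plus[symmetric] simp del: ennreal_plus)
qed

context weighted_cost
begin

text \<open>With \<open>- B \<le> \<phi>\<close>, everything is moved into the extended nonnegative reals.\<close>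

definition shifted_cost :: "('a \<Rightarrow> real) \<Rightarrow> real \<Rightarrow> 'a \<Rightarrow> 'a measure \<Rightarrow> ennreal" where
  "shifted_cost \<phi> B x p = (\<integral>\<^sup>+y. ennreal (\<phi> y + B) \<partial>p) + c x p"

definition shifted_R :: "('a \<Rightarrow> real) \<Rightarrow> real \<Rightarrow> 'a \<Rightarrow> ennreal" where
  "shifted_R \<phi> B x = (INF p\<in>P_gamma \<gamma> xo. shifted_cost \<phi> B x p)"

text \<open>The form in which the alternatives for (C3) enter the duality proof: countably many
  admissible kernels that approach the infimum at every point. It yields both the measurability of
  \<open>shifted_R\<close> and nearly optimal kernels.\<close>

definition selectable :: "('a \<Rightarrow> real) \<Rightarrow> real \<Rightarrow> bool" where
  "selectable \<phi> B \<longleftrightarrow> (\<exists>\<kappa> :: nat \<Rightarrow> 'a \<Rightarrow> 'a measure. (\<forall>n. \<kappa> n \<in> P_gamma_kernels \<gamma> xo) \<and>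
    (\<forall>x. shifted_R \<phi> B x = (INF n. shifted_cost \<phi> B x (\<kappa> n x))))"

lemma nn_integral_shift:
  assumes \<phi>: "\<phi> \<in> Phi_weight w" "\<And>y. - B \<le> \<phi> y" and p: "p \<in> P_gamma \<gamma> xo"
  shows "(\<integral>\<^sup>+y. ennreal (\<phi> y + B) \<partial>p) = ennreal ((\<integral>y. \<phi> y \<partial>p) + B)" "0 \<le> (\<integral>y. \<phi> y \<partial>p) + B"
proof -
  note P = P_gammaD[OF p]
  interpret prob_space p by (rule P)
  have i: "integrable p \<phi>" by (rule integrable_Phi[OF \<phi>(1) p])
  then have "integrable p (\<lambda>y. \<phi> y + B)" by simp
  moreover have nn: "0 \<le> \<phi> y + B" for y using \<phi>(2)[of y] by linarith
  ultimately have "(\<integral>\<^sup>+y. ennreal (\<phi> y + B) \<partial>p) = ennreal (\<integral>y. \<phi> y + B \<partial>p)"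
    by (intro nn_integral_eq_integral) auto
  moreover have "(\<integral>y. \<phi> y + B \<partial>p) = (\<integral>y. \<phi> y \<partial>p) + B"
    using i prob_space by (simp add: P)
  moreover have "0 \<le> (\<integral>y. \<phi> y + B \<partial>p)" using nn by simp
  ultimately show "(\<integral>\<^sup>+y. ennreal (\<phi> y + B) \<partial>p) = ennreal ((\<integral>y. \<phi> y \<partial>p) + B)" "0 \<le> (\<integral>y. \<phi> y \<partial>p) + B"
    by simp_all
qed

lemma R_cost_eq:
  assumes \<phi>: "\<phi> \<in> Phi_weight w" "\<And>y. - B \<le> \<phi> y"
  shows "R_cost \<gamma> xo c \<phi> x = enn2ereal (shifted_R \<phi> B x) - ereal B"
proof -
  have eq: "ereal (\<integral>y. \<phi> y \<partial>p) + enn2ereal (c x p) = enn2ereal (shifted_cost \<phi> B x p) - ereal B"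
    if "p \<in> P_gamma \<gamma> xo" for p
    unfolding shifted_cost_def nn_integral_shift(1)[OF \<phi> that]
    using nn_integral_shift(2)[OF \<phi> that]
    by (cases "c x p") (auto simp: plus_ennreal.rep_eq enn2ereal_ennreal)
  have "R_cost \<gamma> xo c \<phi> x = (INF p\<in>P_gamma \<gamma> xo. enn2ereal (shifted_cost \<phi> B x p) - ereal B)"
    unfolding R_cost_def by (intro INF_cong) (use eq in auto)
  also have "\<dots> = (INF p\<in>P_gamma \<gamma> xo. enn2ereal (shifted_cost \<phi> B x p)) - ereal B"
  proof (rule antisym)
    show "(INF p\<in>P_gamma \<gamma> xo. enn2ereal (shifted_cost \<phi> B x p) - ereal B) \<le>
        (INF p\<in>P_gamma \<gamma> xo. enn2ereal (shifted_cost \<phi> B x p)) - ereal B"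
    proof (subst ereal_le_minus, simp, rule INF_greatest)
      fix p assume "p \<in> P_gamma \<gamma> xo"
      then have "(INF p\<in>P_gamma \<gamma> xo. enn2ereal (shifted_cost \<phi> B x p) - ereal B) \<le> enn2ereal (shifted_cost \<phi> B x p) - ereal B"
        by (rule INF_lower)
      then show "(INF p\<in>P_gamma \<gamma> xo. enn2ereal (shifted_cost \<phi> B x p) - ereal B) + ereal B \<le> enn2ereal (shifted_cost \<phi> B x p)"
        by (simp add: ereal_le_minus)
    qed
    show "(INF p\<in>P_gamma \<gamma> xo. enn2ereal (shifted_cost \<phi> B x p)) - ereal B \<le>
        (INF p\<in>P_gamma \<gamma> xo. enn2ereal (shifted_cost \<phi> B x p) - ereal B)"
      by (intro INF_greatest ereal_minus_mono INF_lower) auto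
  qed
  also have "(INF p\<in>P_gamma \<gamma> xo. enn2ereal (shifted_cost \<phi> B x p)) = enn2ereal (shifted_R \<phi> B x)"
    unfolding shifted_R_def
  proof (rule antisym)
    show "enn2ereal (INF p\<in>P_gamma \<gamma> xo. shifted_cost \<phi> B x p) \<le> (INF p\<in>P_gamma \<gamma> xo. enn2ereal (shifted_cost \<phi> B x p))"
      by (intro INF_greatest) (auto simp: less_eq_ennreal.rep_eq[symmetric] intro: INF_lower)
    show "(INF p\<in>P_gamma \<gamma> xo. enn2ereal (shifted_cost \<phi> B x p)) \<le> enn2ereal (INF p\<in>P_gamma \<gamma> xo. shifted_cost \<phi> B x p)"
    proof -
      let ?I = "INF p\<in>P_gamma \<gamma> xo. enn2ereal (shifted_cost \<phi> B x p)"
      have "0 \<le> ?I" by (intro INF_greatest) simp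
      moreover have "e2ennreal ?I \<le> (INF p\<in>P_gamma \<gamma> xo. shifted_cost \<phi> B x p)"
      proof (rule INF_greatest)
        fix p assume "p \<in> P_gamma \<gamma> xo"
        then have "e2ennreal ?I \<le> e2ennreal (enn2ereal (shifted_cost \<phi> B x p))"
          by (intro e2ennreal_mono INF_lower)
        then show "e2ennreal ?I \<le> shifted_cost \<phi> B x p" by simp
      qed
      ultimately show ?thesis by (metis enn2ereal_e2ennreal less_eq_ennreal.rep_eq)
    qed
  qed
  finally show ?thesis .
qed

lemma shifted_cost_measurable:
  assumes \<phi>: "\<phi> \<in> Phi_weight w" and p: "p \<in> P_gamma_kernels \<gamma> xo"
  shows "(\<lambda>x. shifted_cost \<phi> B x (p x)) \<in> borel_measurable borel"
proof -
  have [measurable]: "\<phi> \<in> borel_measurable borel" by (rule PhiD(2)[OF \<phi>])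
  have "(\<lambda>x. \<integral>\<^sup>+y. ennreal (\<phi> y + B) \<partial>p x) \<in> borel_measurable borel"
    by (rule nn_integral_measurable_subprob_algebra2[OF _ measurable_prob_algebraD[OF kernelD(1)[OF p]]]) measurable
  then show ?thesis unfolding shifted_cost_def using cost_measurable[OF p] by (rule borel_measurable_add)
qed

lemma shifted_R_measurable:
  assumes "selectable \<phi> B" "\<phi> \<in> Phi_weight w"
  shows "shifted_R \<phi> B \<in> borel_measurable borel"
proof -
  obtain \<kappa> :: "nat \<Rightarrow> 'a \<Rightarrow> 'a measure" where \<kappa>: "\<And>n. \<kappa> n \<in> P_gamma_kernels \<gamma> xo"
    "\<And>x. shifted_R \<phi> B x = (INF n. shifted_cost \<phi> B x (\<kappa> n x))"
    using assms(1) by (auto simp: selectable_def)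
  have "(\<lambda>x. INF n. shifted_cost \<phi> B x (\<kappa> n x)) \<in> borel_measurable borel"
    using shifted_cost_measurable[OF assms(2) \<kappa>(1)] by (intro borel_measurable_INF) auto
  then show ?thesis using \<kappa>(2) by (simp cong: measurable_cong)
qed

lemma shifted_cost_integral:
  assumes \<phi>: "\<phi> \<in> Phi_weight w" "\<And>y. - B \<le> \<phi> y" and \<mu>: "\<mu> \<in> P_gamma \<gamma> xo"
    and p: "p \<in> P_gamma_kernels \<gamma> xo" "\<mu> \<bind> p \<in> P_gamma \<gamma> xo"
  shows "(\<integral>\<^sup>+x. shifted_cost \<phi> B x (p x) \<partial>\<mu>) = ennreal ((\<integral>y. \<phi> y \<partial>(\<mu> \<bind> p)) + B) + (\<integral>\<^sup>+x. c x (p x) \<partial>\<mu>)"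
proof -
  interpret prob_kernel \<mu> p using \<mu> p(1) by (rule prob_kernelI)
  have [measurable]: "\<phi> \<in> borel_measurable borel" by (rule PhiD(2)[OF \<phi>(1)])
  have m: "(\<lambda>x. \<integral>\<^sup>+y. ennreal (\<phi> y + B) \<partial>p x) \<in> borel_measurable \<mu>"
    by (rule nn_integral_measurable_subprob_algebra2[OF _ measurable_prob_algebraD[OF kernel_base]]) measurable
  have "(\<integral>\<^sup>+x. shifted_cost \<phi> B x (p x) \<partial>\<mu>) = (\<integral>\<^sup>+x. \<integral>\<^sup>+y. ennreal (\<phi> y + B) \<partial>p x \<partial>\<mu>) + (\<integral>\<^sup>+x. c x (p x) \<partial>\<mu>)"
    unfolding shifted_cost_def by (rule nn_integral_add[OF m cost_measurable_base[OF \<mu> p(1)]])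
  also have "(\<integral>\<^sup>+x. \<integral>\<^sup>+y. ennreal (\<phi> y + B) \<partial>p x \<partial>\<mu>) = (\<integral>\<^sup>+y. ennreal (\<phi> y + B) \<partial>(\<mu> \<bind> p))"
    by (rule nn_integral_bind_kernel[symmetric]) simp
  finally show ?thesis unfolding nn_integral_shift(1)[OF \<phi> p(2)] .
qed

text \<open>At each point the least index within \<open>\<eta>\<close> of the infimum is taken. It
  depends measurably on \<open>x\<close>, so following it through countably many kernels gives a
  kernel. The slack \<open>\<eta>\<close> is strict only where \<open>shifted_R\<close> is finite,
  which by \<open>fin\<close> is almost everywhere.\<close>

lemma ex_nearly_optimal_kernel:
  assumes sel: "selectable \<phi> B" and \<phi>: "\<phi> \<in> Phi_weight w" and \<mu>: "\<mu> \<in> P_gamma \<gamma> xo"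
    and fin: "(\<integral>\<^sup>+x. shifted_R \<phi> B x \<partial>\<mu>) < \<infinity>" and \<eta>: "0 < \<eta>"
  shows "\<exists>p\<in>P_gamma_kernels \<gamma> xo.
    (\<integral>\<^sup>+x. shifted_cost \<phi> B x (p x) \<partial>\<mu>) \<le> (\<integral>\<^sup>+x. shifted_R \<phi> B x \<partial>\<mu>) + ennreal \<eta>"
proof -
  note M = P_gammaD[OF \<mu>]
  interpret prob_space \<mu> by (rule M)
  note [measurable_cong] = M(1)
  obtain \<kappa> :: "nat \<Rightarrow> 'a \<Rightarrow> 'a measure" where \<kappa>: "\<And>n. \<kappa> n \<in> P_gamma_kernels \<gamma> xo"
    "\<And>x. shifted_R \<phi> B x = (INF n. shifted_cost \<phi> B x (\<kappa> n x))"
    using sel by (auto simp: selectable_def)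
  note [measurable] = shifted_cost_measurable[OF \<phi> \<kappa>(1)] shifted_R_measurable[OF sel \<phi>]
  define N where "N x = (LEAST n. shifted_cost \<phi> B x (\<kappa> n x) \<le> shifted_R \<phi> B x + ennreal \<eta>)" for x
  have Nm: "N \<in> borel \<rightarrow>\<^sub>M count_space UNIV" unfolding N_def by measurable
  have N: "shifted_cost \<phi> B x (\<kappa> (N x) x) \<le> shifted_R \<phi> B x + ennreal \<eta>" if "shifted_R \<phi> B x < \<infinity>" for x
  proof -
    have "(INF n. shifted_cost \<phi> B x (\<kappa> n x)) < shifted_R \<phi> B x + ennreal \<eta>"
      unfolding \<kappa>(2)[symmetric] using that \<eta> by (cases "shifted_R \<phi> B x") (auto simp: ennreal_plus[symmetric] ennreal_less_iff simp del: ennreal_plus)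
    then obtain n where "shifted_cost \<phi> B x (\<kappa> n x) < shifted_R \<phi> B x + ennreal \<eta>" by (auto simp: INF_less_iff)
    then have "shifted_cost \<phi> B x (\<kappa> n x) \<le> shifted_R \<phi> B x + ennreal \<eta>" by simp
    then show ?thesis unfolding N_def by (rule LeastI)
  qed
  define p where "p x = \<kappa> (N x) x" for x
  have "p \<in> borel \<rightarrow>\<^sub>M prob_algebra borel"
    unfolding p_def by (rule measurable_compose_countable[OF kernelD(1)[OF \<kappa>(1)] Nm])
  then have p: "p \<in> P_gamma_kernels \<gamma> xo" using kernelD(2)[OF \<kappa>(1)] by (auto simp: P_gamma_kernels_def p_def)
  have "AE x in \<mu>. shifted_R \<phi> B x \<noteq> \<infinity>" using fin by (intro nn_integral_noteq_infinite) auto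
  then have "(\<integral>\<^sup>+x. shifted_cost \<phi> B x (p x) \<partial>\<mu>) \<le> (\<integral>\<^sup>+x. shifted_R \<phi> B x + ennreal \<eta> \<partial>\<mu>)"
    by (intro nn_integral_mono_AE) (auto simp: p_def less_top elim!: eventually_mono intro!: N)
  also have "\<dots> = (\<integral>\<^sup>+x. shifted_R \<phi> B x \<partial>\<mu>) + ennreal \<eta>"
    by (subst nn_integral_add) (auto simp: emeasure_space_1)
  finally show ?thesis using p by blast
qed

lemma mixture_cost:
  assumes C2: "C2 \<gamma> xo c" and \<mu>: "\<mu> \<in> P_gamma \<gamma> xo" and t: "t \<in> {0..1}"
    and p: "p \<in> P_gamma_kernels \<gamma> xo" and q: "q \<in> P_gamma_kernels \<gamma> xo"
  shows "(\<integral>\<^sup>+x. c x (mixture t (p x) (q x)) \<partial>\<mu>) \<le>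
    ennreal (1 - t) * (\<integral>\<^sup>+x. c x (p x) \<partial>\<mu>) + ennreal t * (\<integral>\<^sup>+x. c x (q x) \<partial>\<mu>)"
proof -
  note [measurable] = cost_measurable_base[OF \<mu> p] cost_measurable_base[OF \<mu> q]
  have "(\<integral>\<^sup>+x. c x (mixture t (p x) (q x)) \<partial>\<mu>) \<le> (\<integral>\<^sup>+x. ennreal (1 - t) * c x (p x) + ennreal t * c x (q x) \<partial>\<mu>)"
    using C2 t kernelD(2)[OF p] kernelD(2)[OF q] by (intro nn_integral_mono) (auto simp: C2_def)
  also have "\<dots> = ennreal (1 - t) * (\<integral>\<^sup>+x. c x (p x) \<partial>\<mu>) + ennreal t * (\<integral>\<^sup>+x. c x (q x) \<partial>\<mu>)"
    by (simp add: nn_integral_add nn_integral_cmult)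
  finally show ?thesis .
qed

text \<open>Separation takes place among kernels of finite cost: (C2) makes the cost convex along
  mixtures, and (C4) makes the test functions integrable, so that the constraints are real-valued
  and affine. The multipliers become the coefficients of \<open>\<phi>\<close> as a combination of
  the functions in \<open>\<Psi>\<close>.\<close>

lemma ex_affine_minorant:
  assumes C1: "C1 \<gamma> xo c" and C2: "C2 \<gamma> xo c" and C4: "C4 \<gamma> xo c"
    and \<mu>: "\<mu> \<in> P_gamma \<gamma> xo" and \<nu>: "\<nu> \<in> P_gamma \<gamma> xo"
    and \<alpha>: "0 \<le> \<alpha>" "ennreal \<alpha> < T_cost \<gamma> xo c \<nu> \<mu>"
  shows "\<exists>\<phi>\<in>Phi_weight w. \<forall>p\<in>P_gamma_kernels \<gamma> xo. (\<integral>\<^sup>+x. c x (p x) \<partial>\<mu>) < \<infinity> \<longrightarrow>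
    \<alpha> + (\<integral>y. \<phi> y \<partial>\<nu>) \<le> (\<integral>y. \<phi> y \<partial>(\<mu> \<bind> p)) + enn2real (\<integral>\<^sup>+x. c x (p x) \<partial>\<mu>)"
proof -
  obtain \<Psi> \<epsilon> where \<Psi>: "finite \<Psi>" "\<Psi> \<subseteq> Phi_weight w" "0 < \<epsilon>"
    and near: "\<And>p. p \<in> P_gamma_kernels \<gamma> xo \<Longrightarrow> \<mu> \<bind> p \<in> P_gamma \<gamma> xo \<Longrightarrow>
      (\<forall>\<psi>\<in>\<Psi>. \<bar>(\<integral>y. \<psi> y \<partial>(\<mu> \<bind> p)) - (\<integral>y. \<psi> y \<partial>\<nu>)\<bar> < \<epsilon>) \<Longrightarrow> ennreal \<alpha> \<le> (\<integral>\<^sup>+x. c x (p x) \<partial>\<mu>)"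
    using T_cost_lsc[OF C1 \<mu> \<nu> \<alpha>(2)] by blast
  define D where "D = {p \<in> P_gamma_kernels \<gamma> xo. (\<integral>\<^sup>+x. c x (p x) \<partial>\<mu>) < \<infinity>}"
  define J where "J p = enn2real (\<integral>\<^sup>+x. c x (p x) \<partial>\<mu>)" for p
  define z where "z \<psi> p = (\<integral>y. \<psi> y \<partial>(\<mu> \<bind> p)) - (\<integral>y. \<psi> y \<partial>\<nu>)" for \<psi> :: "'a \<Rightarrow> real" and p
  have D: "p \<in> P_gamma_kernels \<gamma> xo" "\<mu> \<bind> p \<in> P_gamma \<gamma> xo" "(\<integral>\<^sup>+x. c x (p x) \<partial>\<mu>) = ennreal (J p)" "0 \<le> J p"
    if "p \<in> D" for p
    using that C4 \<mu> by (auto simp: D_def C4_def J_def)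
  have conv: "\<exists>r\<in>D. J r \<le> (1 - t) * J p + t * J q \<and> (\<forall>\<psi>\<in>\<Psi>. z \<psi> r = (1 - t) * z \<psi> p + t * z \<psi> q)"
    if pq: "p \<in> D" "q \<in> D" and t: "t \<in> {0..1}" for p q t
  proof -
    let ?r = "\<lambda>x. mixture t (p x) (q x)"
    note p = D[OF pq(1)] and q = D[OF pq(2)]
    have "(\<integral>\<^sup>+x. c x (?r x) \<partial>\<mu>) \<le> ennreal (1 - t) * ennreal (J p) + ennreal t * ennreal (J q)"
      using mixture_cost[OF C2 \<mu> t p(1) q(1)] unfolding p(3) q(3) .
    also have "\<dots> = ennreal ((1 - t) * J p + t * J q)"
      using t p(4) q(4) by (simp add: ennreal_mult ennreal_plus)
    finally have le: "(\<integral>\<^sup>+x. c x (?r x) \<partial>\<mu>) \<le> ennreal ((1 - t) * J p + t * J q)" .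
    have rD: "?r \<in> D" using le mixture_kernel[OF t p(1) q(1)] by (auto simp: D_def intro: le_less_trans)
    moreover have "J ?r \<le> (1 - t) * J p + t * J q"
      using le t p(4) q(4) unfolding D(3)[OF rD] by (subst (asm) ennreal_le_iff) auto
    moreover have "z \<psi> ?r = (1 - t) * z \<psi> p + t * z \<psi> q" if "\<psi> \<in> \<Psi>" for \<psi>
    proof -
      have \<psi>: "\<psi> \<in> Phi_weight w" using \<Psi>(2) that by auto
      note P = P_gammaD[OF p(2)] and Q = P_gammaD[OF q(2)]
      have "(\<integral>y. \<psi> y \<partial>(\<mu> \<bind> ?r)) = (1 - t) * (\<integral>y. \<psi> y \<partial>(\<mu> \<bind> p)) + t * (\<integral>y. \<psi> y \<partial>(\<mu> \<bind> q))"
        unfolding bind_mixture_kernel[OF t \<mu> p(1) q(1)]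
        by (rule integral_mixture[OF t P(1,3) Q(1,3) PhiD(2)[OF \<psi>] integrable_Phi[OF \<psi> p(2)] integrable_Phi[OF \<psi> q(2)]])
      then show ?thesis by (simp add: z_def algebra_simps)
    qed
    ultimately show ?thesis by blast
  qed
  \<comment> \<open>Either \<open>p\<close> satisfies all constraints up to \<open>\<epsilon>\<close>, or the penalty alone exceeds \<open>\<alpha>\<close>.\<close>
  have le: "\<alpha> \<le> J p + \<alpha> / \<epsilon> * (\<Sum>\<psi>\<in>\<Psi>. \<bar>z \<psi> p\<bar>)" if p: "p \<in> D" for p
  proof (cases "\<forall>\<psi>\<in>\<Psi>. \<bar>z \<psi> p\<bar> < \<epsilon>")
    case True
    then have "ennreal \<alpha> \<le> ennreal (J p)" using near[OF D(1,2)[OF p]] unfolding z_def D(3)[OF p] by blast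
    then have "\<alpha> \<le> J p" using D(4)[OF p] by simp
    moreover have "0 \<le> \<alpha> / \<epsilon> * (\<Sum>\<psi>\<in>\<Psi>. \<bar>z \<psi> p\<bar>)" using \<alpha>(1) \<Psi>(3) by (intro mult_nonneg_nonneg sum_nonneg) auto
    ultimately show ?thesis by linarith
  next
    case False
    then obtain \<psi> where \<psi>: "\<psi> \<in> \<Psi>" "\<epsilon> \<le> \<bar>z \<psi> p\<bar>" by (auto simp: not_less)
    have "\<bar>z \<psi> p\<bar> \<le> (\<Sum>\<psi>\<in>\<Psi>. \<bar>z \<psi> p\<bar>)" using \<Psi>(1) \<psi>(1) by (intro member_le_sum) auto
    then have "\<alpha> / \<epsilon> * \<epsilon> \<le> \<alpha> / \<epsilon> * (\<Sum>\<psi>\<in>\<Psi>. \<bar>z \<psi> p\<bar>)" using \<psi>(2) \<alpha>(1) \<Psi>(3) by (intro mult_left_mono) auto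
    then show ?thesis using D(4)[OF p] \<Psi>(3) by simp
  qed
  have "0 \<le> \<alpha> / \<epsilon>" using \<alpha>(1) \<Psi>(3) by simp
  from convex_separation[OF \<Psi>(1) this conv le] obtain a where a: "\<And>p. p \<in> D \<Longrightarrow> \<alpha> \<le> J p + (\<Sum>\<psi>\<in>\<Psi>. a \<psi> * z \<psi> p)"
    by blast
  define \<phi> where "\<phi> y = (\<Sum>\<psi>\<in>\<Psi>. a \<psi> * \<psi> y)" for y
  have \<phi>_int: "(\<integral>y. \<phi> y \<partial>p) = (\<Sum>\<psi>\<in>\<Psi>. a \<psi> * (\<integral>y. \<psi> y \<partial>p))" if "p \<in> P_gamma \<gamma> xo" for p
  proof -
    have "integrable p \<psi>" if "\<psi> \<in> \<Psi>" for \<psi> using integrable_Phi[OF _ \<open>p \<in> P_gamma \<gamma> xo\<close>] \<Psi>(2) that by blast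
    then show ?thesis unfolding \<phi>_def by (subst Bochner_Integration.integral_sum) auto
  qed
  have sub: "(\<lambda>y. \<Sum>\<psi>\<in>S. a \<psi> * \<psi> y) \<in> Phi_weight w" if "finite S" "S \<subseteq> Phi_weight w" for S
    using that
  proof induction
    case empty
    then show ?case by (auto simp: Phi_weight_def intro!: exI[of _ 0])
  next
    case (insert \<psi> S)
    obtain a1 b1 where 1: "0 \<le> a1" "0 \<le> b1" "\<And>y. \<bar>\<Sum>\<psi>\<in>S. a \<psi> * \<psi> y\<bar> \<le> a1 + b1 * w y"
      using PhiD(3)[of "\<lambda>y. \<Sum>\<psi>\<in>S. a \<psi> * \<psi> y"] insert by blast
    obtain a2 b2 where 2: "0 \<le> a2" "0 \<le> b2" "\<And>y. \<bar>\<psi> y\<bar> \<le> a2 + b2 * w y"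
      using PhiD(3)[of \<psi>] insert.prems by blast
    have "\<bar>a \<psi> * \<psi> y + (\<Sum>\<psi>\<in>S. a \<psi> * \<psi> y)\<bar> \<le> (\<bar>a \<psi>\<bar> * a2 + a1) + (\<bar>a \<psi>\<bar> * b2 + b1) * w y" for y
    proof -
      have "\<bar>a \<psi> * \<psi> y + (\<Sum>\<psi>\<in>S. a \<psi> * \<psi> y)\<bar> \<le> \<bar>a \<psi>\<bar> * \<bar>\<psi> y\<bar> + \<bar>\<Sum>\<psi>\<in>S. a \<psi> * \<psi> y\<bar>"
        unfolding abs_mult[symmetric] by (rule abs_triangle_ineq)
      also have "\<dots> \<le> \<bar>a \<psi>\<bar> * (a2 + b2 * w y) + (a1 + b1 * w y)"
        using 1(3)[of y] 2(3)[of y] by (intro add_mono mult_left_mono) auto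
      finally show ?thesis by (simp add: algebra_simps)
    qed
    moreover have "continuous_on UNIV (\<lambda>y. a \<psi> * \<psi> y + (\<Sum>\<psi>\<in>S. a \<psi> * \<psi> y))"
      using insert PhiD(1)[of \<psi>] PhiD(1)[of "\<lambda>y. \<Sum>\<psi>\<in>S. a \<psi> * \<psi> y"]
      by (intro continuous_on_add continuous_on_mult_left) auto
    ultimately show ?case
      using insert(1,2) 1(1,2) 2(1,2) unfolding Phi_weight_def mem_Collect_eq
      by (intro conjI exI[of _ "\<bar>a \<psi>\<bar> * a2 + a1"] exI[of _ "\<bar>a \<psi>\<bar> * b2 + b1"] allI) auto
  qed
  have "\<phi> \<in> Phi_weight w" unfolding \<phi>_def using sub[OF \<Psi>(1,2)] .
  moreover have "\<alpha> + (\<integral>y. \<phi> y \<partial>\<nu>) \<le> (\<integral>y. \<phi> y \<partial>(\<mu> \<bind> p)) + enn2real (\<integral>\<^sup>+x. c x (p x) \<partial>\<mu>)"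
    if "p \<in> P_gamma_kernels \<gamma> xo" "(\<integral>\<^sup>+x. c x (p x) \<partial>\<mu>) < \<infinity>" for p
  proof -
    have p: "p \<in> D" using that by (simp add: D_def)
    have "(\<Sum>\<psi>\<in>\<Psi>. a \<psi> * z \<psi> p) = (\<integral>y. \<phi> y \<partial>(\<mu> \<bind> p)) - (\<integral>y. \<phi> y \<partial>\<nu>)"
      unfolding \<phi>_int[OF D(2)[OF p]] \<phi>_int[OF \<nu>] z_def by (simp add: right_diff_distrib sum_subtractf)
    then show ?thesis using a[OF p] by (simp add: J_def)
  qed
  ultimately show ?thesis by blast
qed

text \<open>Dual functions have to be bounded from below. Truncation can only raise the integrals of
  \<open>\<phi>\<close>: this is harmless for the second marginals of competing kernels, and for
  \<nu> dominated convergence keeps the increase below \<open>\<delta>\<close>.\<close>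

lemma truncate_below:
  assumes \<phi>: "\<phi> \<in> Phi_weight w" and \<nu>: "\<nu> \<in> P_gamma \<gamma> xo" and \<delta>: "0 < \<delta>"
  shows "\<exists>k::nat. (\<lambda>y. max (\<phi> y) (- real k)) \<in> Phi_weight w \<and>
    (\<integral>y. max (\<phi> y) (- real k) \<partial>\<nu>) < (\<integral>y. \<phi> y \<partial>\<nu>) + \<delta>"
proof -
  have Phi: "(\<lambda>y. max (\<phi> y) (- real k)) \<in> Phi_weight w" for k
  proof -
    obtain a b where ab: "0 \<le> a" "0 \<le> b" "\<And>y. \<bar>\<phi> y\<bar> \<le> a + b * w y" using PhiD(3)[OF \<phi>] by blast
    have "\<bar>max (\<phi> y) (- real k)\<bar> \<le> (a + real k) + b * w y" for y using ab(3)[of y] by (auto simp: max_def)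
    moreover have "continuous_on UNIV (\<lambda>y. max (\<phi> y) (- real k))" using PhiD(1)[OF \<phi>] by (intro continuous_intros)
    ultimately show ?thesis using ab unfolding Phi_weight_def mem_Collect_eq
      by (intro conjI exI[of _ "a + real k"] exI[of _ b] allI) auto
  qed
  have i: "integrable \<nu> \<phi>" by (rule integrable_Phi[OF \<phi> \<nu>])
  have "(\<lambda>k. \<integral>y. max (\<phi> y) (- real k) \<partial>\<nu>) \<longlonglongrightarrow> (\<integral>y. \<phi> y \<partial>\<nu>)"
  proof (rule integral_dominated_convergence[where w="\<lambda>y. \<bar>\<phi> y\<bar>"])
    show "AE y in \<nu>. (\<lambda>k. max (\<phi> y) (- real k)) \<longlonglongrightarrow> \<phi> y"
    proof (rule AE_I2, rule tendsto_eventually)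
      fix y
      obtain k0 :: nat where k0: "- \<phi> y \<le> real k0" using real_arch_simple by blast
      show "\<forall>\<^sub>F k in sequentially. max (\<phi> y) (- real k) = \<phi> y"
      proof (rule eventually_sequentiallyI[of k0])
        fix k assume "k0 \<le> k"
        then have "real k0 \<le> real k" by simp
        with k0 show "max (\<phi> y) (- real k) = \<phi> y" by (simp add: max_def)
      qed
    qed
    show "AE y in \<nu>. norm (max (\<phi> y) (- real k)) \<le> \<bar>\<phi> y\<bar>" for k by (auto simp: max_def)
    show "integrable \<nu> (\<lambda>y. \<bar>\<phi> y\<bar>)" using i by simp
    show "\<phi> \<in> borel_measurable \<nu>" using i by simp
    show "(\<lambda>y. max (\<phi> y) (- real k)) \<in> borel_measurable \<nu>" for k using i by measurable
  qed
  then have "\<forall>\<^sub>F k in sequentially. (\<integral>y. max (\<phi> y) (- real k) \<partial>\<nu>) < (\<integral>y. \<phi> y \<partial>\<nu>) + \<delta>"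
    using \<delta> by (intro order_tendstoD) auto
  then obtain k where "(\<integral>y. max (\<phi> y) (- real k) \<partial>\<nu>) < (\<integral>y. \<phi> y \<partial>\<nu>) + \<delta>"
    using eventually_happens'[OF sequentially_bot] by blast
  with Phi show ?thesis by blast
qed

text \<open>Weak duality holds kernel by kernel. Conversely, the affine minorant speaks of
  integrated costs; a nearly optimal measurable selection compares these with the integral of
  \<open>shifted_R\<close>, in which the infimum is taken pointwise.\<close>

theorem duality:
  assumes C1: "C1 \<gamma> xo c" and C2: "C2 \<gamma> xo c" and C4: "C4 \<gamma> xo c"
    and sel: "\<And>\<phi> B. \<phi> \<in> Phi_weight w \<Longrightarrow> 0 \<le> B \<Longrightarrow> (\<And>y. - B \<le> \<phi> y) \<Longrightarrow> selectable \<phi> B"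
    and \<mu>: "\<mu> \<in> P_gamma \<gamma> xo" and \<nu>: "\<nu> \<in> P_gamma \<gamma> xo"
  shows "enn2ereal (T_cost \<gamma> xo c \<nu> \<mu>) =
    (SUP \<phi>\<in>Phi_gamma_b \<gamma> xo. ereal_integral \<mu> (R_cost \<gamma> xo c \<phi>) - ereal (\<integral>y. \<phi> y \<partial>\<nu>))"
    (is "?T = ?S")
proof (rule antisym)
  note M = P_gammaD[OF \<mu>]
  have int_R: "ereal_integral \<mu> (R_cost \<gamma> xo c \<phi>) = enn2ereal (\<integral>\<^sup>+x. shifted_R \<phi> B x \<partial>\<mu>) - ereal B"
    if \<phi>: "\<phi> \<in> Phi_weight w" "\<And>y. - B \<le> \<phi> y" and B: "0 \<le> B" for \<phi> B
  proof -
    have m: "shifted_R \<phi> B \<in> borel_measurable \<mu>"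
      using shifted_R_measurable[OF sel[OF \<phi>(1) B \<phi>(2)] \<phi>(1)] measurable_cong_sets[OF M(1) refl] by blast
    have "R_cost \<gamma> xo c \<phi> = (\<lambda>x. enn2ereal (shifted_R \<phi> B x) - ereal B)"
      using R_cost_eq[OF \<phi>] by blast
    then show ?thesis using ereal_integral_shift[OF m M(3) B] by simp
  qed
  have in_Phi_b: "\<phi> \<in> Phi_gamma_b \<gamma> xo" if "\<phi> \<in> Phi_weight w" "\<And>y. - B \<le> \<phi> y" for \<phi> B
    using that unfolding Phi_gamma_b_def bdd_below_def by blast
  show "?S \<le> ?T"
  proof (rule SUP_least)
    fix \<phi> assume "\<phi> \<in> Phi_gamma_b \<gamma> xo"
    then obtain b where \<phi>: "\<phi> \<in> Phi_weight w" and b: "\<And>y. b \<le> \<phi> y"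
      by (auto simp: Phi_gamma_b_def bdd_below_def)
    define B where "B = \<bar>b\<bar>"
    have "- B \<le> \<phi> y" for y using b[of y] unfolding B_def by linarith
    then have B: "0 \<le> B" "\<And>y. - B \<le> \<phi> y" by (simp_all add: B_def)
    have "(\<integral>\<^sup>+x. shifted_R \<phi> B x \<partial>\<mu>) \<le> ennreal ((\<integral>y. \<phi> y \<partial>\<nu>) + B) + T_cost \<gamma> xo c \<nu> \<mu>"
    proof -
      have "(\<integral>\<^sup>+x. shifted_R \<phi> B x \<partial>\<mu>) - ennreal ((\<integral>y. \<phi> y \<partial>\<nu>) + B) \<le> T_cost \<gamma> xo c \<nu> \<mu>"
        \<comment> \<open>With the finite constant on the left, the infimum over kernels on the
          right can be handled one kernel at a time.\<close>
        unfolding T_cost_eq[OF \<mu> \<nu>]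
      proof (rule INF_greatest)
        fix p assume "p \<in> {p \<in> P_gamma_kernels \<gamma> xo. \<mu> \<bind> p = \<nu>}"
        then have p: "p \<in> P_gamma_kernels \<gamma> xo" "\<mu> \<bind> p = \<nu>" by auto
        have "(\<integral>\<^sup>+x. shifted_R \<phi> B x \<partial>\<mu>) \<le> (\<integral>\<^sup>+x. shifted_cost \<phi> B x (p x) \<partial>\<mu>)"
          unfolding shifted_R_def by (intro nn_integral_mono INF_lower kernelD(2)[OF p(1)])
        also have "\<dots> = ennreal ((\<integral>y. \<phi> y \<partial>\<nu>) + B) + (\<integral>\<^sup>+x. c x (p x) \<partial>\<mu>)"
          using shifted_cost_integral[OF \<phi> B(2) \<mu> p(1)] p(2) \<nu> by simp
        finally show "(\<integral>\<^sup>+x. shifted_R \<phi> B x \<partial>\<mu>) - ennreal ((\<integral>y. \<phi> y \<partial>\<nu>) + B) \<le> (\<integral>\<^sup>+x. c x (p x) \<partial>\<mu>)"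
          by (simp add: ennreal_minus_le_iff)
      qed
      then show ?thesis by (simp add: ennreal_minus_le_iff)
    qed
    then have "enn2ereal (\<integral>\<^sup>+x. shifted_R \<phi> B x \<partial>\<mu>) \<le> ereal ((\<integral>y. \<phi> y \<partial>\<nu>) + B) + ?T"
      using nn_integral_shift(2)[OF \<phi> B(2) \<nu>]
      by (simp add: less_eq_ennreal.rep_eq plus_ennreal.rep_eq enn2ereal_ennreal)
    then show "ereal_integral \<mu> (R_cost \<gamma> xo c \<phi>) - ereal (\<integral>y. \<phi> y \<partial>\<nu>) \<le> ?T"
      unfolding int_R[OF \<phi> B(2) B(1)]
      by (cases "enn2ereal (\<integral>\<^sup>+x. shifted_R \<phi> B x \<partial>\<mu>)"; cases ?T) auto
  qed
  \<comment> \<open>The zero function shows that the supremum is nonnegative. This settles the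
    levels \<open>y \<le> 0\<close>, so that only positive real levels remain to be reached.\<close>
  have S0: "0 \<le> ?S"
  proof -
    have z: "(\<lambda>_. 0) \<in> Phi_weight w" by (auto simp: Phi_weight_def intro!: exI[of _ 0])
    have zb: "(\<lambda>_. 0) \<in> Phi_gamma_b \<gamma> xo" by (rule in_Phi_b[OF z, of 0]) simp
    show ?thesis
    proof (rule SUP_upper2[OF zb])
      show "0 \<le> ereal_integral \<mu> (R_cost \<gamma> xo c (\<lambda>_. 0)) - ereal (\<integral>y. 0 \<partial>\<nu>)"
        unfolding int_R[OF z, of 0, simplified] by simp
    qed
  qed
  show "?T \<le> ?S"
  proof (rule dense_le)
    fix y assume y: "y < ?T"
    show "y \<le> ?S"
    proof (cases "y \<le> 0")
      case True
      then show ?thesis using S0 by (rule order_trans)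
    next
      case False
      with y obtain \<alpha> where \<alpha>: "y = ereal \<alpha>" "0 < \<alpha>" by (cases y) auto
      have "ennreal \<alpha> < T_cost \<gamma> xo c \<nu> \<mu>"
        using y \<alpha> by (simp add: less_ennreal.rep_eq enn2ereal_ennreal)
      then obtain \<phi> where \<phi>: "\<phi> \<in> Phi_weight w"
        and minor: "\<And>p. p \<in> P_gamma_kernels \<gamma> xo \<Longrightarrow> (\<integral>\<^sup>+x. c x (p x) \<partial>\<mu>) < \<infinity> \<Longrightarrow>
          \<alpha> + (\<integral>y. \<phi> y \<partial>\<nu>) \<le> (\<integral>y. \<phi> y \<partial>(\<mu> \<bind> p)) + enn2real (\<integral>\<^sup>+x. c x (p x) \<partial>\<mu>)"
        using ex_affine_minorant[OF C1 C2 C4 \<mu> \<nu>, of \<alpha>] \<alpha>(2) by auto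
      show ?thesis unfolding \<alpha>(1)
      proof (rule ereal_le_epsilon2)
        fix e :: real assume "0 < e"
        \<comment> \<open>One half pays for the truncation, the other for the nearly optimal
          kernel.\<close>
        then have e: "0 < e / 2" by simp
        obtain k :: nat where k: "(\<lambda>y. max (\<phi> y) (- real k)) \<in> Phi_weight w"
          "(\<integral>y. max (\<phi> y) (- real k) \<partial>\<nu>) < (\<integral>y. \<phi> y \<partial>\<nu>) + e / 2"
          using truncate_below[OF \<phi> \<nu> e] by blast
        let ?\<phi> = "\<lambda>y. max (\<phi> y) (- real k)" and ?B = "real k"
        have lb: "- ?B \<le> ?\<phi> y" for y by simp
        have B0: "0 \<le> ?B" by simp
        define I where "I = (\<integral>\<^sup>+x. shifted_R ?\<phi> ?B x \<partial>\<mu>)"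
        have "ereal \<alpha> \<le> enn2ereal I - ereal ?B - ereal (\<integral>y. ?\<phi> y \<partial>\<nu>) + ereal e"
        proof (cases "I = \<infinity>")
          case True
          then show ?thesis by simp
        next
          case False
          then have fin: "(\<integral>\<^sup>+x. shifted_R ?\<phi> ?B x \<partial>\<mu>) < \<infinity>" by (simp add: I_def less_top)
          obtain p where p: "p \<in> P_gamma_kernels \<gamma> xo"
            and le: "(\<integral>\<^sup>+x. shifted_cost ?\<phi> ?B x (p x) \<partial>\<mu>) \<le> I + ennreal (e / 2)"
            using ex_nearly_optimal_kernel[OF sel[OF k(1) B0 lb] k(1) \<mu> fin e] unfolding I_def by blast
          have "(\<integral>\<^sup>+x. c x (p x) \<partial>\<mu>) \<le> (\<integral>\<^sup>+x. shifted_cost ?\<phi> ?B x (p x) \<partial>\<mu>)"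
            unfolding shifted_cost_def by (intro nn_integral_mono) simp
          also have "\<dots> < \<infinity>" using le False by (auto simp: less_top[symmetric] top_unique)
          \<comment> \<open>The integral of the shifted \<open>?\<phi>\<close> is nonnegative, so
            finiteness of the shifted cost forces finiteness of the cost itself; now (C4) and the
            affine minorant apply to \<open>p\<close>.\<close>
          finally have Jfin: "(\<integral>\<^sup>+x. c x (p x) \<partial>\<mu>) < \<infinity>" .
          then have pP: "\<mu> \<bind> p \<in> P_gamma \<gamma> xo" using C4 \<mu> p by (auto simp: C4_def)
          obtain j where j: "0 \<le> j" "(\<integral>\<^sup>+x. c x (p x) \<partial>\<mu>) = ennreal j"
            using Jfin by (cases "\<integral>\<^sup>+x. c x (p x) \<partial>\<mu>") auto
          obtain i where i: "0 \<le> i" "I = ennreal i" using False by (cases I) auto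
          note nn = nn_integral_shift(2)[OF k(1) lb pP]
          have "ennreal ((\<integral>y. ?\<phi> y \<partial>(\<mu> \<bind> p)) + ?B) + ennreal j \<le> ennreal i + ennreal (e / 2)"
            using le unfolding shifted_cost_integral[OF k(1) lb \<mu> p pP] j(2) i(2) .
          then have "(\<integral>y. ?\<phi> y \<partial>(\<mu> \<bind> p)) + ?B + j \<le> i + e / 2"
            using nn j(1) i(1) e by (simp add: ennreal_plus[symmetric] del: ennreal_plus)
          moreover have "\<alpha> + (\<integral>y. \<phi> y \<partial>\<nu>) \<le> (\<integral>y. \<phi> y \<partial>(\<mu> \<bind> p)) + j"
            using minor[OF p Jfin] j by simp
          moreover have "(\<integral>y. \<phi> y \<partial>(\<mu> \<bind> p)) \<le> (\<integral>y. ?\<phi> y \<partial>(\<mu> \<bind> p))"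
            by (intro integral_mono integrable_Phi[OF \<phi> pP] integrable_Phi[OF k(1) pP]) simp
          ultimately have "\<alpha> \<le> i - ?B - (\<integral>y. ?\<phi> y \<partial>\<nu>) + e" using k(2) by linarith
          then show ?thesis using i by (simp add: enn2ereal_ennreal)
        qed
        also have "enn2ereal I - ereal ?B - ereal (\<integral>y. ?\<phi> y \<partial>\<nu>) \<le> ?S"
          using in_Phi_b[OF k(1) lb] int_R[OF k(1) lb B0]
          by (intro SUP_upper2[of ?\<phi>]) (auto simp: I_def)
        finally show "ereal \<alpha> \<le> ?S + ereal e" by (simp add: add_right_mono)
      qed
    qed
  qed
qed

end

section \<open>Selection of nearly optimal kernels\<close>

lemma (in weight) topspace_sigma_P: "topspace (sigma_P \<gamma> xo) = P_gamma \<gamma> xo"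
  by (simp add: sigma_P_def topspace_sigma_topology P_gamma_def)

context weighted_cost
begin

text \<open>With \<open>p\<close> fixed the shifted cost is continuous in \<open>x\<close>, so the
  sets where it is below a level \<open>r\<close> are open, and countably many \<open>p\<close>
  cover as much as all of them. Letting \<open>r\<close> run through a countable dense set gives one
  sequence of constant kernels.\<close>

lemma selectable_C3:
  assumes "C3 \<gamma> xo c"
  shows "selectable \<phi> B"
proof -
  have cont: "continuous_on UNIV (\<lambda>x. shifted_cost \<phi> B x p)" if p: "p \<in> P_gamma \<gamma> xo" for p
  proof -
    have "continuous_map euclidean (prod_topology euclidean (sigma_P \<gamma> xo)) (\<lambda>x. (x, p))"
      using p by (intro continuous_map_pairedI) (auto simp: topspace_sigma_P)
    from continuous_map_compose[OF this assms[unfolded C3_def]]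
    have "continuous_on UNIV (\<lambda>x. c x p)" by (simp add: comp_def)
    then show ?thesis unfolding shifted_cost_def by (intro continuous_on_add_ennreal continuous_on_const)
  qed
  obtain D :: "ennreal set" where D: "countable D" "\<And>X. open X \<Longrightarrow> X \<noteq> {} \<Longrightarrow> \<exists>d\<in>D. d \<in> X"
    using countable_dense_exists by metis
  have "\<exists>Q. countable Q \<and> Q \<subseteq> P_gamma \<gamma> xo \<and> (\<forall>x. shifted_R \<phi> B x < r \<longrightarrow> (\<exists>p\<in>Q. shifted_cost \<phi> B x p < r))" for r
  proof -
    define U where "U p = {x. shifted_cost \<phi> B x p < r}" for p
    have "open S" if "S \<in> U ` P_gamma \<gamma> xo" for S
      using that cont unfolding U_def by (auto intro!: open_Collect_less continuous_on_const)
    then obtain \<F> where F: "\<F> \<subseteq> U ` P_gamma \<gamma> xo" "countable \<F>" "\<Union>\<F> = \<Union>(U ` P_gamma \<gamma> xo)"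
      using Lindelof by metis
    obtain Q where Q: "countable Q" "Q \<subseteq> P_gamma \<gamma> xo" "\<F> = U ` Q"
      using countable_subset_image[of \<F> U "P_gamma \<gamma> xo"] F(1,2) by blast
    have "\<exists>p\<in>Q. shifted_cost \<phi> B x p < r" if lt: "shifted_R \<phi> B x < r" for x
    proof -
      obtain p where "p \<in> P_gamma \<gamma> xo" "shifted_cost \<phi> B x p < r"
        using lt unfolding shifted_R_def INF_less_iff by blast
      then have "x \<in> \<Union>(U ` P_gamma \<gamma> xo)" by (auto simp: U_def)
      then show ?thesis unfolding F(3)[symmetric] Q(3) by (auto simp: U_def)
    qed
    with Q show ?thesis by blast
  qed
  then obtain Q where Q: "\<And>r. countable (Q r)" "\<And>r. Q r \<subseteq> P_gamma \<gamma> xo"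
    "\<And>r x. shifted_R \<phi> B x < r \<Longrightarrow> \<exists>p\<in>Q r. shifted_cost \<phi> B x p < r"
    by metis
  \<comment> \<open>The Dirac mass keeps \<open>A\<close> nonempty, as its enumeration
    requires.\<close>
  define A where "A = insert (return borel xo) (\<Union>r\<in>D. Q r)"
  have A: "countable A" "A \<noteq> {}" "A \<subseteq> P_gamma \<gamma> xo"
    using D(1) Q(1,2) return_in_P_gamma unfolding A_def by (auto simp del: UN_simps)
  define q where "q = from_nat_into A"
  have q: "q n \<in> P_gamma \<gamma> xo" for n using from_nat_into[OF A(2)] A(3) by (auto simp: q_def)
  have "shifted_R \<phi> B x = (INF n. shifted_cost \<phi> B x (q n))" for x
  proof (rule antisym)
    show "shifted_R \<phi> B x \<le> (INF n. shifted_cost \<phi> B x (q n))"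
      unfolding shifted_R_def using q by (intro INF_greatest INF_lower)
    show "(INF n. shifted_cost \<phi> B x (q n)) \<le> shifted_R \<phi> B x"
    proof (rule ccontr)
      assume "\<not> ?thesis"
      then have lt: "shifted_R \<phi> B x < (INF n. shifted_cost \<phi> B x (q n))" by (simp add: not_le)
      then have "{shifted_R \<phi> B x<..<(INF n. shifted_cost \<phi> B x (q n))} \<noteq> {}" using dense by auto
      then obtain r where r: "r \<in> D" "shifted_R \<phi> B x < r" "r < (INF n. shifted_cost \<phi> B x (q n))"
        using D(2)[OF open_greaterThanLessThan] by auto
      obtain p where p: "p \<in> Q r" "shifted_cost \<phi> B x p < r" using Q(3)[OF r(2)] by blast
      then have "p \<in> A" using r(1) by (auto simp: A_def)
      then obtain n where "q n = p" using from_nat_into_surj[OF A(1)] by (auto simp: q_def)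
      then have "(INF n. shifted_cost \<phi> B x (q n)) \<le> shifted_cost \<phi> B x p" by (auto intro: INF_lower2)
      with p(2) r(3) show False by auto
    qed
  qed
  then show ?thesis unfolding selectable_def using const_kernel[OF q] by (intro exI[of _ "\<lambda>n _. q n"]) auto
qed

section \<open>The countable discrete case\<close>

lemma discrete_sets_borel:
  assumes "\<forall>x::'a. x isolated_in UNIV"
  shows "open (A :: 'a set)" "A \<in> sets borel"
proof -
  have "open {x}" for x :: 'a
    using assms unfolding isolated_in_def by (metis Int_UNIV_right)
  then have "open (\<Union>x\<in>A. {x})" by (intro open_UN) auto
  then show "open A" by simp
  then show "A \<in> sets borel" by simp
qed

lemma selectable_C3'':
  assumes "C3'' \<gamma> xo c"
  shows "selectable \<phi> B"
proof -
  have disc: "A \<in> sets borel" for A :: "'a set" using assms discrete_sets_borel by (auto simp: C3''_def)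
  have "\<exists>q :: nat \<Rightarrow> 'a measure. (\<forall>n. q n \<in> P_gamma \<gamma> xo) \<and> shifted_R \<phi> B x = (INF n. shifted_cost \<phi> B x (q n))" for x
  proof -
    have ne: "shifted_cost \<phi> B x ` P_gamma \<gamma> xo \<noteq> {}" using return_in_P_gamma by auto
    obtain f :: "nat \<Rightarrow> ennreal" where f: "range f \<subseteq> shifted_cost \<phi> B x ` P_gamma \<gamma> xo"
      "Inf (shifted_cost \<phi> B x ` P_gamma \<gamma> xo) = (INF n. f n)"
      using ennreal_Inf_countable_INF[OF ne] by blast
    then have "\<forall>n. \<exists>p\<in>P_gamma \<gamma> xo. f n = shifted_cost \<phi> B x p" by blast
    then obtain q where q: "\<And>n. q n \<in> P_gamma \<gamma> xo" "\<And>n. f n = shifted_cost \<phi> B x (q n)" by metis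
    show ?thesis using f(2) q unfolding shifted_R_def q(2) by blast
  qed
  then have "\<forall>x. \<exists>q :: nat \<Rightarrow> 'a measure. (\<forall>n. q n \<in> P_gamma \<gamma> xo) \<and> shifted_R \<phi> B x = (INF n. shifted_cost \<phi> B x (q n))"
    by (rule allI)
  from choice[OF this] obtain q where q': "\<forall>x. (\<forall>n :: nat. q x n \<in> P_gamma \<gamma> xo) \<and>
      shifted_R \<phi> B x = (INF n. shifted_cost \<phi> B x (q x n))" ..
  then have q: "q x n \<in> P_gamma \<gamma> xo" "shifted_R \<phi> B x = (INF n. shifted_cost \<phi> B x (q x n))" for x n
    by blast+
  have "(\<lambda>x. q x n) \<in> P_gamma_kernels \<gamma> xo" for n
  proof -
    have "(\<lambda>x. q x n) \<in> borel \<rightarrow>\<^sub>M prob_algebra borel"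
      using P_gammaD[OF q(1)] by (intro measurableI disc) (auto simp: space_prob_algebra)
    then show ?thesis using q(1) by (simp add: P_gamma_kernels_def)
  qed
  then show ?thesis unfolding selectable_def using q(2) by (intro exI[of _ "\<lambda>n x. q x n"] conjI allI)
qed

end

text \<open>Prepares a Fatou argument in terms of open sets: lying strictly below lower
  semicontinuous functions at finitely many points is an open condition. Strictness is asked only
  where \<open>t\<close> is nonzero, since \<open>f\<close> may vanish.\<close>

lemma ex_strict_finite_minorant:
  fixes f :: "'a::topological_space \<Rightarrow> ennreal"
  assumes cnt: "countable (UNIV :: 'a set)" and disc: "\<And>A :: 'a set. A \<in> sets \<mu>" and sp: "space \<mu> = UNIV"
    and a: "a < (\<integral>\<^sup>+x. f x \<partial>\<mu>)"
  shows "\<exists>t E. finite E \<and> (\<forall>x. x \<notin> E \<longrightarrow> t x = 0) \<and> (\<forall>x. t x \<noteq> 0 \<longrightarrow> t x < f x) \<and> a < (\<integral>\<^sup>+x. t x \<partial>\<mu>)"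
proof -
  have meas: "g \<in> borel_measurable \<mu>" for g :: "'a \<Rightarrow> ennreal" using disc sp by (intro measurableI) auto
  obtain D :: "ennreal set" where D: "countable D" "\<And>X. open X \<Longrightarrow> X \<noteq> {} \<Longrightarrow> \<exists>d\<in>D. d \<in> X"
    using countable_dense_exists by metis
  define d where "d = from_nat_into D"
  define e :: "nat \<Rightarrow> 'a" where "e = from_nat_into UNIV"
  \<comment> \<open>The largest value below \<open>f x\<close> among the first \<open>n + 1\<close>
    members of a dense sequence, or 0 if there is none; these increase to
    \<open>f x\<close>.\<close>
  define s where "s n x = Max ((\<lambda>j. if d j < f x then d j else 0) ` {..n::nat})" for n x
  define t where "t n x = s n x * indicator (e ` {..n}) x" for n :: nat and x
  have s_in: "s n x \<in> (\<lambda>j. if d j < f x then d j else 0) ` {..n}" for n x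
    unfolding s_def by (intro Max_in) auto
  have s_mono: "s n x \<le> s n' x" if "n \<le> n'" for n n' x
    unfolding s_def using that by (intro Max_mono image_mono) auto
  have ind: "indicator (e ` {..n}) x \<le> (indicator (e ` {..n'}) x :: ennreal)" if "n \<le> n'" for n n' x
    using that by (auto split: split_indicator)
  have t_mono: "t n x \<le> t n' x" if "n \<le> n'" for n n' x
    unfolding t_def using s_mono[OF that] ind[OF that] by (intro mult_mono) auto
  have strict: "t n x < f x" if "t n x \<noteq> 0" for n x
  proof -
    have "t n x = s n x" "s n x \<noteq> 0" using that by (auto simp: t_def split: split_indicator_asm)
    then show ?thesis using s_in[of n x] by (auto split: if_splits)
  qed
  have "(SUP n. t n x) = f x" for x
  proof (rule antisym)
    show "(SUP n. t n x) \<le> f x"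
    proof (rule SUP_least)
      fix n show "t n x \<le> f x" using strict[of n x] by (cases "t n x = 0") (auto intro: less_imp_le)
    qed
    show "f x \<le> (SUP n. t n x)"
    proof (rule ccontr)
      assume "\<not> ?thesis"
      then have lt: "(SUP n. t n x) < f x" by (simp add: not_le)
      then have "{(SUP n. t n x)<..<f x} \<noteq> {}" using dense by auto
      then obtain r where r: "r \<in> D" "(SUP n. t n x) < r" "r < f x"
        using D(2)[OF open_greaterThanLessThan] by auto
      obtain j where j: "d j = r" using from_nat_into_surj[OF D(1) r(1)] by (auto simp: d_def)
      obtain i where i: "e i = x" using from_nat_into_surj[OF cnt, of x] by (auto simp: e_def)
      have "r \<le> s (max i j) x"
        unfolding s_def using j r(3) by (intro Max_ge) (auto intro!: image_eqI[of _ _ j])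
      also have "\<dots> = t (max i j) x" using i by (auto simp: t_def indicator_def)
      also have "\<dots> \<le> (SUP n. t n x)" by (intro SUP_upper) auto
      finally show False using r(2) by simp
    qed
  qed
  then have "(\<integral>\<^sup>+x. f x \<partial>\<mu>) = (\<integral>\<^sup>+x. (SUP n. t n x) \<partial>\<mu>)" by simp
  also have "\<dots> = (SUP n. \<integral>\<^sup>+x. t n x \<partial>\<mu>)"
    using t_mono by (intro nn_integral_monotone_convergence_SUP meas) (auto simp: incseq_def le_fun_def)
  finally obtain n where "a < (\<integral>\<^sup>+x. t n x \<partial>\<mu>)" using a by (auto simp: less_SUP_iff)
  then show ?thesis using strict by (intro exI[of _ "t n"] exI[of _ "e ` {..n}"]) (auto simp: t_def)
qed

context weighted_cost
begin

lemma fibre_is_semidirect: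
  assumes \<mu>: "\<mu> \<in> P_gamma \<gamma> xo" and \<pi>: "\<pi> \<in> P_gamma2 \<gamma> xo" "distr \<pi> borel fst = \<mu>"
  shows "\<exists>p\<in>P_gamma_kernels \<gamma> xo. \<pi> = semidirect \<mu> p"
proof -
  have s: "sets \<pi> = sets borel" "prob_space \<pi>" and fin: "(\<integral>\<^sup>+z. ennreal (weight2 \<gamma> xo z) \<partial>\<pi>) < \<infinity>"
    using \<pi>(1) by (auto simp: P_gamma2_def P_weight_def)
  interpret prob_space \<pi> by (rule s)
  have sm: "snd \<in> \<pi> \<rightarrow>\<^sub>M borel"
    using s by (simp add: borel_measurable_continuous_onI continuous_on_snd cong: measurable_cong_sets)
  have "(\<integral>\<^sup>+y. ennreal (w y) \<partial>distr \<pi> borel snd) = (\<integral>\<^sup>+z. ennreal (w (snd z)) \<partial>\<pi>)"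
    by (rule nn_integral_distr[OF sm]) simp
  also have "\<dots> \<le> (\<integral>\<^sup>+z. ennreal (weight2 \<gamma> xo z) \<partial>\<pi>)"
  proof (intro nn_integral_mono ennreal_leI)
    show "w (snd z) \<le> weight2 \<gamma> xo z" for z by (cases z) (simp add: weight2_eq)
  qed
  finally have "distr \<pi> borel snd \<in> P_gamma \<gamma> xo"
    using fin prob_space_distr[OF sm] by (intro P_gammaI) (auto intro: le_less_trans)
  from coupling_is_semidirect[OF \<mu> this, of \<pi>] s \<pi>(2) show ?thesis by (auto simp: couplings_def)
qed

text \<open>At an atom of \<mu>, dividing by its mass expresses the integral of
  \<open>\<phi>\<close> against \<open>p x\<close> through an integral against the coupling. Hence
  \<open>p x\<close> depends continuously on the coupling there.\<close>

lemma integral_slice: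
  assumes \<mu>: "\<mu> \<in> P_gamma \<gamma> xo" and p: "p \<in> P_gamma_kernels \<gamma> xo" and \<phi>: "\<phi> \<in> Phi_weight w"
  shows "(\<integral>z. indicator {x} (fst z) * \<phi> (snd z) \<partial>semidirect \<mu> p) = measure \<mu> {x} * (\<integral>y. \<phi> y \<partial>p x)"
proof -
  interpret prob_kernel \<mu> p using \<mu> p by (rule prob_kernelI)
  interpret M: prob_space \<mu> by (rule prob_base)
  have [measurable]: "\<phi> \<in> borel_measurable borel" by (rule PhiD(2)[OF \<phi>])
  have ix: "integrable (p x) \<phi>" by (rule integrable_Phi[OF \<phi> kernelD(2)[OF p]])
  have fs: "fst \<in> borel \<rightarrow>\<^sub>M (borel :: 'a measure)" "snd \<in> borel \<rightarrow>\<^sub>M (borel :: 'a measure)"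
    by (auto intro!: borel_measurable_continuous_onI continuous_intros)
  have m: "(\<lambda>z. indicator {x} (fst z) * h (snd z)) \<in> borel_measurable borel"
    if [measurable]: "h \<in> borel_measurable borel" for h :: "'a \<Rightarrow> real"
    using fs by measurable
  have nn: "(\<integral>\<^sup>+z. ennreal (indicator {x} (fst z) * h (snd z)) \<partial>semidirect \<mu> p) =
      ennreal (measure \<mu> {x}) * (\<integral>\<^sup>+y. ennreal (h y) \<partial>p x)"
    if h: "h \<in> borel_measurable borel" for h :: "'a \<Rightarrow> real"
  proof -
    have "(\<integral>\<^sup>+z. ennreal (indicator {x} (fst z) * h (snd z)) \<partial>semidirect \<mu> p) =
        (\<integral>\<^sup>+x'. \<integral>\<^sup>+y. ennreal (indicator {x} x' * h y) \<partial>p x' \<partial>\<mu>)"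
      using m[OF h] by (subst nn_integral_semidirect) auto
    also have "\<dots> = (\<integral>\<^sup>+x'. (\<integral>\<^sup>+y. ennreal (h y) \<partial>p x) * indicator {x} x' \<partial>\<mu>)"
      by (intro nn_integral_cong) (auto split: split_indicator)
    also have "\<dots> = ennreal (measure \<mu> {x}) * (\<integral>\<^sup>+y. ennreal (h y) \<partial>p x)"
      by (subst nn_integral_cmult_indicator) (auto simp: M.emeasure_eq_measure mult.commute)
    finally show ?thesis .
  qed
  have fin: "(\<integral>\<^sup>+y. ennreal (\<phi> y) \<partial>p x) < \<infinity>" "(\<integral>\<^sup>+y. ennreal (- \<phi> y) \<partial>p x) < \<infinity>"
    using ix unfolding real_integrable_def by (auto simp: less_top)
  have nn1: "(\<integral>\<^sup>+z. ennreal (indicator {x} (fst z) * \<phi> (snd z)) \<partial>semidirect \<mu> p) =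
      ennreal (measure \<mu> {x}) * (\<integral>\<^sup>+y. ennreal (\<phi> y) \<partial>p x)"
    by (rule nn) simp
  have nn2: "(\<integral>\<^sup>+z. ennreal (- (indicator {x} (fst z) * \<phi> (snd z))) \<partial>semidirect \<mu> p) =
      ennreal (measure \<mu> {x}) * (\<integral>\<^sup>+y. ennreal (- \<phi> y) \<partial>p x)"
    using nn[of "\<lambda>y. - \<phi> y"] by simp
  have i: "integrable (semidirect \<mu> p) (\<lambda>z. indicator {x} (fst z) * \<phi> (snd z))"
    unfolding real_integrable_def nn1 nn2 using fin m[of \<phi>]
    by (auto simp: ennreal_mult_eq_top_iff less_top cong: measurable_cong_sets)
  show ?thesis
    unfolding real_lebesgue_integral_def[OF i] real_lebesgue_integral_def[OF ix] nn1 nn2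
    by (simp add: enn2real_mult algebra_simps)
qed

text \<open>The integrated cost is a countable sum over atoms. Each term is lower semicontinuous in
  the coupling because the conditional law at an atom depends continuously on it, and finitely many
  terms, each slightly lowered, already exceed any level below the sum.\<close>

lemma C3''_imp_C1:
  assumes C3'': "C3'' \<gamma> xo c"
  shows "C1 \<gamma> xo c"
  unfolding C1_def lsc_map_def
proof (intro ballI allI)
  fix \<mu> a assume \<mu>: "\<mu> \<in> P_gamma \<gamma> xo"
  let ?fib = "{\<pi> \<in> P_gamma2 \<gamma> xo. distr \<pi> borel fst = \<mu>}"
  let ?T = "subtopology (sigma_P2 \<gamma> xo) ?fib"
  have cnt: "countable (UNIV :: 'a set)" and iso: "\<forall>x::'a. x isolated_in UNIV"
    and lsc: "\<And>x. lsc_map (sigma_P \<gamma> xo) (c x)"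
    using C3'' by (auto simp: C3''_def)
  note disc = discrete_sets_borel[OF iso]
  note M = P_gammaD[OF \<mu>]
  interpret M: prob_space \<mu> by (rule M)
  have top: "topspace ?T = ?fib"
    by (auto simp: sigma_P2_def topspace_sigma_topology P_gamma2_def)
  define \<kappa> where "\<kappa> \<pi> = (SOME p. p \<in> P_gamma_kernels \<gamma> xo \<and> \<pi> = semidirect \<mu> p)" for \<pi>
  have \<kappa>: "\<kappa> \<pi> \<in> P_gamma_kernels \<gamma> xo" "\<pi> = semidirect \<mu> (\<kappa> \<pi>)" if "\<pi> \<in> ?fib" for \<pi>
    using someI_ex[of "\<lambda>p. p \<in> P_gamma_kernels \<gamma> xo \<and> \<pi> = semidirect \<mu> p"] fibre_is_semidirect[OF \<mu>, of \<pi>] that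
    unfolding \<kappa>_def by blast+
  have I: "I_cost \<gamma> xo c \<pi> = (\<integral>\<^sup>+x. c x (\<kappa> \<pi> x) \<partial>\<mu>)" if "\<pi> \<in> ?fib" for \<pi>
    using I_cost_semidirect[OF \<mu> \<kappa>(1)[OF that], of c] \<kappa>(2)[OF that] by simp
  have cont: "continuous_map ?T (sigma_P \<gamma> xo) (\<lambda>\<pi>. \<kappa> \<pi> x)" if pos: "measure \<mu> {x} \<noteq> 0" for x
    unfolding sigma_P_def sigma_topology_def
  proof (rule continuous_on_generated_topo)
    fix U assume "U \<in> {{\<mu> \<in> P_weight w. (\<integral>z. \<phi> z \<partial>\<mu>) \<in> U} | \<phi> U. \<phi> \<in> Phi_weight w \<and> open U}"
    then obtain \<phi> W where U: "U = {\<mu> \<in> P_weight w. (\<integral>z. \<phi> z \<partial>\<mu>) \<in> W}" "\<phi> \<in> Phi_weight w" "open W" by blast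
    \<comment> \<open>A test function on the product: the singleton is open and closed, so its
      indicator is continuous, and the division normalises the conditional law.\<close>
    define f where "f z = indicator {x} (fst z) * (\<phi> (snd z) / measure \<mu> {x})" for z :: "'a \<times> 'a"
    have "continuous_on UNIV (indicator {x} :: 'a \<Rightarrow> real)"
      unfolding continuous_on_def using disc(1) iso
      by (metis continuous_on_def continuous_on_eq_continuous_at continuous_on_open_vimage disc(1) open_UNIV)
    then have ci: "continuous_on UNIV (\<lambda>z :: 'a \<times> 'a. indicator {x} (fst z) :: real)"
      by (rule continuous_on_compose2) (auto intro: continuous_intros)
    have c\<phi>: "continuous_on UNIV (\<lambda>z :: 'a \<times> 'a. \<phi> (snd z))"
      by (rule continuous_on_compose2[OF PhiD(1)[OF U(2)]]) (auto intro: continuous_intros)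
    have fc: "continuous_on UNIV f"
      unfolding f_def using pos by (intro continuous_on_mult ci continuous_on_divide c\<phi> continuous_on_const) auto
    obtain a b where ab: "0 \<le> a" "0 \<le> b" "\<And>y. \<bar>\<phi> y\<bar> \<le> a + b * w y" using PhiD(3)[OF U(2)] by blast
    have "\<bar>f z\<bar> \<le> a / measure \<mu> {x} + b / measure \<mu> {x} * weight2 \<gamma> xo z" for z
    proof (cases z)
      case (Pair x' y)
      have m0: "0 < measure \<mu> {x}" using pos by (simp add: zero_less_measure_iff)
      have "\<bar>f z\<bar> \<le> \<bar>\<phi> y\<bar> / measure \<mu> {x}"
        using m0 by (auto simp: f_def Pair abs_mult split: split_indicator)
      also have "\<dots> \<le> (a + b * (w x' + w y)) / measure \<mu> {x}"
      proof (rule divide_right_mono)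
        have "b * w y \<le> b * (w x' + w y)" using ab(2) by (intro mult_left_mono) auto
        then show "\<bar>\<phi> y\<bar> \<le> a + b * (w x' + w y)" using ab(3)[of y] by linarith
      qed simp
      finally show ?thesis by (simp add: Pair weight2_eq add_divide_distrib)
    qed
    then have fPhi: "f \<in> Phi_weight (weight2 \<gamma> xo)"
      using fc ab(1,2) unfolding Phi_weight_def mem_Collect_eq
      by (intro conjI exI[of _ "a / measure \<mu> {x}"] exI[of _ "b / measure \<mu> {x}"] allI) auto
    have int_f: "(\<integral>z. f z \<partial>\<pi>) = (\<integral>y. \<phi> y \<partial>\<kappa> \<pi> x)" if \<pi>: "\<pi> \<in> ?fib" for \<pi>
    proof -
      have "(\<integral>z. f z \<partial>semidirect \<mu> (\<kappa> \<pi>)) =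
          (\<integral>z. indicator {x} (fst z) * \<phi> (snd z) \<partial>semidirect \<mu> (\<kappa> \<pi>)) / measure \<mu> {x}"
        unfolding f_def by simp
      then show ?thesis
        using integral_slice[OF \<mu> \<kappa>(1)[OF \<pi>] U(2), of x] \<kappa>(2)[OF \<pi>] pos by simp
    qed
    have "(\<lambda>\<pi>. \<kappa> \<pi> x) -` U \<inter> topspace ?T = {\<pi> \<in> P_weight (weight2 \<gamma> xo). (\<integral>z. f z \<partial>\<pi>) \<in> W} \<inter> ?fib"
      unfolding top U(1) using int_f kernelD(2)[OF \<kappa>(1)] by (auto simp: P_gamma_def P_gamma2_def)
    moreover have "openin (sigma_P2 \<gamma> xo) {\<pi> \<in> P_weight (weight2 \<gamma> xo). (\<integral>z. f z \<partial>\<pi>) \<in> W}"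
      unfolding sigma_P2_def sigma_topology_def using fPhi U(3) by (intro topology_generated_by_Basis) blast
    ultimately show "openin ?T ((\<lambda>\<pi>. \<kappa> \<pi> x) -` U \<inter> topspace ?T)"
      by (auto simp: openin_subtopology)
  next
    have "\<kappa> \<pi> x \<in> topspace (sigma_P \<gamma> xo)" if "\<pi> \<in> ?fib" for \<pi>
      unfolding topspace_sigma_P using kernelD(2)[OF \<kappa>(1)[OF that]] .
    then show "(\<lambda>\<pi>. \<kappa> \<pi> x) ` topspace ?T \<subseteq> \<Union>{{\<mu> \<in> P_weight w. (\<integral>z. \<phi> z \<partial>\<mu>) \<in> U} | \<phi> U. \<phi> \<in> Phi_weight w \<and> open U}"
      unfolding top sigma_P_def sigma_topology_def topology_generated_by_topspace by blast
  qed
  show "openin ?T {\<pi> \<in> topspace ?T. a < I_cost \<gamma> xo c \<pi>}"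
  proof (subst openin_subopen, intro ballI)
    fix \<pi>0 assume "\<pi>0 \<in> {\<pi> \<in> topspace ?T. a < I_cost \<gamma> xo c \<pi>}"
    then have \<pi>0: "\<pi>0 \<in> ?fib" "a < (\<integral>\<^sup>+x. c x (\<kappa> \<pi>0 x) \<partial>\<mu>)" using I unfolding top by auto
    obtain t E where t: "finite E" "\<And>x. x \<notin> E \<Longrightarrow> t x = 0" "\<And>x. t x \<noteq> 0 \<Longrightarrow> t x < c x (\<kappa> \<pi>0 x)"
      "a < (\<integral>\<^sup>+x. t x \<partial>\<mu>)"
      using ex_strict_finite_minorant[OF cnt _ M(2) \<pi>0(2)] disc(2) M(1) by metis
    \<comment> \<open>At points of mass 0 the coupling does not determine
      \<open>\<kappa> \<pi>\<close>; they are left out here and form a null set below.\<close>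
    define E' where "E' = {x \<in> E. t x \<noteq> 0 \<and> measure \<mu> {x} \<noteq> 0}"
    define N where "N = topspace ?T \<inter> (\<Inter>x\<in>E'. {\<pi> \<in> topspace ?T. \<kappa> \<pi> x \<in> {p \<in> topspace (sigma_P \<gamma> xo). t x < c x p}})"
    have "openin ?T N"
    proof (cases "E' = {}")
      case True
      then have "N = topspace ?T" unfolding N_def by blast
      then show ?thesis by (simp only: openin_topspace)
    next
      case False
      show ?thesis
        unfolding N_def
      proof (intro openin_Int openin_topspace openin_INT2)
        fix x assume "x \<in> E'"
        then have "measure \<mu> {x} \<noteq> 0" by (simp add: E'_def)
        moreover have "openin (sigma_P \<gamma> xo) {p \<in> topspace (sigma_P \<gamma> xo). t x < c x p}"
          using lsc[of x] by (simp add: lsc_map_def)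
        ultimately show "openin ?T {\<pi> \<in> topspace ?T. \<kappa> \<pi> x \<in> {p \<in> topspace (sigma_P \<gamma> xo). t x < c x p}}"
          by (intro openin_continuous_map_preimage[OF cont])
      qed (use t(1) False in \<open>auto simp: E'_def\<close>)
    qed
    moreover have "\<pi>0 \<in> N"
      unfolding N_def top using \<pi>0(1) t(3) kernelD(2)[OF \<kappa>(1)[OF \<pi>0(1)]] by (auto simp: E'_def topspace_sigma_P)
    moreover have "N \<subseteq> {\<pi> \<in> topspace ?T. a < I_cost \<gamma> xo c \<pi>}"
    proof
      fix \<pi> assume \<pi>: "\<pi> \<in> N"
      then have fib: "\<pi> \<in> ?fib" unfolding N_def top by blast
      have "AE x in \<mu>. t x \<le> c x (\<kappa> \<pi> x)"
      proof (rule AE_I'[where N="{x \<in> E. measure \<mu> {x} = 0}"])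
        have "(\<Union>x\<in>{x \<in> E. measure \<mu> {x} = 0}. {x}) \<in> null_sets \<mu>"
          using t(1) disc(2) M(1)
          by (intro null_sets_UN' countable_finite) (auto simp: M.emeasure_eq_measure null_sets_def)
        then show "{x \<in> E. measure \<mu> {x} = 0} \<in> null_sets \<mu>" by simp
        show "{x \<in> space \<mu>. \<not> t x \<le> c x (\<kappa> \<pi> x)} \<subseteq> {x \<in> E. measure \<mu> {x} = 0}"
        proof safe
          fix x assume nle: "\<not> t x \<le> c x (\<kappa> \<pi> x)"
          then have "t x \<noteq> 0" by auto
          then show "x \<in> E" using t(2) by blast
          show "measure \<mu> {x} = 0"
          proof (rule ccontr)
            assume "measure \<mu> {x} \<noteq> 0"
            then have "x \<in> E'" using \<open>t x \<noteq> 0\<close> \<open>x \<in> E\<close> by (simp add: E'_def)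
            then have "t x < c x (\<kappa> \<pi> x)" using \<pi> by (auto simp: N_def)
            with nle show False by simp
          qed
        qed
      qed
      then have "(\<integral>\<^sup>+x. t x \<partial>\<mu>) \<le> (\<integral>\<^sup>+x. c x (\<kappa> \<pi> x) \<partial>\<mu>)" by (rule nn_integral_mono_AE)
      then show "\<pi> \<in> {\<pi> \<in> topspace ?T. a < I_cost \<gamma> xo c \<pi>}"
        using fib t(4) I[OF fib] unfolding top by (auto intro: less_le_trans)
    qed
    ultimately show "\<exists>T. openin ?T T \<and> \<pi>0 \<in> T \<and> T \<subseteq> {\<pi> \<in> topspace ?T. a < I_cost \<gamma> xo c \<pi>}" by blast
  qed
qed

end

section \<open>The compact case: measurable selection of minimisers\<close>

lemma compact_space_chain:
  assumes Y: "compact_space Y" and cl: "\<And>C. C \<in> \<C> \<Longrightarrow> closedin Y C" "\<And>C. C \<in> \<C> \<Longrightarrow> C \<noteq> {}"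
    and chain: "\<And>C C'. C \<in> \<C> \<Longrightarrow> C' \<in> \<C> \<Longrightarrow> C \<subseteq> C' \<or> C' \<subseteq> C"
  shows "\<Inter>\<C> \<noteq> {}"
proof -
  have "\<Inter>\<F> \<noteq> {}" if F: "finite \<F>" "\<F> \<subseteq> \<C>" for \<F>
  proof (cases "\<F> = {}")
    case False
    have "\<exists>C\<in>\<C>. \<Inter>\<F> = C"
      using F(1) False F(2)
    proof (induction \<F> rule: finite_ne_induct)
      case (insert C \<F>)
      then obtain C' where C': "C' \<in> \<C>" "\<Inter>\<F> = C'" by auto
      have "C \<subseteq> C' \<or> C' \<subseteq> C" using chain insert.prems C'(1) by blast
      then have "\<Inter>(insert C \<F>) = C \<or> \<Inter>(insert C \<F>) = C'" using C'(2) by auto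
      then show ?case using C'(1) insert.prems by auto
    qed auto
    then show ?thesis using cl(2) by auto
  qed simp
  with Y cl(1) show ?thesis unfolding compact_space_fip by blast
qed

text \<open>Weak measurability of a closed-valued map.\<close>

definition hit_measurable :: "'b topology \<Rightarrow> ('x::topological_space \<Rightarrow> 'b set) \<Rightarrow> bool" where
  "hit_measurable Y F \<longleftrightarrow> (\<forall>x. closedin Y (F x) \<and> F x \<noteq> {}) \<and>
    (\<forall>C. closedin Y C \<longrightarrow> {x. F x \<inter> C \<noteq> {}} \<in> sets borel)"

definition argmin_on :: "('x \<Rightarrow> 'b \<Rightarrow> ennreal) \<Rightarrow> ('x \<Rightarrow> 'b set) \<Rightarrow> 'x \<Rightarrow> 'b set" where
  "argmin_on g F x = {p \<in> F x. \<forall>q\<in>F x. g x p \<le> g x q}"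

text \<open>The minimisers meet \<open>C\<close> exactly when, for every level \<open>r\<close> of a
  countable dense set, \<open>F x \<inter> C\<close> contains a point of value at most
  \<open>r\<close> as soon as \<open>F x\<close> does. Compactness turns this countable condition
  into an actual minimiser, a common point of nested closed sets.\<close>

lemma hit_measurable_argmin:
  fixes g :: "'x::topological_space \<Rightarrow> 'b \<Rightarrow> ennreal"
  assumes Y: "compact_space Y" and F: "hit_measurable Y F"
    and g: "\<And>x r. closedin Y {p \<in> topspace Y. g x p \<le> r}"
    and hit: "\<And>C r. closedin Y C \<Longrightarrow> {x. \<exists>p\<in>F x \<inter> C. g x p \<le> r} \<in> sets borel"
  shows "hit_measurable Y (argmin_on g F)"
proof -
  have Fcl: "closedin Y (F x)" "F x \<noteq> {}" for x using F by (auto simp: hit_measurable_def)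
  have Ftop: "F x \<subseteq> topspace Y" for x using Fcl(1) by (rule closedin_subset)
  obtain D0 :: "ennreal set" where D0: "countable D0" "\<And>X. open X \<Longrightarrow> X \<noteq> {} \<Longrightarrow> \<exists>d\<in>D0. d \<in> X"
    using countable_dense_exists by metis
  \<comment> \<open>The top level belongs to \<open>R\<close> even if \<open>g x\<close> is infinite
    throughout, so a common point of the sets \<open>L r\<close> lies in
    \<open>F x \<inter> C\<close>.\<close>
  define D where "D = insert \<top> D0"
  have D: "countable D" "\<top> \<in> D" "\<And>a b. a < b \<Longrightarrow> \<exists>r\<in>D. a < r \<and> r < b"
  proof -
    fix a b :: ennreal assume "a < b"
    then have "{a<..<b} \<noteq> {}" using dense by auto
    then show "\<exists>r\<in>D. a < r \<and> r < b" using D0(2)[OF open_greaterThanLessThan] by (auto simp: D_def)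
  qed (auto simp: D_def D0(1))
  have hits: "argmin_on g F x \<inter> C \<noteq> {} \<longleftrightarrow>
      (\<forall>r\<in>D. (\<exists>p\<in>F x. g x p \<le> r) \<longrightarrow> (\<exists>p\<in>F x \<inter> C. g x p \<le> r))" if C: "closedin Y C" for x C
  proof
    assume "argmin_on g F x \<inter> C \<noteq> {}"
    then obtain p where p: "p \<in> F x" "p \<in> C" "\<And>q. q \<in> F x \<Longrightarrow> g x p \<le> g x q" by (auto simp: argmin_on_def)
    show "\<forall>r\<in>D. (\<exists>p\<in>F x. g x p \<le> r) \<longrightarrow> (\<exists>p\<in>F x \<inter> C. g x p \<le> r)"
      using p by (blast intro: order_trans)
  next
    assume *: "\<forall>r\<in>D. (\<exists>p\<in>F x. g x p \<le> r) \<longrightarrow> (\<exists>p\<in>F x \<inter> C. g x p \<le> r)"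
    define L where "L r = F x \<inter> C \<inter> {p \<in> topspace Y. g x p \<le> r}" for r
    define R where "R = {r \<in> D. \<exists>p\<in>F x. g x p \<le> r}"
    have "\<Inter>(L ` R) \<noteq> {}"
    proof (rule compact_space_chain[OF Y])
      fix S assume "S \<in> L ` R"
      then obtain r where r: "r \<in> R" "S = L r" by auto
      show "closedin Y S" unfolding r(2) L_def using C Fcl(1) g by (intro closedin_Int)
      obtain p where "p \<in> F x \<inter> C" "g x p \<le> r" using * r(1) by (auto simp: R_def)
      then show "S \<noteq> {}" unfolding r(2) L_def using Ftop by auto
    next
      fix S T assume "S \<in> L ` R" "T \<in> L ` R"
      then obtain r r' where r: "S = L r" "T = L r'" by auto
      show "S \<subseteq> T \<or> T \<subseteq> S"
        using linear[of r r'] unfolding r L_def by (auto intro: order_trans)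
    qed
    then obtain p where p: "\<And>r. r \<in> R \<Longrightarrow> p \<in> L r" by auto
    have "\<top> \<in> R" using D(2) Fcl(2)[of x] by (auto simp: R_def)
    then have pF: "p \<in> F x" "p \<in> C" using p by (auto simp: L_def)
    have "g x p \<le> g x q" if q: "q \<in> F x" for q
    proof (rule ccontr)
      assume "\<not> g x p \<le> g x q"
      then obtain r where r: "r \<in> D" "g x q < r" "r < g x p" using D(3) by (auto simp: not_le)
      then have "r \<in> R" using q by (auto simp: R_def intro!: bexI[of _ q] less_imp_le)
      then have "g x p \<le> r" using p by (auto simp: L_def)
      with r show False by simp
    qed
    with pF show "argmin_on g F x \<inter> C \<noteq> {}" by (auto simp: argmin_on_def)
  qed
  have top: "closedin Y (topspace Y)" by simp
  have "argmin_on g F x \<noteq> {}" for x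
    using hits[OF top, of x] Ftop by (auto simp: subset_eq)
  moreover have "closedin Y (argmin_on g F x)" for x
  proof -
    obtain p where p: "p \<in> argmin_on g F x" using calculation by blast
    then have "argmin_on g F x = F x \<inter> {q \<in> topspace Y. g x q \<le> g x p}"
      using Ftop[of x] by (auto simp: argmin_on_def intro: order_trans)
    then show ?thesis using Fcl(1) g by (auto intro: closedin_Int)
  qed
  moreover have "{x. argmin_on g F x \<inter> C \<noteq> {}} \<in> sets borel" if C: "closedin Y C" for C
  proof -
    have h: "{x. \<exists>p\<in>F x. g x p \<le> r} \<in> sets borel" for r
    proof -
      have "{x. \<exists>p\<in>F x \<inter> topspace Y. g x p \<le> r} = {x. \<exists>p\<in>F x. g x p \<le> r}" using Ftop by blast
      with hit[OF top, of r] show ?thesis by simp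
    qed
    have "{x. argmin_on g F x \<inter> C \<noteq> {}} =
        (\<Inter>r\<in>D. - {x. \<exists>p\<in>F x. g x p \<le> r} \<union> {x. \<exists>p\<in>F x \<inter> C. g x p \<le> r})"
      unfolding hits[OF C] by auto
    also have "\<dots> \<in> sets borel"
      using D(1,2) h hit[OF C] by (intro sets.countable_INT' sets.Un) auto
    finally show ?thesis .
  qed
  ultimately show ?thesis by (auto simp: hit_measurable_def)
qed

text \<open>Ties among the minimisers of \<open>g x\<close> are broken lexicographically by \<open>h 0, h 1, \<dots>\<close>, so that
  \<open>h j (s x)\<close> is the minimum of \<open>h j\<close> over a weakly measurable set.\<close>

theorem ex_measurable_argmin:
  fixes g :: "'x::topological_space \<Rightarrow> 'b \<Rightarrow> ennreal" and h :: "nat \<Rightarrow> 'b \<Rightarrow> ennreal"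
  assumes Y: "compact_space Y" "topspace Y \<noteq> {}"
    and g: "lsc_map (prod_topology euclidean Y) (\<lambda>(x, p). g x p)"
    and h: "\<And>j. lsc_map Y (h j)"
  shows "\<exists>s. (\<forall>x. s x \<in> topspace Y \<and> (\<forall>q\<in>topspace Y. g x (s x) \<le> g x q)) \<and>
    (\<forall>j. (\<lambda>x. h j (s x)) \<in> borel_measurable borel)"
proof -
  have le_closed: "closedin T {z \<in> topspace T. f z \<le> r}" if f: "lsc_map T f" for T and f :: "'z \<Rightarrow> ennreal" and r
  proof -
    have "topspace T - {z \<in> topspace T. f z \<le> r} = {z \<in> topspace T. r < f z}" by auto
    with f show ?thesis by (auto simp: closedin_def lsc_map_def)
  qed
  have g_closed: "closedin (prod_topology euclidean Y) {(x, p). p \<in> topspace Y \<and> g x p \<le> r}" for r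
  proof -
    have "{(x, p). p \<in> topspace Y \<and> g x p \<le> r} =
        {z \<in> topspace (prod_topology euclidean Y). (\<lambda>(x, p). g x p) z \<le> r}" by auto
    then show ?thesis using le_closed[OF g, of r] by simp
  qed
  have g_slice: "closedin Y {p \<in> topspace Y. g x p \<le> r}" for x r
  proof -
    have "continuous_map Y (prod_topology euclidean Y) (\<lambda>p. (x, p))"
      by (intro continuous_map_pairedI) auto
    from closedin_continuous_map_preimage[OF this g_closed[of r]]
    show ?thesis by (auto simp: conj_commute)
  qed
  define F where "F = rec_nat (argmin_on g (\<lambda>_. topspace Y)) (\<lambda>j F. argmin_on (\<lambda>_. h j) F)"
  have F0: "F 0 = argmin_on g (\<lambda>_. topspace Y)" and FS: "F (Suc j) = argmin_on (\<lambda>_. h j) (F j)" for j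
    by (simp_all add: F_def)
  have hm: "hit_measurable Y (F j)" for j
  proof (induction j)
    case 0
    show ?case unfolding F0
    proof (rule hit_measurable_argmin[OF Y(1) _ g_slice])
      show "hit_measurable Y (\<lambda>_::'x. topspace Y)"
        using Y(2) by (auto simp: hit_measurable_def)
      fix C r assume C: "closedin Y C"
      \<comment> \<open>Projection along a compact factor is a closed map, so the set of
        \<open>x\<close> in question is even closed.\<close>
      have "closedin (prod_topology euclidean Y) ((UNIV :: 'x set) \<times> C \<inter> {(x, p). p \<in> topspace Y \<and> g x p \<le> r})"
        using C g_closed by (intro closedin_Int) (auto simp: closedin_prod_Times_iff)
      with closed_map_fst[OF Y(1), of "euclidean :: 'x topology"]
      have "closed (fst ` ((UNIV :: 'x set) \<times> C \<inter> {(x, p). p \<in> topspace Y \<and> g x p \<le> r}))"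
        by (auto simp: closed_map_def)
      also have "fst ` ((UNIV :: 'x set) \<times> C \<inter> {(x, p). p \<in> topspace Y \<and> g x p \<le> r}) =
          {x. \<exists>p\<in>topspace Y \<inter> C. g x p \<le> r}" by force
      finally show "{x. \<exists>p\<in>topspace Y \<inter> C. g x p \<le> r} \<in> sets borel" by simp
    qed
  next
    case (Suc j)
    show ?case unfolding FS
    proof (rule hit_measurable_argmin[OF Y(1) Suc])
      show "closedin Y {p \<in> topspace Y. h j p \<le> r}" for r by (rule le_closed[OF h])
      fix C r assume C: "closedin Y C"
      \<comment> \<open>The bound on \<open>h j\<close> does not involve \<open>x\<close> and cuts
        out a closed set, so it is absorbed into \<open>C\<close> and the induction hypothesis
        applies.\<close>
      have "{x. \<exists>p\<in>F j x \<inter> C. h j p \<le> r} = {x. F j x \<inter> (C \<inter> {p \<in> topspace Y. h j p \<le> r}) \<noteq> {}}"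
        using closedin_subset[OF C] by auto
      also have "\<dots> \<in> sets borel"
        using Suc closedin_Int[OF C le_closed[OF h, of j r]] unfolding hit_measurable_def by blast
      finally show "{x. \<exists>p\<in>F j x \<inter> C. h j p \<le> r} \<in> sets borel" .
    qed
  qed
  have Fcl: "closedin Y (F j x)" "F j x \<noteq> {}" for j x using hm[of j] by (auto simp: hit_measurable_def)
  have "F (Suc j) x \<subseteq> F j x" for j x unfolding FS by (auto simp: argmin_on_def)
  then have dec: "F j' x \<subseteq> F j x" if "j \<le> j'" for j j' x
    using lift_Suc_antimono_le[of "\<lambda>j. F j x", OF _ that] by blast
  have "(\<Inter>j. F j x) \<noteq> {}" for x
  proof (rule compact_space_chain[OF Y(1)])
    fix S T assume "S \<in> range (\<lambda>j. F j x)" "T \<in> range (\<lambda>j. F j x)"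
    then obtain i j where "S = F i x" "T = F j x" by auto
    then show "S \<subseteq> T \<or> T \<subseteq> S" using dec[of i j x] dec[of j i x] linear[of i j] by auto
  qed (use Fcl in auto)
  then have "\<exists>p. \<forall>j. p \<in> F j x" for x by blast
  then obtain s where s: "\<And>x j. s x \<in> F j x" by metis
  have s0: "s x \<in> topspace Y" "\<And>q. q \<in> topspace Y \<Longrightarrow> g x (s x) \<le> g x q" for x
    using s[of x 0] unfolding F0 by (auto simp: argmin_on_def)
  have "(\<lambda>x. h j (s x)) \<in> borel_measurable borel" for j
  proof (rule borel_measurableI_le)
    fix r
    have min: "h j (s x) \<le> h j q" if "q \<in> F j x" for x q
      using s[of x "Suc j"] that unfolding FS by (auto simp: argmin_on_def)
    have "{x \<in> space borel. h j (s x) \<le> r} = {x. F j x \<inter> {p \<in> topspace Y. h j p \<le> r} \<noteq> {}}"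
      using s s0(1) by (auto intro: order_trans[OF min])
    also have "\<dots> \<in> sets borel"
      using hm[of j] le_closed[OF h, of j r] unfolding hit_measurable_def by blast
    finally show "{x \<in> space borel. h j (s x) \<le> r} \<in> sets borel" .
  qed
  with s0 show ?thesis by blast
qed

section \<open>Compactness of moment balls over a compact space\<close>

context weight
begin

text \<open>Even on compact X a lower semicontinuous weight may be unbounded, for instance with
  \<gamma>(u) = 1/u for u > 0, and then \<open>P_gamma\<close> need not be compact. Bounding the
  moment restores compactness.\<close>

definition ball_P :: "nat \<Rightarrow> 'a measure set" where
  "ball_P n = {p \<in> P_gamma \<gamma> xo. (\<integral>\<^sup>+y. ennreal (w y) \<partial>p) \<le> of_nat n}"

lemma openin_sigma_P_gt:
  assumes "\<phi> \<in> Phi_weight w"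
  shows "openin (sigma_P \<gamma> xo) {p \<in> P_gamma \<gamma> xo. r < (\<integral>y. \<phi> y \<partial>p)}"
    "openin (sigma_P \<gamma> xo) {p \<in> P_gamma \<gamma> xo. (\<integral>y. \<phi> y \<partial>p) < r}"
proof -
  have "openin (sigma_P \<gamma> xo) {p \<in> P_weight w. (\<integral>y. \<phi> y \<partial>p) \<in> U}" if "open U" for U
    unfolding sigma_P_def sigma_topology_def using assms that by (intro topology_generated_by_Basis) blast
  from this[of "{r<..}"] this[of "{..<r}"]
  show "openin (sigma_P \<gamma> xo) {p \<in> P_gamma \<gamma> xo. r < (\<integral>y. \<phi> y \<partial>p)}"
    "openin (sigma_P \<gamma> xo) {p \<in> P_gamma \<gamma> xo. (\<integral>y. \<phi> y \<partial>p) < r}"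
    by (simp_all add: P_gamma_def)
qed

text \<open>The complement is closed, so \<open>closed_approx\<close> bounds its mass near
  \<open>p\<close> by the integral of a single test function. These masses serve to break ties
  between minimisers.\<close>

lemma lsc_emeasure_open:
  assumes U: "open U"
  shows "lsc_map (sigma_P \<gamma> xo) (\<lambda>p. emeasure p U)"
  unfolding lsc_map_def topspace_sigma_P
proof (rule allI, subst openin_subopen, rule ballI)
  fix a p assume "p \<in> {p \<in> P_gamma \<gamma> xo. a < emeasure p U}"
  then have p: "p \<in> P_gamma \<gamma> xo" "a < emeasure p U" by auto
  have compl: "measure q U = 1 - measure q (- U)" if q: "q \<in> P_gamma \<gamma> xo" for q
  proof -
    note Q = P_gammaD[OF q]
    interpret prob_space q by (rule Q)
    show ?thesis using prob_compl[of "- U"] U Q by (auto simp: Compl_eq_Diff_UNIV[symmetric])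
  qed
  note P = P_gammaD[OF p(1)]
  interpret p: prob_space p by (rule P)
  obtain a' where a': "a = ennreal a'" "0 \<le> a'" "a' < measure p U"
    using p(2) by (cases a) (auto simp: p.emeasure_eq_measure ennreal_less_iff)
  have "measure p (- U) < 1 - a'" using a'(3) compl[OF p(1)] by simp
  then obtain \<psi> where \<psi>: "continuous_on UNIV \<psi>" "\<And>y. 0 \<le> \<psi> y" "\<And>y. \<psi> y \<le> 1" "\<And>y. y \<in> - U \<Longrightarrow> \<psi> y = 1"
    "(\<integral>y. \<psi> y \<partial>p) < 1 - a'"
    using closed_approx[OF P(1,3), of "- U" "1 - a'"] U by (auto simp: closed_Compl)
  have \<psi>P: "\<psi> \<in> Phi_weight w"
    using \<psi>(1-3) unfolding Phi_weight_def mem_Collect_eq by (intro conjI exI[of _ 1] exI[of _ 0] allI) auto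
  have "a < emeasure q U" if q: "q \<in> P_gamma \<gamma> xo" "(\<integral>y. \<psi> y \<partial>q) < 1 - a'" for q
  proof -
    note Q = P_gammaD[OF q(1)]
    interpret q: prob_space q by (rule Q)
    have m: "- U \<in> sets q" using U Q(1) by simp
    have "measure q (- U) \<le> (\<integral>y. \<psi> y \<partial>q)"
      by (rule measure_le_integral[OF q.finite_measure_axioms m integrable_Phi[OF \<psi>P q(1)] \<psi>(2,4)])
    then show ?thesis using q(2) compl[OF q(1)] a' by (simp add: q.emeasure_eq_measure ennreal_less_iff)
  qed
  then show "\<exists>T. openin (sigma_P \<gamma> xo) T \<and> p \<in> T \<and> T \<subseteq> {p \<in> P_gamma \<gamma> xo. a < emeasure p U}"
    using openin_sigma_P_gt(2)[OF \<psi>P, of "1 - a'"] p(1) \<psi>(5)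
    by (intro exI[of _ "{q \<in> P_gamma \<gamma> xo. (\<integral>y. \<psi> y \<partial>q) < 1 - a'}"]) auto
qed

text \<open>Measures are regarded as kernels over the Dirac mass at \<open>xo\<close>, so that
  \<open>ex_limit_kernel\<close> applies; closed sets decreasing to the empty set are eventually
  empty here. The moment bound passes to the limit because \<open>w\<close> is lower semicontinuous,
  and test functions, bounded by compactness, are dominated by a constant.\<close>

lemma compactin_ball_P:
  assumes comp: "compact (UNIV :: 'a set)"
  shows "compactin (sigma_P \<gamma> xo) (ball_P n)"
  unfolding compactin_def
proof (intro conjI allI impI)
  show "ball_P n \<subseteq> topspace (sigma_P \<gamma> xo)" by (auto simp: ball_P_def topspace_sigma_P)
  fix \<U> assume \<U>: "(\<forall>U\<in>\<U>. openin (sigma_P \<gamma> xo) U) \<and> ball_P n \<subseteq> \<Union>\<U>"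
  show "\<exists>\<F>. finite \<F> \<and> \<F> \<subseteq> \<U> \<and> ball_P n \<subseteq> \<Union>\<F>"
  proof (rule ccontr)
    assume neg: "\<not> ?thesis"
    define I where "I = {\<F>. finite \<F> \<and> \<F> \<subseteq> \<U>}"
    \<comment> \<open>A cover without finite subcover gives a proper filter on the ball that
      eventually avoids each member of \<open>\<U>\<close>; a limit in the ball contradicts
      this.\<close>
    define F where "F = (INF \<F>\<in>I. principal (ball_P n - \<Union>\<F>))"
    have ev_F: "eventually P F \<longleftrightarrow> (\<exists>\<F>\<in>I. \<forall>p\<in>ball_P n - \<Union>\<F>. P p)" for P
      unfolding F_def
    proof (subst eventually_INF_base)
      show "I \<noteq> {}" by (auto simp: I_def)
      fix a b assume "a \<in> I" "b \<in> I"
      then show "\<exists>x\<in>I. principal (ball_P n - \<Union>x) \<le> inf (principal (ball_P n - \<Union>a)) (principal (ball_P n - \<Union>b))"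
        by (intro bexI[of _ "a \<union> b"]) (auto simp: I_def)
    qed (simp add: eventually_principal)
    have Fne: "F \<noteq> bot"
    proof
      assume "F = bot"
      then have "\<exists>\<F>\<in>I. \<forall>p\<in>ball_P n - \<Union>\<F>. False"
        unfolding ev_F[symmetric] by simp
      then obtain \<F> where "\<F> \<in> I" "ball_P n \<subseteq> \<Union>\<F>" by blast
      with neg show False unfolding I_def by blast
    qed
    have ev: "\<forall>\<^sub>F p in F. p \<in> ball_P n" unfolding ev_F by (intro bexI[of _ "{}"]) (auto simp: I_def)
    have pk: "prob_kernel (return borel xo) (\<lambda>_. p)" if "p \<in> P_gamma \<gamma> xo" for p
      by (rule prob_kernelI[OF return_in_P_gamma const_kernel[OF that]])
    have kernels: "\<forall>\<^sub>F p in F. prob_kernel (return borel xo) (\<lambda>_. p)"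
      using ev by eventually_elim (simp add: ball_P_def pk)
    have "\<exists>n. \<forall>\<^sub>F p in F. measure (return borel xo \<bind> (\<lambda>_. p)) (C n) \<le> e"
      if C: "\<And>n::nat. closed (C n)" "decseq C" "(\<Inter>n. C n) = {}" and e: "0 < e" for C :: "nat \<Rightarrow> 'a set" and e :: real
    proof -
      have "\<exists>n. C n = {}"
      proof (rule ccontr)
        assume ne: "\<nexists>n. C n = {}"
        have "\<Inter>(range C) \<noteq> {}"
        proof (rule compact_space_chain)
          show "compact_space (euclidean :: 'a topology)" using comp by (simp add: compact_space_def)
          fix S T assume "S \<in> range C" "T \<in> range C"
          then obtain i j where "S = C i" "T = C j" by auto
          then show "S \<subseteq> T \<or> T \<subseteq> S" using C(2) linear[of i j] by (auto simp: decseq_def)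
        qed (use C(1) ne in auto)
        with C(3) show False by simp
      qed
      then obtain m where "C m = {}" by blast
      then show ?thesis using e by (intro exI[of _ m]) simp
    qed
    from ex_limit_kernel[OF Fne kernels this] obtain F' q where F': "F' \<le> F"
      and lim: "kernel_limit F' (return borel xo) (\<lambda>p _. p) q" by blast
    interpret kernel_limit F' "return borel xo" "\<lambda>p _. p" q by (rule lim)
    define p where "p = q xo"
    have ev': "\<forall>\<^sub>F p in F'. p \<in> ball_P n" using F' ev by (rule filter_leD)
    have bind: "return borel xo \<bind> k = k xo" if "prob_kernel (return borel xo) k" for k :: "'a \<Rightarrow> 'a measure"
      by (rule bind_return[OF prob_kernel.kernel_subprob[OF that]]) simp
    have nn_semi: "(\<integral>\<^sup>+z. f (snd z) \<partial>semidirect (return borel xo) k) = (\<integral>\<^sup>+y. f y \<partial>k xo)"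
      if k: "prob_kernel (return borel xo) k" and f [measurable]: "f \<in> borel_measurable borel"
      for k :: "'a \<Rightarrow> 'a measure" and f
    proof -
      interpret k: prob_kernel "return borel xo" k by (rule k)
      show ?thesis unfolding bind[OF k, symmetric] by (rule k.nn_integral_snd_semidirect[OF f])
    qed
    have wp: "(\<integral>\<^sup>+y. ennreal (w y) \<partial>p) \<le> of_nat n"
    proof (rule ccontr)
      assume "\<not> ?thesis"
      then have lt: "of_nat n < (\<integral>\<^sup>+z. ennreal (indicator (UNIV \<times> UNIV) z * w (snd z)) \<partial>semidirect (return borel xo) q)"
        using nn_semi[OF limit, of "\<lambda>y. ennreal (w y)"] by (simp add: p_def not_le)
      have "open ((\<lambda>z :: 'a \<times> 'a. snd z) -` {y. r < w y})" for r
        by (intro open_vimage w_open continuous_intros)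
      then have op: "open {z :: 'a \<times> 'a. r < w (snd z)}" for r by (simp add: vimage_def)
      have "\<forall>\<^sub>F p in F'. of_nat n < (\<integral>\<^sup>+z. ennreal (indicator (UNIV \<times> UNIV) z * w (snd z)) \<partial>semidirect (return borel xo) (\<lambda>_. p))"
        by (rule lsc_nn_integral_above[OF _ op _ lt]) auto
      with ev' have "\<forall>\<^sub>F p in F'. False"
      proof eventually_elim
        case (elim p)
        then have p: "p \<in> P_gamma \<gamma> xo" "(\<integral>\<^sup>+y. ennreal (w y) \<partial>p) \<le> of_nat n" by (auto simp: ball_P_def)
        then show False using elim(2) nn_semi[OF pk[OF p(1)], of "\<lambda>y. ennreal (w y)"] by simp
      qed
      then show False using nontrivial by (simp add: eventually_False)
    qed
    have "p \<in> P_gamma \<gamma> xo"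
      unfolding p_def using wp[unfolded p_def] L.kernel_prob[of xo] by (intro P_gammaI) (auto intro: le_less_trans simp: of_nat_less_top)
    with wp have p: "p \<in> ball_P n" by (simp add: ball_P_def)
    then obtain U where U: "U \<in> \<U>" "p \<in> U" using \<U> by auto
    have "\<forall>\<^sub>F p' in F'. p' \<in> U"
    proof (rule eventually_sigma_topology[where l = p])
      show "openin (sigma_topology w) U" using \<U> U(1) by (simp add: sigma_P_def)
      show "\<forall>\<^sub>F p in F'. p \<in> P_weight w" using ev' by eventually_elim (simp add: ball_P_def P_gamma_def)
      fix \<phi> assume \<phi>: "\<phi> \<in> Phi_weight w"
      obtain K where K: "\<And>y. \<bar>\<phi> y\<bar> \<le> K"
        using compact_imp_bounded[OF compact_continuous_image[OF PhiD(1)[OF \<phi>] comp]]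
        by (auto simp: bounded_iff)
      have K0: "0 \<le> K" using K[of xo] by linarith
      have c\<phi>: "continuous_on UNIV (\<lambda>z :: 'a \<times> 'a. \<phi> (snd z))"
        by (rule continuous_on_compose2[OF PhiD(1)[OF \<phi>]]) (auto intro: continuous_intros)
      have int: "(\<integral>z. indicator (UNIV \<times> UNIV) z * \<phi> (snd z) \<partial>semidirect (return borel xo) k) = (\<integral>y. \<phi> y \<partial>k xo)"
        if k: "prob_kernel (return borel xo) k" for k :: "'a \<Rightarrow> 'a measure"
      proof -
        interpret k: prob_kernel "return borel xo" k by (rule k)
        show ?thesis unfolding bind[OF k, symmetric]
          using k.integral_snd_semidirect[OF PhiD(2)[OF \<phi>]] by simp
      qed
      have const: "integrable (return borel xo \<bind> k) (\<lambda>_. K)" "(\<integral>y. K \<partial>(return borel xo \<bind> k)) = K"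
        if k: "prob_kernel (return borel xo) k" for k :: "'a \<Rightarrow> 'a measure"
      proof -
        interpret k: prob_kernel "return borel xo" k by (rule k)
        interpret b: prob_space "return borel xo \<bind> k" by (rule k.prob_bind_kernel)
        show "integrable (return borel xo \<bind> k) (\<lambda>_. K)" by simp
        show "(\<integral>y. K \<partial>(return borel xo \<bind> k)) = K" using b.prob_space by simp
      qed
      have "((\<lambda>p. \<integral>z. indicator (UNIV \<times> UNIV) z * \<phi> (snd z) \<partial>semidirect (return borel xo) (\<lambda>_. p)) \<longlongrightarrow>
          (\<integral>z. indicator (UNIV \<times> UNIV) z * \<phi> (snd z) \<partial>semidirect (return borel xo) q)) F'"
      proof (rule dominated_integral_tendsto[where G="\<lambda>_. K"])
        show "\<forall>\<^sub>F p in F'. integrable (return borel xo \<bind> (\<lambda>_. p)) (\<lambda>_. K)"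
          using kernel_limit.kernels[OF lim] by eventually_elim (rule const)
        show "((\<lambda>p. \<integral>y. K \<partial>(return borel xo \<bind> (\<lambda>_. p))) \<longlongrightarrow> (\<integral>y. K \<partial>(return borel xo \<bind> q))) F'"
        proof (rule tendsto_eventually)
          show "\<forall>\<^sub>F p in F'. (\<integral>y. K \<partial>(return borel xo \<bind> (\<lambda>_. p))) = (\<integral>y. K \<partial>(return borel xo \<bind> q))"
            using kernel_limit.kernels[OF lim] by eventually_elim (rule trans[OF const(2) const(2)[OF limit, symmetric]])
        qed
      qed (use c\<phi> K K0 const(1)[OF limit] in auto)
      then show "((\<lambda>p. \<integral>z. \<phi> z \<partial>p) \<longlongrightarrow> (\<integral>z. \<phi> z \<partial>p)) F'"
        unfolding int[OF limit] p_def
      proof (rule tendsto_cong[THEN iffD1, rotated])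
        show "\<forall>\<^sub>F p in F'. (\<integral>z. indicator (UNIV \<times> UNIV) z * \<phi> (snd z) \<partial>semidirect (return borel xo) (\<lambda>_. p)) = (\<integral>z. \<phi> z \<partial>p)"
          using kernel_limit.kernels[OF lim] by eventually_elim (rule int)
      qed
    qed (rule U(2))
    moreover have "\<forall>\<^sub>F p' in F'. p' \<notin> U"
    proof (rule filter_leD[OF F'])
      show "\<forall>\<^sub>F p' in F. p' \<notin> U" unfolding ev_F using U(1) by (intro bexI[of _ "{U}"]) (auto simp: I_def)
    qed
    ultimately have "\<forall>\<^sub>F p' in F'. False" by eventually_elim simp
    then show False using nontrivial by (simp add: eventually_False)
  qed
qed

end

context weighted_cost
begin

lemma shifted_cost_lsc:
  assumes C3': "C3' \<gamma> xo c" and \<phi>: "\<phi> \<in> Phi_weight w" "\<And>y. - B \<le> \<phi> y"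
  shows "lsc_map (prod_topology euclidean (sigma_P \<gamma> xo)) (\<lambda>(x, p). shifted_cost \<phi> B x p)"
  unfolding lsc_map_def
proof
  fix a :: ennreal
  let ?T = "prod_topology euclidean (sigma_P \<gamma> xo) :: ('a \<times> 'a measure) topology"
  have top: "topspace ?T = UNIV \<times> P_gamma \<gamma> xo" by (simp add: topspace_sigma_P)
  have sc: "shifted_cost \<phi> B x p = ennreal ((\<integral>y. \<phi> y \<partial>p) + B) + c x p" "0 \<le> (\<integral>y. \<phi> y \<partial>p) + B"
    if "p \<in> P_gamma \<gamma> xo" for x p
    using nn_integral_shift[OF \<phi> that] by (simp_all add: shifted_cost_def)
  show "openin ?T {z \<in> topspace ?T. a < (case z of (x, p) \<Rightarrow> shifted_cost \<phi> B x p)}"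
  proof (cases a)
    case top: top
    then show ?thesis by simp
  next
    case (real a')
    define V where "V r = (UNIV :: 'a set) \<times> {p \<in> P_gamma \<gamma> xo. a' - B - r < (\<integral>y. \<phi> y \<partial>p)}" for r :: real
    define W where "W r = {z \<in> topspace ?T. ennreal r < (case z of (x, p) \<Rightarrow> c x p)}" for r
    have V: "openin ?T (V r)" for r
      unfolding V_def openin_prod_Times_iff using openin_sigma_P_gt(1)[OF \<phi>(1)] by auto
    have W: "openin ?T (W r)" for r using C3' by (simp add: W_def C3'_def lsc_map_def)
    \<comment> \<open>The sum exceeds \<open>a'\<close> when \<open>a' - r\<close> and
      \<open>r\<close> lie strictly below the two summands for some \<open>r\<close>. The set
      \<open>V 0\<close> covers the case in which the first summand alone suffices, including a
      vanishing cost, for which no \<open>W r\<close> is available.\<close>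
    have "{z \<in> topspace ?T. a < (case z of (x, p) \<Rightarrow> shifted_cost \<phi> B x p)} = V 0 \<union> (\<Union>r\<in>{0..}. V r \<inter> W r)"
    proof (intro set_eqI iffI)
      fix z assume z: "z \<in> {z \<in> topspace ?T. a < (case z of (x, p) \<Rightarrow> shifted_cost \<phi> B x p)}"
      obtain x p where zp: "z = (x, p)" by (cases z)
      have p: "p \<in> P_gamma \<gamma> xo" using z unfolding top zp by simp
      define u where "u = (\<integral>y. \<phi> y \<partial>p) + B"
      have lt: "ennreal a' < ennreal u + c x p" using z sc[OF p] real by (simp add: zp u_def)
      have u0: "0 \<le> u" using sc(2)[OF p] by (simp add: u_def)
      show "z \<in> V 0 \<union> (\<Union>r\<in>{0..}. V r \<inter> W r)"
      proof (cases "a' < u")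
        case True
        then show ?thesis using p by (simp add: V_def zp u_def)
      next
        case False
        have "ennreal (a' - u) < c x p"
          using lt False u0 real by (cases "c x p") (auto simp: ennreal_less_iff ennreal_plus[symmetric] simp del: ennreal_plus)
        then obtain r0 where r0: "ennreal (a' - u) < r0" "r0 < c x p" using dense by blast
        obtain r where r: "r0 = ennreal r" "0 \<le> r" using r0(2) by (cases r0) auto
        have "a' - u < r" using r0(1) False r by (simp add: ennreal_less_iff)
        then have "z \<in> V r \<inter> W r" using p r0(2) r unfolding V_def W_def top by (simp add: zp u_def)
        then show ?thesis using r(2) by auto
      qed
    next
      fix z assume z: "z \<in> V 0 \<union> (\<Union>r\<in>{0..}. V r \<inter> W r)"
      obtain x p where zp: "z = (x, p)" by (cases z)
      have p: "p \<in> P_gamma \<gamma> xo" using z by (auto simp: V_def zp)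
      define u where "u = (\<integral>y. \<phi> y \<partial>p) + B"
      have u0: "0 \<le> u" using sc(2)[OF p] by (simp add: u_def)
      have "ennreal a' < ennreal u + c x p"
      proof (cases "z \<in> V 0")
        case True
        then have "a' < u" by (simp add: V_def zp u_def)
        then have "ennreal a' < ennreal u" using real(1) by (simp add: ennreal_less_iff)
        also have "\<dots> \<le> ennreal u + c x p" by (rule add_increasing2) auto
        finally show ?thesis .
      next
        case False
        then obtain r where r: "0 \<le> r" "z \<in> V r" "z \<in> W r" using z by auto
        have "a' < u + r" using r(2) by (simp add: V_def zp u_def)
        then have "ennreal a' < ennreal u + ennreal r"
          using real(1) u0 r(1) by (simp add: ennreal_less_iff ennreal_plus[symmetric] del: ennreal_plus)
        also have "\<dots> \<le> ennreal u + c x p" using r(3) by (intro add_left_mono) (auto simp: W_def zp intro: less_imp_le)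
        finally show ?thesis .
      qed
      then show "z \<in> {z \<in> topspace ?T. a < (case z of (x, p) \<Rightarrow> shifted_cost \<phi> B x p)}"
        using p sc[OF p] real by (simp add: zp u_def topspace_sigma_P)
    qed
    moreover have "openin ?T (V 0 \<union> (\<Union>r\<in>{0..}. V r \<inter> W r))"
      using V W by (intro openin_Un openin_Union ballI) auto
    ultimately show ?thesis by simp
  qed
qed

lemma lsc_map_subtopology:
  assumes "lsc_map T f"
  shows "lsc_map (subtopology T S) f"
  unfolding lsc_map_def
proof
  fix a
  have "{z \<in> topspace (subtopology T S). a < f z} = {z \<in> topspace T. a < f z} \<inter> S" by auto
  then show "openin (subtopology T S) {z \<in> topspace (subtopology T S). a < f z}"
    using assms unfolding lsc_map_def openin_subtopology by blast
qed

text \<open>On each compact moment ball the jointly lower semicontinuous shifted cost has a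
  measurable minimiser. Every admissible measure lies in some ball, so these minimisers together
  reach the infimum.\<close>

lemma selectable_C3':
  assumes C3': "C3' \<gamma> xo c" and \<phi>: "\<phi> \<in> Phi_weight w" "\<And>y. - B \<le> \<phi> y"
  shows "selectable \<phi> B"
proof -
  have comp: "compact (UNIV :: 'a set)" using C3' by (simp add: C3'_def)
  obtain G :: "'a set set" where G: "countable G" "Int_stable G" "UNIV \<in> G"
      "sets borel = sigma_sets UNIV G" "\<And>U. U \<in> G \<Longrightarrow> open U"
    using borel_countable_Int_stable_generator by blast
  have Gne: "G \<noteq> {}" using G(3) by auto
  \<comment> \<open>The masses of an intersection-stable generator control measurability into the
    space of probability measures: once all \<open>h j (s x)\<close> are measurable in
    \<open>x\<close>, \<open>s\<close> is a kernel.\<close>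
  define h where "h j p = emeasure p (from_nat_into G j)" for j and p :: "'a measure"
  have "\<exists>s\<in>P_gamma_kernels \<gamma> xo. \<forall>x. \<forall>q\<in>ball_P n. shifted_cost \<phi> B x (s x) \<le> shifted_cost \<phi> B x q" for n
  proof -
    let ?Y = "subtopology (sigma_P \<gamma> xo) (ball_P n)"
    have topY: "topspace ?Y = ball_P n" by (auto simp: topspace_sigma_P ball_P_def)
    have "return borel xo \<in> ball_P n"
      using return_in_P_gamma by (simp add: ball_P_def nn_integral_return)
    then have ne: "topspace ?Y \<noteq> {}" unfolding topY by auto
    have "\<exists>s. (\<forall>x. s x \<in> topspace ?Y \<and> (\<forall>q\<in>topspace ?Y. shifted_cost \<phi> B x (s x) \<le> shifted_cost \<phi> B x q)) \<and>
      (\<forall>j. (\<lambda>x. h j (s x)) \<in> borel_measurable borel)"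
    proof (rule ex_measurable_argmin[OF compact_space_subtopology[OF compactin_ball_P[OF comp]] ne])
      show "lsc_map (prod_topology euclidean ?Y) (\<lambda>(x, p). shifted_cost \<phi> B x p)"
        unfolding prod_topology_subtopology(2) by (rule lsc_map_subtopology[OF shifted_cost_lsc[OF C3' \<phi>]])
      show "lsc_map ?Y (h j)" for j
        unfolding h_def[abs_def] using G(5) from_nat_into[OF Gne] by (intro lsc_map_subtopology lsc_emeasure_open) blast
    qed
    then obtain s where s: "\<And>x. s x \<in> ball_P n" "\<And>x q. q \<in> ball_P n \<Longrightarrow> shifted_cost \<phi> B x (s x) \<le> shifted_cost \<phi> B x q"
      "\<And>j. (\<lambda>x. h j (s x)) \<in> borel_measurable borel"
      unfolding topY by blast
    have sP: "s x \<in> P_gamma \<gamma> xo" for x using s(1) by (simp add: ball_P_def)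
    have "s \<in> borel \<rightarrow>\<^sub>M prob_algebra borel"
    proof (rule measurable_prob_algebra_generated[OF G(4,2)])
      fix A assume "A \<in> G"
      then obtain j where "from_nat_into G j = A" using from_nat_into_surj[OF G(1)] by blast
      then show "(\<lambda>x. emeasure (s x) A) \<in> borel_measurable borel" using s(3)[of j] by (simp add: h_def)
    qed (use P_gammaD[OF sP] in auto)
    then show ?thesis using s(2) sP by (intro bexI[of _ s]) (auto simp: P_gamma_kernels_def)
  qed
  then obtain \<kappa> where \<kappa>: "\<And>n. \<kappa> n \<in> P_gamma_kernels \<gamma> xo"
    "\<And>n x q. q \<in> ball_P n \<Longrightarrow> shifted_cost \<phi> B x (\<kappa> n x) \<le> shifted_cost \<phi> B x q"
    by metis
  have "shifted_R \<phi> B x = (INF n. shifted_cost \<phi> B x (\<kappa> n x))" for x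
  proof (rule antisym)
    show "shifted_R \<phi> B x \<le> (INF n. shifted_cost \<phi> B x (\<kappa> n x))"
      unfolding shifted_R_def using kernelD(2)[OF \<kappa>(1)] by (intro INF_greatest INF_lower)
    show "(INF n. shifted_cost \<phi> B x (\<kappa> n x)) \<le> shifted_R \<phi> B x"
      unfolding shifted_R_def
    proof (rule INF_greatest)
      fix q assume q: "q \<in> P_gamma \<gamma> xo"
      obtain n :: nat where "(\<integral>\<^sup>+y. ennreal (w y) \<partial>q) \<le> of_nat n"
        using P_gammaD(4)[OF q] ennreal_Ex_less_of_nat[of "\<integral>\<^sup>+y. ennreal (w y) \<partial>q"] by (auto intro: less_imp_le)
      then have "q \<in> ball_P n" using q by (simp add: ball_P_def)
      then have "shifted_cost \<phi> B x (\<kappa> n x) \<le> shifted_cost \<phi> B x q" by (rule \<kappa>(2))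
      then show "(INF n. shifted_cost \<phi> B x (\<kappa> n x)) \<le> shifted_cost \<phi> B x q" by (rule INF_lower2[rotated]) simp
    qed
  qed
  then show ?thesis unfolding selectable_def using \<kappa>(1) by (intro exI[of _ \<kappa>] conjI allI)
qed

end

theorem theorem9p5:
  fixes \<gamma> :: "real \<Rightarrow> real" and K :: real
    and xo :: "'a::polish_space"
    and c :: "'a \<Rightarrow> 'a measure \<Rightarrow> ennreal"
    and \<mu> \<nu> :: "'a measure"
  assumes gamma_nonneg: "\<And>u. u \<ge> 0 \<Longrightarrow> \<gamma> u \<ge> 0"
    and gamma_lsc: "lsc_map (top_of_set {0..}) \<gamma>"
    and gamma_zero: "\<gamma> 0 = 0"
    and gamma_add: "\<And>u v. u \<ge> 0 \<Longrightarrow> v \<ge> 0 \<Longrightarrow> \<gamma> (u + v) \<le> K * (\<gamma> u + \<gamma> v)"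
    and c_measurable: "(\<lambda>(x, p). c x p) \<in> borel_measurable (borel \<Otimes>\<^sub>M P_gamma_algebra \<gamma> xo)"
    and cond: "cond_C \<gamma> xo c \<or> cond_C' \<gamma> xo c \<or> cond_C'' \<gamma> xo c"
    and mu: "\<mu> \<in> P_gamma \<gamma> xo"
    and nu: "\<nu> \<in> P_gamma \<gamma> xo"
  shows "enn2ereal (T_cost \<gamma> xo c \<nu> \<mu>) =
    (SUP \<phi>\<in>Phi_gamma_b \<gamma> xo.
       ereal_integral \<mu> (R_cost \<gamma> xo c \<phi>) - ereal (\<integral>y. \<phi> y \<partial>\<nu>))"
proof -
  interpret weighted_cost \<gamma> xo c
    by unfold_locales (fact gamma_nonneg gamma_lsc gamma_zero c_measurable)+
  have C: "C1 \<gamma> xo c" "C2 \<gamma> xo c" "C4 \<gamma> xo c"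
    using cond C3''_imp_C1 unfolding cond_C_def cond_C'_def cond_C''_def by blast+
  have sel: "selectable \<phi> B" if "\<phi> \<in> Phi_weight w" "0 \<le> B" "\<And>y. - B \<le> \<phi> y" for \<phi> B
    using cond selectable_C3 selectable_C3'[OF _ that(1,3)] selectable_C3''
    unfolding cond_C_def cond_C'_def cond_C''_def by blast
  show ?thesis by (rule duality[OF C sel mu nu])
qed

end
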